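(* Let $d\in\mathbb N$, $z>0$. Let $a:\mathbb R^d\to[0,\infty]$ and $b:\mathbb R^d\to[0,\infty]$ be measurable and even functions with $a,b\in L^1(\mathbb R^d,dx)$ and $\operatorname{ess\,sup}_{x\in\mathbb R^d}b(x)<\infty$. Let $(\mathcal E_0,D(\mathcal E_0))$ be the closure in $L^2(\Gamma,\pi_z)$ of the form $\mathcal E_0(F,G)=\int_\Gamma(-L_0F)(\gamma)G(\gamma)\,\pi_z(d\gamma)$, $F,G\in\mathscr F_{\mathrm{exp}}$, where $$\begin{aligned}(L_0F)(\gamma):=\langle a\rangle^2\Big[&\sum_{\{x_1,x_2\}\subset\gamma}b(x_2-x_1)\big(F(\gamma\setminus\{x_1,x_2\})-F(\gamma)\big)\\&+\frac12\int_{\mathbb R^d}z\,dx_1\int_{\mathbb R^d}z\,dx_2\,b(x_2-x_1)\big(F(\gamma\cup\{x_1,x_2\})-F(\gamma)\big)\\&+z\langle b\rangle\sum_{x\in\gamma}\big(F(\gamma\setminus\{x\})-F(\gamma)\big)+z\langle b\rangle\int_{\mathbb R^d}z\,dx\,\big(F(\gamma\cup\{x\})-F(\gamma)\big)\Big].\end{aligned}$$ Then $(\mathcal E_0,D(\mathcal E_0))$ satisfies the Poincaré inequality: $$\mathcal E_0(F,F)\ge\langle a\rangle^2z\langle b\rangle\int_\Gamma\big(F(\gamma)-\langle F\rangle_{\pi_z}\big)^2\pi_z(d\gamma),\quad F\in D(\mathcal E_0),$$ where $\langle F\rangle_{\pi_z}:=\int_\Gamma F(\gamma)\,\pi_z(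d\gamma)$.
   Context: $\Gamma$ is the set of all locally finite subsets $\gamma\subset\mathbb R^d$, identified with the Radon measures $\sum_{x\in\gamma}\delta_x$ and equipped with the relative vague topology; $\langle\varphi,\gamma\rangle:=\sum_{x\in\gamma}\varphi(x)$, and for $f\in L^1(\mathbb R^d,dx)$, $\langle f\rangle:=\int_{\mathbb R^d}f(x)\,dx$. $\pi_z$ is the Poisson measure on $(\Gamma,\mathcal B(\Gamma))$ with intensity measure $z\,dx$. $\mathscr F_{\mathrm{exp}}$ is the linear span of $\{e^{\langle\varphi,\cdot\rangle}:\varphi\in C_0(\mathbb R^d)\}$, where $C_0(\mathbb R^d)$ is the space of continuous real functions with compact support. The form $(\mathcal E_0,\mathscr F_{\mathrm{exp}})$ is symmetric and closable in $L^2(\Gamma,\pi_z)$. *)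

theory Defs
  imports "HOL-Probability.Probability"
begin

section \<open>Configuration space\<close>

definition configs :: "'a::euclidean_space set set" where
  "configs = {\<gamma>. \<forall>K. compact K \<longrightarrow> finite (\<gamma> \<inter> K)}"

definition C0 :: "('a::euclidean_space \<Rightarrow> real) set" where
  "C0 = {\<phi>. continuous_on UNIV \<phi> \<and> compact (closure {x. \<phi> x \<noteq> 0})}"

text \<open>For \<open>\<phi>\<close> in \<^const>\<open>C0\<close> and \<open>\<gamma>\<close> in \<^const>\<open>configs\<close> only finitely many terms are nonzero.\<close>

definition pairing :: "('a::euclidean_space \<Rightarrow> real) \<Rightarrow> 'a set \<Rightarrow> real" where
  "pairing \<phi> \<gamma> = (\<Sum>\<^sub>\<infinity>x\<in>\<gamma>. \<phi> x)"

text \<open>The vague topology on Radon measures, restricted to configurations, is the coarsest topology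
  making \<open>\<gamma> \<mapsto> \<langle>\<phi>, \<gamma>\<rangle>\<close> continuous for every \<open>\<phi>\<close> in \<^const>\<open>C0\<close>.\<close>

definition vague_topology :: "'a::euclidean_space set topology" where
  "vague_topology =
     topology_generated_by {{\<gamma> \<in> configs. pairing \<phi> \<gamma> \<in> U} | \<phi> U. \<phi> \<in> C0 \<and> open U}"

definition config_borel :: "'a::euclidean_space set measure" where
  "config_borel = sigma configs {U. openin vague_topology U}"

text \<open>\<open>poisson_measure z \<pi>\<close>: \<open>\<pi>\<close> is the Poisson measure with intensity \<open>z dx\<close>, i.e. the number of points
  in a bounded Borel set \<open>B\<close> is Poisson distributed with mean \<open>z |B|\<close>, and the numbers of points in
  disjoint sets are independent.  The Poisson weights are written out because
  \<^const>\<open>poisson_pmf\<close> is only specified for a positive rate, whereas \<open>B\<close> may be a null set.\<close>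

definition poisson_measure :: "real \<Rightarrow> 'a::euclidean_space set measure \<Rightarrow> bool" where
  "poisson_measure z \<pi> \<longleftrightarrow>
     prob_space \<pi> \<and> space \<pi> = configs \<and> sets \<pi> = sets config_borel \<and>
     (\<forall>B\<in>sets borel. bounded B \<longrightarrow>
        (\<forall>n. measure \<pi> {\<gamma> \<in> configs. card (\<gamma> \<inter> B) = n}
              = (z * measure lborel B) ^ n / fact n * exp (- (z * measure lborel B)))) \<and>
     (\<forall>\<B>. finite \<B> \<and> disjoint \<B> \<and> (\<forall>B\<in>\<B>. B \<in> sets borel \<and> bounded B) \<longrightarrow>
        prob_space.indep_vars \<pi> (\<lambda>_. count_space UNIV) (\<lambda>B \<gamma>. card (\<gamma> \<inter> B)) \<B>)"

definition F_exp :: "('a::euclidean_space set \<Rightarrow> real) set" where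
  "F_exp = {F. \<exists>(n::nat) c \<phi>. (\<forall>i<n. \<phi> i \<in> C0) \<and> F = (\<lambda>\<gamma>. \<Sum>i<n. c i * exp (pairing (\<phi> i) \<gamma>))}"


section \<open>The generator and its form\<close>

definition integral_dx :: "('a::euclidean_space \<Rightarrow> ennreal) \<Rightarrow> real" where
  "integral_dx f = enn2real (\<integral>\<^sup>+x. f x \<partial>lborel)"

text \<open>The sum over unordered pairs \<open>{x1, x2} \<subseteq> \<gamma>\<close> is half the sum over ordered pairs of distinct points
  (\<open>b\<close> is even).  For integrable \<open>b\<close> the set where \<open>b\<close> is infinite has measure zero, so
  that the value \<open>enn2real \<infinity> = 0\<close> plays no role almost surely.\<close>

definition L0 :: "('a::euclidean_space \<Rightarrow> ennreal) \<Rightarrow> ('a \<Rightarrow> ennreal) \<Rightarrow> real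
    \<Rightarrow> ('a set \<Rightarrow> real) \<Rightarrow> 'a set \<Rightarrow> real" where
  "L0 a b z F \<gamma> = (integral_dx a)\<^sup>2 *
     ( 1/2 * (\<Sum>\<^sub>\<infinity>(x1, x2)\<in>{(x1, x2). x1 \<in> \<gamma> \<and> x2 \<in> \<gamma> \<and> x1 \<noteq> x2}.
          enn2real (b (x2 - x1)) * (F (\<gamma> - {x1, x2}) - F \<gamma>))
     + 1/2 * (LINT x1|lborel. z * (LINT x2|lborel. z *
          (enn2real (b (x2 - x1)) * (F (\<gamma> \<union> {x1, x2}) - F \<gamma>))))
     + z * integral_dx b * (\<Sum>\<^sub>\<infinity>x\<in>\<gamma>. F (\<gamma> - {x}) - F \<gamma>)
     + z * integral_dx b * (LINT x|lborel. z * (F (\<gamma> \<union> {x}) - F \<gamma>)))"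

definition E0 :: "('a::euclidean_space \<Rightarrow> ennreal) \<Rightarrow> ('a \<Rightarrow> ennreal) \<Rightarrow> real \<Rightarrow> 'a set measure
    \<Rightarrow> ('a set \<Rightarrow> real) \<Rightarrow> ('a set \<Rightarrow> real) \<Rightarrow> real" where
  "E0 a b z \<pi> F G = (LINT \<gamma>|\<pi>. (- L0 a b z F \<gamma>) * G \<gamma>)"


section \<open>Closure of a form in \<open>L\<^sup>2\<close>\<close>

text \<open>Elements of \<open>L\<^sup>2(M)\<close> are represented by functions; all notions below respect equality
  almost everywhere.\<close>

definition L2 :: "'b measure \<Rightarrow> ('b \<Rightarrow> real) set" where
  "L2 M = {F \<in> borel_measurable M. integrable M (\<lambda>x. (F x)\<^sup>2)}"

definition form_approx :: "'b measure \<Rightarrow> (('b \<Rightarrow> real) \<Rightarrow> ('b \<Rightarrow> real) \<Rightarrow> real) \<Rightarrow> ('b \<Rightarrow> real) set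
    \<Rightarrow> (nat \<Rightarrow> 'b \<Rightarrow> real) \<Rightarrow> ('b \<Rightarrow> real) \<Rightarrow> bool" where
  "form_approx M \<E> \<D> Fs F \<longleftrightarrow>
     (\<forall>n. Fs n \<in> \<D>) \<and>
     (\<lambda>n. \<integral>\<^sup>+x. ennreal ((Fs n x - F x)\<^sup>2) \<partial>M) \<longlonglongrightarrow> 0 \<and>
     (\<forall>e>0. \<exists>N. \<forall>m\<ge>N. \<forall>n\<ge>N. \<bar>\<E> (\<lambda>x. Fs m x - Fs n x) (\<lambda>x. Fs m x - Fs n x)\<bar> < e)"

definition closure_dom :: "'b measure \<Rightarrow> (('b \<Rightarrow> real) \<Rightarrow> ('b \<Rightarrow> real) \<Rightarrow> real) \<Rightarrow> ('b \<Rightarrow> real) set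
    \<Rightarrow> ('b \<Rightarrow> real) set" where
  "closure_dom M \<E> \<D> = {F \<in> L2 M. \<exists>Fs. form_approx M \<E> \<D> Fs F}"

text \<open>For a closable symmetric nonnegative form the limit below exists and does not depend on the
  approximating sequences, so it is immaterial which ones are selected.\<close>

definition form_closure :: "'b measure \<Rightarrow> (('b \<Rightarrow> real) \<Rightarrow> ('b \<Rightarrow> real) \<Rightarrow> real) \<Rightarrow> ('b \<Rightarrow> real) set
    \<Rightarrow> ('b \<Rightarrow> real) \<Rightarrow> ('b \<Rightarrow> real) \<Rightarrow> real" where
  "form_closure M \<E> \<D> F G =
     (let approx = (\<lambda>H. SOME Hs. form_approx M \<E> \<D> Hs H)
      in lim (\<lambda>n. \<E> (approx F n) (approx G n)))"

end

theory Submission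
  imports Defs "HOL-Real_Asymp.Real_Asymp"
begin

text \<open>
  Write \<open>e\<^sub>\<phi> = exp \<langle>\<phi>, \<cdot>\<rangle>\<close> and \<open>f\<^sub>\<phi> = exp \<phi> - 1\<close>.  Adding or removing a point multiplies \<open>e\<^sub>\<phi>\<close> by
  \<open>exp (\<plusminus> \<phi> x)\<close>, so each of the four parts of the generator acts on \<open>e\<^sub>\<phi>\<close> as multiplication by an explicit
  function of the configuration.  The Mecke formula for one and for two points converts the sums over
  points into Lebesgue integrals, and the death and birth terms combine into a square.  For
  \<open>F = \<Sum>\<^sub>i c\<^sub>i e\<^sub>\<phi>\<^sub>i\<close> this gives
  \<open>\<E>\<^sub>0(F, F) = \<langle>a\<rangle>\<^sup>2 \<Sum>\<^sub>i\<^sub>j c\<^sub>i c\<^sub>j (P\<^sub>i\<^sub>j / 2 + z \<langle>b\<rangle> t\<^sub>i\<^sub>j) E[e\<^sub>\<phi>\<^sub>i e\<^sub>\<phi>\<^sub>j]\<close> (lemma \<open>E0_esum\<close>), where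
  \<open>t\<^sub>i\<^sub>j = z \<integral> f\<^sub>\<phi>\<^sub>i f\<^sub>\<phi>\<^sub>j dx\<close> comes from single points and \<open>P\<^sub>i\<^sub>j\<close> from pairs.

  The pair part is an integral of quadratic forms in the matrix \<open>E[e\<^sub>\<phi>\<^sub>i e\<^sub>\<phi>\<^sub>j]\<close>, which is a Gram matrix, so it
  is nonnegative and may be dropped (\<open>pair_form_psd\<close>).  The single point part is \<open>\<langle>a\<rangle>\<^sup>2 z \<langle>b\<rangle>\<close> times the
  standard Dirichlet form of the Poisson measure, whose Poincare constant is 1.  On exponentials the
  latter is elementary: with \<open>\<alpha>\<^sub>i = E[e\<^sub>\<phi>\<^sub>i]\<close> the Laplace functional gives
  \<open>E[e\<^sub>\<phi>\<^sub>i e\<^sub>\<phi>\<^sub>j] = \<alpha>\<^sub>i \<alpha>\<^sub>j exp t\<^sub>i\<^sub>j\<close>, so the claim is positivity of the quadratic form with matrix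
  \<open>t\<^sub>i\<^sub>j exp t\<^sub>i\<^sub>j - exp t\<^sub>i\<^sub>j + 1\<close>.  The function \<open>t exp t - exp t + 1\<close> has a power series with nonnegative
  coefficients, and all entrywise powers of the Gram matrix \<open>t\<^sub>i\<^sub>j\<close> are positive semidefinite
  (\<open>point_form_power_psd\<close>, \<open>poisson_poincare\<close>).

  The Mecke formulas are obtained from the definition of the Poisson measure in three stages: the
  Laplace functional (\<open>nn_laplace\<close>), its first and second differences in directions of indicator
  functions, which are moments of point counts weighted by \<open>e\<^sub>\<phi>\<close> (\<open>integral_card_exp\<close>,
  \<open>integral_card_card_exp\<close>), and the extension from rectangles to all integrands by uniqueness of
  measures (\<open>campbell1\<close>, \<open>campbell2\<close>).  Finally, the inequality passes to the closure because
  nonnegativity of \<open>\<E>\<^sub>0\<close> makes \<open>\<E>\<^sub>0(F\<^sub>n, F\<^sub>n)\<close> converge along form-Cauchy sequences, while the variance is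
  continuous in \<open>L\<^sup>2\<close> (\<open>closure_poincare\<close>).
\<close>

section \<open>Measurability of sums over random point sets\<close>

text \<open>On \<open>B n\<close> the sum is finite, so the measurable sets of pairs whose indicator has a measurable sum
  form a Dynkin system: a complement is the difference to the finite total count.  The integrand may
  depend on \<open>\<omega>\<close> as well as on the point, because the jumps of the generator involve values of \<open>F\<close>
  at the configuration itself.\<close>
lemma borel_measurable_sum_points:
  fixes S :: "'b \<Rightarrow> 'x set" and H :: "'b \<times> 'x \<Rightarrow> ennreal" and B :: "nat \<Rightarrow> 'x set"
  assumes fin: "\<And>\<omega> n. \<omega> \<in> space M \<Longrightarrow> finite (S \<omega> \<inter> B n)"
    and card: "\<And>n A. A \<in> sets N \<Longrightarrow> (\<lambda>\<omega>. card (S \<omega> \<inter> (B n \<inter> A))) \<in> measurable M (count_space UNIV)"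
    and B: "incseq B" "(\<Union>n. B n) = UNIV" and space_N: "space N = UNIV"
    and H: "H \<in> borel_measurable (M \<Otimes>\<^sub>M N)"
  shows "(\<lambda>\<omega>. \<integral>\<^sup>+x. H (\<omega>, x) \<partial>count_space (S \<omega>)) \<in> borel_measurable M"
proof -
  have card': "(\<lambda>\<omega>. of_nat (card (S \<omega> \<inter> (B n \<inter> A))) :: ennreal) \<in> borel_measurable M"
    if "A \<in> sets N" for n A
    using measurable_compose[OF card[OF that], of of_nat borel n] by simp
  have fin_meas: "(\<lambda>\<omega>. \<integral>\<^sup>+x. H (\<omega>, x) \<partial>count_space (S \<omega> \<inter> B n)) \<in> borel_measurable M" for n
    using H
  proof (induction rule: borel_measurable_induct)
    case (cong f g)
    then have "(\<integral>\<^sup>+x. f (\<omega>, x) \<partial>count_space (S \<omega> \<inter> B n)) = (\<integral>\<^sup>+x. g (\<omega>, x) \<partial>count_space (S \<omega> \<inter> B n))"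
      if "\<omega> \<in> space M" for \<omega>
      using that by (intro nn_integral_cong) (auto simp: space_pair_measure space_N)
    then show ?case using cong by (subst measurable_cong[of M _ "\<lambda>\<omega>. \<integral>\<^sup>+x. g (\<omega>, x) \<partial>count_space (S \<omega> \<inter> B n)"]) auto
  next
    case (set A)
    have sub: "{a \<times> b |a b. a \<in> sets M \<and> b \<in> sets N} \<subseteq> Pow (space M \<times> space N)"
      using sets.space_closed[of M] sets.space_closed[of N] by auto
    from Int_stable_pair_measure_generator sub set[unfolded sets_pair_measure]
    show ?case
    proof (induct rule: sigma_sets_induct_disjoint)
      case (basic A)
      then obtain a b where A: "A = a \<times> b" "a \<in> sets M" "b \<in> sets N" by auto
      have "(\<integral>\<^sup>+x. indicator A (\<omega>, x) \<partial>count_space (S \<omega> \<inter> B n)) = indicator a \<omega> * of_nat (card (S \<omega> \<inter> (B n \<inter> b)))"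
        if "\<omega> \<in> space M" for \<omega>
      proof -
        have "(\<integral>\<^sup>+x. indicator A (\<omega>, x) \<partial>count_space (S \<omega> \<inter> B n))
            = indicator a \<omega> * (\<integral>\<^sup>+x. indicator b x \<partial>count_space (S \<omega> \<inter> B n))"
          unfolding A by (subst nn_integral_cmult[symmetric]) (auto simp: indicator_times)
        also have "(\<integral>\<^sup>+x. indicator b x \<partial>count_space (S \<omega> \<inter> B n)) = of_nat (card (S \<omega> \<inter> (B n \<inter> b)))"
          using fin[OF that, of n]
          by (simp add: nn_integral_count_space_finite sum.If_cases indicator_def Int_assoc flip: of_nat_sum)
        finally show ?thesis .
      qed
      then show ?case
        using card'[of b n] A
        by (subst measurable_cong[where g="\<lambda>\<omega>. indicator a \<omega> * of_nat (card (S \<omega> \<inter> (B n \<inter> b)))"])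
           (auto intro!: borel_measurable_times_ennreal borel_measurable_indicator)
    next
      case empty
      then show ?case by simp
    next
      case (compl A)
      have "(\<integral>\<^sup>+x. indicator (space M \<times> space N - A) (\<omega>, x) \<partial>count_space (S \<omega> \<inter> B n))
         = of_nat (card (S \<omega> \<inter> (B n \<inter> space N))) - (\<integral>\<^sup>+x. indicator A (\<omega>, x) \<partial>count_space (S \<omega> \<inter> B n))"
        if w: "\<omega> \<in> space M" for \<omega>
      proof -
        have f: "finite (S \<omega> \<inter> B n)" by (rule fin[OF w])
        have "(\<integral>\<^sup>+x. indicator (space M \<times> space N - A) (\<omega>, x) \<partial>count_space (S \<omega> \<inter> B n))
           = (\<integral>\<^sup>+x. 1 - indicator A (\<omega>, x) \<partial>count_space (S \<omega> \<inter> B n))"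
          using w by (intro nn_integral_cong) (auto simp: space_N indicator_def)
        also have "\<dots> = (\<integral>\<^sup>+x. 1 \<partial>count_space (S \<omega> \<inter> B n)) - (\<integral>\<^sup>+x. indicator A (\<omega>, x) \<partial>count_space (S \<omega> \<inter> B n))"
        proof (rule nn_integral_diff)
          have "(\<integral>\<^sup>+x. indicator A (\<omega>, x) \<partial>count_space (S \<omega> \<inter> B n)) \<le> (\<integral>\<^sup>+x. 1 \<partial>count_space (S \<omega> \<inter> B n))"
            by (intro nn_integral_mono) (auto simp: indicator_def)
          also have "\<dots> < \<infinity>" using f by (simp add: emeasure_count_space_finite of_nat_less_top)
          finally show "(\<integral>\<^sup>+x. indicator A (\<omega>, x) \<partial>count_space (S \<omega> \<inter> B n)) \<noteq> \<infinity>" by simp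
        qed (auto simp: indicator_def)
        finally show ?thesis using f by (simp add: space_N)
      qed
      then show ?case
        using compl card'[of "space N" n]
        by (subst measurable_cong[where g="\<lambda>\<omega>. of_nat (card (S \<omega> \<inter> (B n \<inter> space N)))
              - (\<integral>\<^sup>+x. indicator A (\<omega>, x) \<partial>count_space (S \<omega> \<inter> B n))"]) (auto intro!: borel_measurable_minus_ennreal)
    next
      case (union A)
      have disj: "disjoint_family A" by fact
      have "(\<integral>\<^sup>+x. indicator (\<Union>i. A i) (\<omega>, x) \<partial>count_space (S \<omega> \<inter> B n))
         = (\<Sum>i. \<integral>\<^sup>+x. indicator (A i) (\<omega>, x) \<partial>count_space (S \<omega> \<inter> B n))" for \<omega>
        by (subst nn_integral_suminf[symmetric]) (auto intro!: nn_integral_cong simp: suminf_indicator[OF disj])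
      then show ?case using union by (auto intro!: borel_measurable_suminf)
    qed
  next
    case (mult u c)
    then show ?case
      by (subst nn_integral_cmult) auto
  next
    case (add u v)
    then show ?case
      by (subst nn_integral_add) auto
  next
    case (seq U)
    have "(\<integral>\<^sup>+x. (SUP i. U i) (\<omega>, x) \<partial>count_space (S \<omega> \<inter> B n))
       = (SUP i. \<integral>\<^sup>+x. U i (\<omega>, x) \<partial>count_space (S \<omega> \<inter> B n))" for \<omega>
      using seq by (subst nn_integral_monotone_convergence_SUP[symmetric])
         (auto simp: incseq_def le_fun_def image_comp SUP_apply)
    then show ?case using seq by (auto intro!: borel_measurable_SUP)
  qed
  have "(\<integral>\<^sup>+x. H (\<omega>, x) \<partial>count_space (S \<omega>)) = (SUP n. \<integral>\<^sup>+x. H (\<omega>, x) \<partial>count_space (S \<omega> \<inter> B n))" for \<omega>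
  proof -
    have 1: "(\<integral>\<^sup>+x. H (\<omega>, x) \<partial>count_space A) = (\<integral>\<^sup>+x. H (\<omega>, x) * indicator A x \<partial>count_space UNIV)" for A
      by (subst nn_integral_count_space_indicator) auto
    have mono: "incseq (\<lambda>n x. H (\<omega>, x) * indicator (S \<omega> \<inter> B n) x)"
      using B(1) by (auto simp: incseq_def le_fun_def indicator_def)
    have "(SUP n. H (\<omega>, x) * indicator (S \<omega> \<inter> B n) x) = H (\<omega>, x) * indicator (S \<omega>) x" for x
    proof -
      obtain n where "x \<in> B n" using B(2) by blast
      then show ?thesis
        by (intro antisym SUP_least SUP_upper2[of n]) (auto simp: indicator_def)
    qed
    then show ?thesis
      unfolding 1 using mono by (subst nn_integral_monotone_convergence_SUP[symmetric]) auto
  qed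
  then show ?thesis using fin_meas by (auto intro!: borel_measurable_SUP)
qed

text \<open>The integral is 0 by convention at every \<open>\<omega>\<close> where the sum does not converge absolutely.  The set of
  these \<open>\<omega>\<close> is measurable, so measurability holds without an exceptional null set; this matters since
  the Poisson measure is not assumed complete.\<close>
lemma borel_measurable_integral_points:
  fixes S :: "'b \<Rightarrow> 'x set" and H :: "'b \<times> 'x \<Rightarrow> real"
  assumes nn: "\<And>G::'b \<times> 'x \<Rightarrow> ennreal. G \<in> borel_measurable (M \<Otimes>\<^sub>M N) \<Longrightarrow>
      (\<lambda>\<omega>. \<integral>\<^sup>+x. G (\<omega>, x) \<partial>count_space (S \<omega>)) \<in> borel_measurable M"
    and H[measurable]: "H \<in> borel_measurable (M \<Otimes>\<^sub>M N)"
  shows "(\<lambda>\<omega>. LINT x|count_space (S \<omega>). H (\<omega>, x)) \<in> borel_measurable M"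
proof -
  have [measurable]: "(\<lambda>\<omega>. \<integral>\<^sup>+x. ennreal (H (\<omega>, x)) \<partial>count_space (S \<omega>)) \<in> borel_measurable M"
    "(\<lambda>\<omega>. \<integral>\<^sup>+x. ennreal (- H (\<omega>, x)) \<partial>count_space (S \<omega>)) \<in> borel_measurable M"
    "(\<lambda>\<omega>. \<integral>\<^sup>+x. ennreal (norm (H (\<omega>, x))) \<partial>count_space (S \<omega>)) \<in> borel_measurable M"
    by (rule nn, measurable)+
  have "(LINT x|count_space (S \<omega>). H (\<omega>, x)) =
     (if (\<integral>\<^sup>+x. ennreal (norm (H (\<omega>, x))) \<partial>count_space (S \<omega>)) < \<infinity>
      then enn2real (\<integral>\<^sup>+x. ennreal (H (\<omega>, x)) \<partial>count_space (S \<omega>))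
         - enn2real (\<integral>\<^sup>+x. ennreal (- H (\<omega>, x)) \<partial>count_space (S \<omega>))
      else 0)" for \<omega>
    by (auto simp: integrable_iff_bounded not_integrable_integral_eq intro!: real_lebesgue_integral_def)
  then show ?thesis by (simp only:) measurable
qed

text \<open>For reals, unconditional and absolute summability coincide, and both sides are 0 when it fails.\<close>
lemma infsum_eq_integral_count_space:
  fixes f :: "'x \<Rightarrow> real"
  shows "infsum f A = (LINT x|count_space A. f x)"
proof (cases "f summable_on A")
  case True
  then have "Infinite_Set_Sum.abs_summable_on f A"
    using summable_on_iff_abs_summable_on_real[of f A] abs_summable_equivalent[of f A] by blast
  then show ?thesis by (simp add: infsetsum_def flip: infsetsum_infsum)
next
  case False
  then have "\<not> integrable (count_space A) f"
    using abs_summable_equivalent[of f A] summable_on_iff_abs_summable_on_real[of f A]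
    by (simp add: abs_summable_on_def)
  then show ?thesis using False by (simp add: infsum_not_exists not_integrable_integral_eq)
qed

section \<open>Bounded measurable functions with bounded support\<close>

text \<open>Unlike continuous functions, this class contains step functions and the perturbations of
  a function by multiples of an indicator.\<close>
definition test_fun :: "('a::euclidean_space \<Rightarrow> real) \<Rightarrow> bool" where
  "test_fun \<phi> \<longleftrightarrow> \<phi> \<in> borel_measurable borel \<and> bounded (range \<phi>) \<and> bounded {x. \<phi> x \<noteq> 0}"

lemma test_fun_bound:
  assumes "test_fun \<phi>"
  obtains C r where "C > 0" "\<And>x. \<bar>\<phi> x\<bar> \<le> C * indicator (ball 0 r) x"
proof -
  obtain C where C: "C > 0" "\<And>x. \<bar>\<phi> x\<bar> \<le> C"
    using assms by (auto simp: test_fun_def bounded_pos)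
  obtain r where r: "{x. \<phi> x \<noteq> 0} \<subseteq> ball 0 r"
    using assms bounded_subset_ballD[of "{x. \<phi> x \<noteq> 0}" 0] by (auto simp: test_fun_def)
  have "\<bar>\<phi> x\<bar> \<le> C * indicator (ball 0 r) x" for x
    using C(2)[of x] r by (cases "x \<in> ball 0 r") (auto simp: indicator_def)
  with C(1) show thesis by (rule that)
qed

lemma test_funI:
  assumes "\<phi> \<in> borel_measurable borel" "\<And>x. \<bar>\<phi> x\<bar> \<le> C * indicator B x" "bounded B"
  shows "test_fun \<phi>"
proof -
  have "\<bar>\<phi> x\<bar> \<le> \<bar>C\<bar>" for x using assms(2)[of x] by (auto split: split_indicator split_indicator_asm)
  then have "bounded (range \<phi>)" by (auto simp: bounded_iff)
  moreover have "{x. \<phi> x \<noteq> 0} \<subseteq> B" using assms(2) by (force split: split_indicator_asm)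
  ultimately show ?thesis using assms bounded_subset by (auto simp: test_fun_def)
qed

lemma test_fun_add:
  assumes "test_fun \<phi>" "test_fun \<psi>" shows "test_fun (\<lambda>x. \<phi> x + \<psi> x)"
proof -
  obtain C r D s where *: "\<And>x. \<bar>\<phi> x\<bar> \<le> C * indicator (ball 0 r) x" "C > 0"
    "\<And>x. \<bar>\<psi> x\<bar> \<le> D * indicator (ball 0 s) x" "D > 0"
    using assms by (metis test_fun_bound)
  have "\<bar>\<phi> x + \<psi> x\<bar> \<le> (C + D) * indicator (ball 0 r \<union> ball 0 s) x" for x
    using *(1)[of x] *(3)[of x] *(2,4) by (auto split: split_indicator split_indicator_asm)
  then show ?thesis using assms by (intro test_funI) (auto simp: test_fun_def)
qed

lemma test_fun_indicator:
  assumes "A \<in> sets borel" "bounded A" shows "test_fun (\<lambda>x. s * indicator A x)"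
  using assms by (intro test_funI[where C="\<bar>s\<bar>" and B=A]) (auto simp: indicator_def)

lemma abs_exp_minus_one_le: 
  fixes x :: real assumes "\<bar>x\<bar> \<le> C" shows "\<bar>exp x - 1\<bar> \<le> exp C * \<bar>x\<bar>"
proof (cases "x \<ge> 0")
  case True
  have "exp x * (1 - x) \<le> exp x * exp (- x)"
    using exp_ge_add_one_self[of "-x"] by (intro mult_left_mono) auto
  then have "exp x - 1 \<le> exp x * x" by (simp add: exp_minus field_simps)
  also have "\<dots> \<le> exp C * x" using True assms by (intro mult_right_mono) auto
  finally show ?thesis using True by simp
next
  case False
  have "1 - exp x \<le> - x" using exp_ge_add_one_self[of x] by linarith
  also have "\<dots> \<le> exp C * (- x)" using False assms mult_right_mono[of 1 "exp C" "-x"] by auto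
  finally show ?thesis using False by simp
qed

lemma test_fun_exp_minus_one:
  assumes "test_fun \<phi>" shows "test_fun (\<lambda>x. exp (\<phi> x) - 1)"
proof -
  obtain C r where *: "\<And>x. \<bar>\<phi> x\<bar> \<le> C * indicator (ball 0 r) x" "C > 0"
    using assms by (metis test_fun_bound)
  have "\<bar>exp (\<phi> x) - 1\<bar> \<le> (exp C * C) * indicator (ball 0 r) x" for x
    using *(1)[of x] abs_exp_minus_one_le[of "\<phi> x" C] *(2)
      order_trans[OF _ mult_left_mono[of "\<bar>\<phi> x\<bar>" C "exp C"]]
    by (auto split: split_indicator split_indicator_asm)
  then show ?thesis using assms by (intro test_funI) (auto simp: test_fun_def)
qed

lemma test_fun_integrable:
  assumes "test_fun \<phi>" shows "integrable lborel \<phi>"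
proof -
  obtain C r where *: "\<And>x. \<bar>\<phi> x\<bar> \<le> C * indicator (ball 0 r) x" "C > 0"
    using assms by (metis test_fun_bound)
  have "integrable lborel (\<lambda>x. C * indicator (ball 0 r) x)"
    by (intro integrable_mult_right integrable_real_indicator) (auto simp: emeasure_bounded_finite[OF bounded_ball, simplified])
  then show ?thesis
  proof (rule Bochner_Integration.integrable_bound)
    show "AE x in lborel. norm (\<phi> x) \<le> norm (C * indicator (ball 0 r) x)"
      using * by (intro always_eventually allI) (auto split: split_indicator split_indicator_asm)
  qed (use assms in \<open>simp add: test_fun_def\<close>)
qed

lemma C0_test_fun: assumes "\<phi> \<in> C0" shows "test_fun \<phi>"
proof -
  have c: "continuous_on UNIV \<phi>" and K: "compact (closure {x. \<phi> x \<noteq> 0})" using assms by (auto simp: C0_def)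
  have b: "bounded {x. \<phi> x \<noteq> 0}" using K compact_imp_bounded bounded_closure bounded_subset closure_subset by metis
  have "compact (\<phi> ` closure {x. \<phi> x \<noteq> 0})"
    using K c by (intro compact_continuous_image continuous_on_subset[OF c]) auto
  then have "bounded (insert 0 (\<phi> ` closure {x. \<phi> x \<noteq> 0}))" by (simp add: compact_imp_bounded)
  moreover have "range \<phi> \<subseteq> insert 0 (\<phi> ` closure {x. \<phi> x \<noteq> 0})" using closure_subset[of "{x. \<phi> x \<noteq> 0}"] by blast
  ultimately have "bounded (range \<phi>)" using bounded_subset by blast
  then show ?thesis using b c by (simp add: test_fun_def borel_measurable_continuous_onI)
qed

section \<open>Configurations and pairings\<close>

definition offdiag :: "'a set \<Rightarrow> ('a \<times> 'a) set" where
  "offdiag \<gamma> = {(x1, x2). x1 \<in> \<gamma> \<and> x2 \<in> \<gamma> \<and> x1 \<noteq> x2}"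

lemma configs_finite_Int:
  assumes "\<gamma> \<in> configs" "bounded B" shows "finite (\<gamma> \<inter> B)"
proof (rule finite_subset)
  show "\<gamma> \<inter> B \<subseteq> \<gamma> \<inter> closure B" using closure_subset by blast
  show "finite (\<gamma> \<inter> closure B)" using assms by (simp add: configs_def compact_closure)
qed

lemma configs_countable: assumes "\<gamma> \<in> configs" shows "countable \<gamma>"
proof -
  have "\<gamma> = (\<Union>n::nat. \<gamma> \<inter> ball 0 (real n))"
    using reals_Archimedean2 by auto
  moreover have "countable (\<Union>n::nat. \<gamma> \<inter> ball 0 (real n))"
    using assms by (intro countable_UN) (auto intro!: countable_finite configs_finite_Int)
  ultimately show ?thesis by simp
qed

lemma configs_mono:
  assumes "\<gamma> \<in> configs" "\<gamma>' \<subseteq> \<gamma>" shows "\<gamma>' \<in> configs"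
proof -
  have "finite (\<gamma>' \<inter> K)" if "compact K" for K
  proof (rule finite_subset)
    show "\<gamma>' \<inter> K \<subseteq> \<gamma> \<inter> K" using assms by blast
    show "finite (\<gamma> \<inter> K)" using assms that by (simp add: configs_def)
  qed
  then show ?thesis by (simp add: configs_def)
qed

lemma configs_insert: "\<gamma> \<in> configs \<Longrightarrow> insert x \<gamma> \<in> configs"
  by (auto simp: configs_def Int_insert_left)

lemma pairing_eq_sum:
  assumes "\<gamma> \<in> configs" "bounded B" "{x. \<phi> x \<noteq> 0} \<subseteq> B"
  shows "pairing \<phi> \<gamma> = (\<Sum>x\<in>\<gamma> \<inter> B. \<phi> x)"
proof -
  have "pairing \<phi> \<gamma> = infsum \<phi> (\<gamma> \<inter> B)"
    unfolding pairing_def using assms(3) by (intro infsum_cong_neutral) auto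
  then show ?thesis using configs_finite_Int[OF assms(1,2)] by simp
qed

lemma pairing_add:
  assumes "\<gamma> \<in> configs" "test_fun \<phi>" "test_fun \<psi>"
  shows "pairing (\<lambda>x. \<phi> x + \<psi> x) \<gamma> = pairing \<phi> \<gamma> + pairing \<psi> \<gamma>"
proof -
  define B where "B = {x. \<phi> x \<noteq> 0} \<union> {x. \<psi> x \<noteq> 0}"
  have B: "bounded B" using assms by (auto simp: B_def test_fun_def)
  have "pairing (\<lambda>x. \<phi> x + \<psi> x) \<gamma> = (\<Sum>x\<in>\<gamma> \<inter> B. \<phi> x + \<psi> x)"
    by (rule pairing_eq_sum[OF assms(1) B]) (auto simp: B_def)
  also have "\<dots> = (\<Sum>x\<in>\<gamma> \<inter> B. \<phi> x) + (\<Sum>x\<in>\<gamma> \<inter> B. \<psi> x)" by (rule sum.distrib)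
  also have "\<dots> = pairing \<phi> \<gamma> + pairing \<psi> \<gamma>"
    by (intro arg_cong2[where f="(+)"] pairing_eq_sum[symmetric] assms(1) B) (auto simp: B_def)
  finally show ?thesis .
qed

lemma pairing_indicator:
  assumes "\<gamma> \<in> configs" "bounded A"
  shows "pairing (\<lambda>x. s * indicator A x) \<gamma> = s * real (card (\<gamma> \<inter> A))"
  using assms by (subst pairing_eq_sum[of _ A]) (auto simp: indicator_def)

lemma pairing_insert:
  assumes "\<gamma> \<in> configs" "test_fun \<phi>" "x \<notin> \<gamma>"
  shows "pairing \<phi> (insert x \<gamma>) = \<phi> x + pairing \<phi> \<gamma>"
proof -
  define B where "B = insert x {x. \<phi> x \<noteq> 0}"
  have B: "bounded B" using assms by (auto simp: B_def test_fun_def)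
  have 1: "insert x \<gamma> \<inter> B = insert x (\<gamma> \<inter> B)" by (auto simp: B_def)
  show ?thesis
    using assms configs_insert[OF assms(1), of x] configs_finite_Int[OF assms(1) B]
    by (subst (1 2) pairing_eq_sum[of _ B]) (auto simp: 1 B, auto simp: B_def)
qed

lemma pairing_remove:
  assumes "\<gamma> \<in> configs" "test_fun \<phi>" "x \<in> \<gamma>"
  shows "pairing \<phi> (\<gamma> - {x}) = pairing \<phi> \<gamma> - \<phi> x"
proof -
  have "pairing \<phi> (insert x (\<gamma> - {x})) = \<phi> x + pairing \<phi> (\<gamma> - {x})"
    using assms by (intro pairing_insert configs_mono[OF assms(1)]) auto
  then show ?thesis using assms by (simp add: insert_absorb)
qed

section \<open>Point counts under the Poisson measure\<close>

locale poisson_space = prob_space \<pi> for \<pi> :: "'a::euclidean_space set measure" +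
  fixes z :: real
  assumes z_pos: "z > 0" and poisson: "poisson_measure z \<pi>"
begin

lemma space_pi: "space \<pi> = configs"
  using poisson by (simp add: poisson_measure_def)

lemma card_measurable:
  assumes "A \<in> sets borel" "bounded A"
  shows "(\<lambda>\<gamma>. card (\<gamma> \<inter> A)) \<in> measurable \<pi> (count_space UNIV)"
proof -
  \<comment> \<open>Independence of a family, even of a single count, includes measurability of its members.\<close>
  have "indep_vars (\<lambda>_. count_space UNIV) (\<lambda>B \<gamma>. card (\<gamma> \<inter> B)) {A}"
    using poisson assms unfolding poisson_measure_def by (auto simp: disjoint_def)
  then show ?thesis by (simp add: indep_vars_def)
qed

text \<open>The parameter space is more general than the configuration space so that the lemma can be applied a second time
  with a point of the configuration as an additional parameter, which yields sums over pairs.\<close>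
lemma nn_points_measurable_comp:
  assumes q: "q \<in> measurable M \<pi>" and H: "H \<in> borel_measurable (M \<Otimes>\<^sub>M borel)"
  shows "(\<lambda>\<omega>. \<integral>\<^sup>+x. H (\<omega>, x) \<partial>count_space (q \<omega>)) \<in> borel_measurable M"
proof (rule borel_measurable_sum_points[where N=borel and B="\<lambda>n. ball 0 (real n)"])
  show "finite (q \<omega> \<inter> ball 0 (real n))" if "\<omega> \<in> space M" for \<omega> n
    using measurable_space[OF q that] by (auto simp: space_pi intro: configs_finite_Int)
  show "(\<lambda>\<omega>. card (q \<omega> \<inter> (ball 0 (real n) \<inter> A))) \<in> measurable M (count_space UNIV)" if "A \<in> sets borel" for n A
    by (rule measurable_compose[OF q card_measurable]) (use that in \<open>auto intro: bounded_Int\<close>)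
  show "incseq (\<lambda>n. ball (0::'a) (real n))" by (auto simp: incseq_def)
  show "(\<Union>n. ball (0::'a) (real n)) = UNIV" using reals_Archimedean2 by auto
qed (use H in auto)

lemma nn_points_measurable:
  "H \<in> borel_measurable (\<pi> \<Otimes>\<^sub>M borel) \<Longrightarrow> (\<lambda>\<gamma>. \<integral>\<^sup>+x. H (\<gamma>, x) \<partial>count_space \<gamma>) \<in> borel_measurable \<pi>"
  by (rule nn_points_measurable_comp) auto

lemma nn_integral_offdiag:
  fixes H :: "'a \<times> 'a \<Rightarrow> ennreal"
  shows "(\<integral>\<^sup>+p. H p \<partial>count_space (offdiag \<gamma>))
     = (\<integral>\<^sup>+x1. \<integral>\<^sup>+x2. H (x1, x2) * indicator (- {x1}) x2 \<partial>count_space \<gamma> \<partial>count_space \<gamma>)"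
proof -
  have "(\<integral>\<^sup>+p. H p \<partial>count_space (offdiag \<gamma>))
     = (\<integral>\<^sup>+p. H p * indicator (offdiag \<gamma>) p \<partial>count_space UNIV)"
    by (subst nn_integral_count_space_indicator) auto
  also have "\<dots> = (\<integral>\<^sup>+x1. \<integral>\<^sup>+x2. H (x1, x2) * indicator (offdiag \<gamma>) (x1, x2) \<partial>count_space UNIV \<partial>count_space UNIV)"
    by (rule nn_integral_fst_count_space[symmetric])
  also have "\<dots> = (\<integral>\<^sup>+x1. (\<integral>\<^sup>+x2. H (x1, x2) * indicator (- {x1}) x2 \<partial>count_space \<gamma>) * indicator \<gamma> x1 \<partial>count_space UNIV)"
  proof (intro nn_integral_cong)
    fix x1
    show "(\<integral>\<^sup>+x2. H (x1, x2) * indicator (offdiag \<gamma>) (x1, x2) \<partial>count_space UNIV)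
       = (\<integral>\<^sup>+x2. H (x1, x2) * indicator (- {x1}) x2 \<partial>count_space \<gamma>) * indicator \<gamma> x1"
      by (cases "x1 \<in> \<gamma>")
         (auto simp: nn_integral_count_space_indicator offdiag_def indicator_def intro!: nn_integral_cong)
  qed
  also have "\<dots> = (\<integral>\<^sup>+x1. \<integral>\<^sup>+x2. H (x1, x2) * indicator (- {x1}) x2 \<partial>count_space \<gamma> \<partial>count_space \<gamma>)"
    by (subst (2) nn_integral_count_space_indicator) auto
  finally show ?thesis .
qed

lemma nn_pairs_measurable:
  assumes [measurable]: "H \<in> borel_measurable (\<pi> \<Otimes>\<^sub>M (borel \<Otimes>\<^sub>M borel))"
  shows "(\<lambda>\<gamma>. \<integral>\<^sup>+p. H (\<gamma>, p) \<partial>count_space (offdiag \<gamma>)) \<in> borel_measurable \<pi>"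
  unfolding nn_integral_offdiag
proof (rule nn_points_measurable[of "\<lambda>(\<gamma>, x1). \<integral>\<^sup>+x2. H (\<gamma>, x1, x2) * indicator (- {x1}) x2 \<partial>count_space \<gamma>", simplified])
  have [measurable]: "(\<lambda>q. H (fst (fst q), snd (fst q), snd q)) \<in> borel_measurable ((\<pi> \<Otimes>\<^sub>M borel) \<Otimes>\<^sub>M borel)"
    by measurable
  have "(\<lambda>\<omega>. \<integral>\<^sup>+x2. (\<lambda>q. H (fst (fst q), snd (fst q), snd q) * of_bool (snd q \<noteq> snd (fst q))) (\<omega>, x2) \<partial>count_space (fst \<omega>))
     \<in> borel_measurable (\<pi> \<Otimes>\<^sub>M borel)"
    by (rule nn_points_measurable_comp) (unfold of_bool_def, measurable)
  then show "(\<lambda>(\<gamma>, x1). \<integral>\<^sup>+x2. H (\<gamma>, x1, x2) * indicator (- {x1}) x2 \<partial>count_space \<gamma>) \<in> borel_measurable (\<pi> \<Otimes>\<^sub>M borel)"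
    by (simp add: case_prod_beta' indicator_def)
qed

lemma pairing_measurable:
  assumes [measurable]: "\<phi> \<in> borel_measurable borel"
  shows "pairing \<phi> \<in> borel_measurable \<pi>"
proof -
  have "(\<lambda>\<gamma>. LINT x|count_space \<gamma>. (\<lambda>(\<gamma>, x). \<phi> x) (\<gamma>, x)) \<in> borel_measurable \<pi>"
    by (rule borel_measurable_integral_points[where N=borel]) (auto intro: nn_points_measurable)
  then show ?thesis by (simp add: pairing_def[abs_def] infsum_eq_integral_count_space)
qed

end

section \<open>The Laplace functional\<close>

lemma test_fun_sum:
  assumes "finite I" "\<And>i. i \<in> I \<Longrightarrow> test_fun (\<phi> i)"
  shows "test_fun (\<lambda>x. \<Sum>i\<in>I. \<phi> i x)"
  using assms
proof (induction I)
  case empty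
  then show ?case by (simp add: test_fun_def image_constant_conv)
next
  case (insert i I)
  then show ?case by (simp add: test_fun_add)
qed

lemma pairing_zero: "pairing (\<lambda>x. 0) \<gamma> = 0" by (simp add: pairing_def)

lemma pairing_sum:
  assumes "finite I" "\<And>i. i \<in> I \<Longrightarrow> test_fun (\<phi> i)" "\<gamma> \<in> configs"
  shows "pairing (\<lambda>x. \<Sum>i\<in>I. \<phi> i x) \<gamma> = (\<Sum>i\<in>I. pairing (\<phi> i) \<gamma>)"
  using assms by (induction I) (simp_all add: pairing_zero pairing_add test_fun_sum)

lemma finite_range_eq_sum_levels:
  fixes \<phi> :: "'x \<Rightarrow> real" and f :: "real \<Rightarrow> real"
  assumes "finite (range \<phi>)" "f 0 = 0"
  shows "f (\<phi> x) = (\<Sum>t\<in>range \<phi> - {0}. f t * indicator (\<phi> -` {t}) x)"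
proof -
  have "(\<Sum>t\<in>range \<phi> - {0}. f t * indicator (\<phi> -` {t}) x) = (\<Sum>t\<in>range \<phi> - {0}. if t = \<phi> x then f t else 0)"
    by (intro sum.cong) (auto split: split_indicator)
  then show ?thesis using assms by (auto simp: sum.delta)
qed

context poisson_space begin

lemma prob_card:
  assumes "B \<in> sets borel" "bounded B"
  shows "prob {\<gamma> \<in> configs. card (\<gamma> \<inter> B) = n}
    = (z * measure lborel B) ^ n / fact n * exp (- (z * measure lborel B))"
  using poisson assms unfolding poisson_measure_def by blast

lemma nn_integral_card:
  fixes h :: "nat \<Rightarrow> ennreal"
  assumes B: "B \<in> sets borel" "bounded B"
  shows "(\<integral>\<^sup>+\<gamma>. h (card (\<gamma> \<inter> B)) \<partial>\<pi>)
    = (\<Sum>n. ennreal ((z * measure lborel B) ^ n / fact n * exp (- (z * measure lborel B))) * h n)"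
    (is "_ = (\<Sum>n. ennreal (?p n) * h n)")
proof -
  define D where "D = distr \<pi> (count_space UNIV) (\<lambda>\<gamma>. card (\<gamma> \<inter> B))"
  note [measurable] = card_measurable[OF B]
  have "D = density (count_space UNIV) (\<lambda>n. ennreal (?p n))"
  proof (rule measure_eqI_countable[where A=UNIV])
    fix n
    have "emeasure D {n} = emeasure \<pi> {\<gamma> \<in> configs. card (\<gamma> \<inter> B) = n}"
      unfolding D_def by (subst emeasure_distr) (auto simp: space_pi intro!: arg_cong[where f="emeasure \<pi>"])
    also have "\<dots> = ennreal (?p n)" using prob_card[OF B, of n] by (simp add: emeasure_eq_measure)
    also have "\<dots> = emeasure (density (count_space UNIV) (\<lambda>n. ennreal (?p n))) {n}"
      by (subst emeasure_density) (auto simp: nn_integral_count_space_finite)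
    finally show "emeasure D {n} = emeasure (density (count_space UNIV) (\<lambda>n. ennreal (?p n))) {n}" .
  qed (auto simp: D_def)
  moreover have "(\<integral>\<^sup>+\<gamma>. h (card (\<gamma> \<inter> B)) \<partial>\<pi>) = (\<integral>\<^sup>+n. h n \<partial>D)"
    unfolding D_def by (subst nn_integral_distr) auto
  ultimately show ?thesis
    by (simp add: nn_integral_density nn_integral_count_space_nat)
qed

text \<open>The exponential series absorbs the factor \<open>exp (s n)\<close> by replacing the mean \<open>m\<close> by \<open>m exp s\<close>.\<close>
lemma nn_integral_exp_card:
  fixes s :: real
  assumes B: "B \<in> sets borel" "bounded B"
  shows "(\<integral>\<^sup>+\<gamma>. ennreal (exp (s * card (\<gamma> \<inter> B))) \<partial>\<pi>) = ennreal (exp (z * measure lborel B * (exp s - 1)))"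
proof -
  define m where "m = z * measure lborel B"
  have m: "m \<ge> 0" using z_pos by (simp add: m_def)
  have "(\<lambda>n. ((m * exp s) ^ n /\<^sub>R fact n) * exp (- m)) sums (exp (m * exp s) * exp (- m))"
    by (intro sums_mult2 exp_converges)
  also have "(\<lambda>n. ((m * exp s) ^ n /\<^sub>R fact n) * exp (- m)) = (\<lambda>n. (m ^ n / fact n * exp (- m)) * exp (s * n))"
    by (auto simp: fun_eq_iff power_mult_distrib exp_of_nat2_mult divide_inverse mult_ac)
  also have "exp (m * exp s) * exp (- m) = exp (m * (exp s - 1))"
    by (simp add: exp_add[symmetric] algebra_simps)
  finally have "(\<Sum>n. ennreal ((m ^ n / fact n * exp (- m)) * exp (s * n))) = ennreal (exp (m * (exp s - 1)))"
    using m by (intro suminf_ennreal_eq) auto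
  then show ?thesis
    using m unfolding nn_integral_card[OF B, of "\<lambda>n. ennreal (exp (s * real n))"]
    by (subst (asm) ennreal_mult) (auto simp: m_def)
qed

text \<open>Independence of the counts in disjoint sets makes the expectation of the product factorise.\<close>
lemma laplace_disjoint:
  fixes s :: "'a set \<Rightarrow> real"
  assumes "finite \<B>" "disjoint \<B>" "\<And>B. B \<in> \<B> \<Longrightarrow> B \<in> sets borel \<and> bounded B"
  shows "(\<integral>\<^sup>+\<gamma>. ennreal (exp (\<Sum>B\<in>\<B>. s B * card (\<gamma> \<inter> B))) \<partial>\<pi>)
    = ennreal (exp (\<Sum>B\<in>\<B>. z * measure lborel B * (exp (s B) - 1)))"
proof -
  have "indep_vars (\<lambda>_. count_space UNIV) (\<lambda>B \<gamma>. card (\<gamma> \<inter> B)) \<B>"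
    using poisson assms unfolding poisson_measure_def by blast
  then have "indep_vars (\<lambda>_. borel) (\<lambda>B \<gamma>. ennreal (exp (s B * real (card (\<gamma> \<inter> B))))) \<B>"
    by (rule indep_vars_compose2) auto
  then have "(\<integral>\<^sup>+\<gamma>. (\<Prod>B\<in>\<B>. ennreal (exp (s B * card (\<gamma> \<inter> B)))) \<partial>\<pi>)
    = (\<Prod>B\<in>\<B>. \<integral>\<^sup>+\<gamma>. ennreal (exp (s B * card (\<gamma> \<inter> B))) \<partial>\<pi>)"
    using assms by (intro indep_vars_nn_integral) auto
  also have "\<dots> = (\<Prod>B\<in>\<B>. ennreal (exp (z * measure lborel B * (exp (s B) - 1))))"
    using assms by (intro prod.cong nn_integral_exp_card) auto
  finally show ?thesis using assms(1) by (simp add: prod_ennreal exp_sum)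
qed

text \<open>The nonzero level sets of \<open>\<phi>\<close> are finitely many disjoint bounded sets on which \<open>\<phi>\<close> is constant.\<close>
lemma laplace_finite_range:
  assumes \<phi>: "test_fun \<phi>" and fin: "finite (range \<phi>)"
  shows "(\<integral>\<^sup>+\<gamma>. ennreal (exp (pairing \<phi> \<gamma>)) \<partial>\<pi>) = ennreal (exp (z * (LINT x|lborel. exp (\<phi> x) - 1)))"
proof -
  define T where "T = range \<phi> - {0}"
  define L where "L t = \<phi> -` {t}" for t
  \<comment> \<open>Independence is stated for counts indexed by sets, so the value of \<open>\<phi>\<close> is recovered from its level set.\<close>
  define s where "s B = \<phi> (SOME x. x \<in> B)" for B
  have L: "L t \<in> sets borel" "bounded (L t)" "L t \<noteq> {}" "s (L t) = t" if "t \<in> T" for t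
  proof -
    show "L t \<in> sets borel" using \<phi> measurable_sets[of \<phi> borel borel "{t}"] by (auto simp: test_fun_def L_def)
    have "L t \<subseteq> {x. \<phi> x \<noteq> 0}" using that by (auto simp: L_def T_def)
    then show "bounded (L t)" using \<phi> bounded_subset unfolding test_fun_def by blast
    show ne: "L t \<noteq> {}" using that by (auto simp: L_def T_def)
    then have "(SOME x. x \<in> L t) \<in> L t" by (simp add: some_in_eq)
    then show "s (L t) = t" by (simp add: s_def L_def)
  qed
  have inj: "inj_on L T" using L(4) by (rule inj_on_inverseI)
  have finT: "finite T" using fin by (simp add: T_def)
  have "pairing \<phi> \<gamma> = (\<Sum>B\<in>L ` T. s B * card (\<gamma> \<inter> B))" if "\<gamma> \<in> configs" for \<gamma>
  proof -
    define \<phi>' where "\<phi>' x = (\<Sum>t\<in>T. t * indicator (L t) x)" for x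
    have "\<phi> = \<phi>'"
    proof (rule ext)
      show "\<phi> x = \<phi>' x" for x
        unfolding \<phi>'_def T_def L_def by (rule finite_range_eq_sum_levels[of \<phi> "\<lambda>t. t" x, OF fin refl])
    qed
    then have "pairing \<phi> \<gamma> = pairing \<phi>' \<gamma>" by (rule arg_cong)
    also have "\<dots> = (\<Sum>t\<in>T. t * card (\<gamma> \<inter> L t))"
      using L that finT unfolding \<phi>'_def by (subst pairing_sum) (auto intro: test_fun_indicator simp: pairing_indicator)
    finally show ?thesis using L by (simp add: sum.reindex[OF inj])
  qed
  then have "(\<integral>\<^sup>+\<gamma>. ennreal (exp (pairing \<phi> \<gamma>)) \<partial>\<pi>)
      = (\<integral>\<^sup>+\<gamma>. ennreal (exp (\<Sum>B\<in>L ` T. s B * card (\<gamma> \<inter> B))) \<partial>\<pi>)"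
    by (intro nn_integral_cong) (simp add: space_pi)
  also have "\<dots> = ennreal (exp (\<Sum>B\<in>L ` T. z * measure lborel B * (exp (s B) - 1)))"
    using L finT by (intro laplace_disjoint) (auto simp: disjoint_def L_def)
  also have "(\<Sum>B\<in>L ` T. z * measure lborel B * (exp (s B) - 1)) = z * (\<Sum>t\<in>T. (exp t - 1) * measure lborel (L t))"
    using L by (simp add: sum.reindex[OF inj] sum_distrib_left mult_ac)
  also have "(\<Sum>t\<in>T. (exp t - 1) * measure lborel (L t)) = (LINT x|lborel. (\<Sum>t\<in>T. (exp t - 1) * indicator (L t) x))"
    using L by (subst Bochner_Integration.integral_sum)
      (auto intro!: integrable_mult_right integrable_real_indicator simp: emeasure_bounded_finite[simplified])
  also have "\<dots> = (LINT x|lborel. exp (\<phi> x) - 1)"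
    unfolding T_def L_def
    by (intro Bochner_Integration.integral_cong refl finite_range_eq_sum_levels[OF fin, of "\<lambda>t. exp t - 1", symmetric]) simp
  finally show ?thesis .
qed

text \<open>Rounding \<open>\<phi>\<close> down to multiples of \<open>1 / (n + 1)\<close> gives functions of finite range which converge uniformly
  and, as \<open>0\<close> is rounded to \<open>0\<close>, keep the support.  All of them are bounded by \<open>C + 1\<close> on one ball, whose
  exponential count moment dominates.\<close>
lemma nn_laplace:
  assumes \<phi>: "test_fun \<phi>"
  shows "(\<integral>\<^sup>+\<gamma>. ennreal (exp (pairing \<phi> \<gamma>)) \<partial>\<pi>) = ennreal (exp (z * (LINT x|lborel. exp (\<phi> x) - 1)))"
proof -
  obtain C r where C: "C > 0" "\<And>x. \<bar>\<phi> x\<bar> \<le> C * indicator (ball 0 r) x"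
    using test_fun_bound[OF \<phi>] by blast
  have [measurable]: "\<phi> \<in> borel_measurable borel" using \<phi> by (simp add: test_fun_def)
  define \<phi>' where "\<phi>' n x = of_int \<lfloor>real (Suc n) * \<phi> x\<rfloor> / real (Suc n)" for n x
  have near: "\<bar>\<phi>' n x - \<phi> x\<bar> \<le> 1 / real (Suc n)" for n x
  proof -
    have "\<bar>of_int \<lfloor>real (Suc n) * \<phi> x\<rfloor> - real (Suc n) * \<phi> x\<bar> \<le> 1" by linarith
    then have "\<bar>of_int \<lfloor>real (Suc n) * \<phi> x\<rfloor> - real (Suc n) * \<phi> x\<bar> / real (Suc n) \<le> 1 / real (Suc n)"
      by (intro divide_right_mono) auto
    also have "\<bar>of_int \<lfloor>real (Suc n) * \<phi> x\<rfloor> - real (Suc n) * \<phi> x\<bar> / real (Suc n) = \<bar>\<phi>' n x - \<phi> x\<bar>"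
      by (simp add: \<phi>'_def field_simps abs_divide flip: abs_mult)
    finally show ?thesis .
  qed
  have bound: "\<bar>\<phi>' n x\<bar> \<le> (C + 1) * indicator (ball 0 r) x" for n x
  proof (cases "x \<in> ball 0 r")
    case True
    have "1 / real (Suc n) \<le> 1" "\<bar>\<phi> x\<bar> \<le> C" using C(2)[of x] True by simp_all
    then have "\<bar>\<phi>' n x\<bar> \<le> C + 1" using near[of n x] by linarith
    then show ?thesis using True by simp
  next
    case False
    then have "\<phi> x = 0" using C(2)[of x] by simp
    then show ?thesis using False by (simp add: \<phi>'_def)
  qed
  have supp: "{x. \<phi>' n x \<noteq> 0} \<subseteq> ball 0 r" "{x. \<phi> x \<noteq> 0} \<subseteq> ball 0 r" for n
    using bound[of n] C(2) by (force split: split_indicator_asm)+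
  have lim: "(\<lambda>n. \<phi>' n x) \<longlonglongrightarrow> \<phi> x" for x
  proof (rule LIMSEQ_I)
    fix e :: real assume "e > 0"
    then obtain N where N: "1 / real (Suc N) < e" using nat_approx_posE by blast
    have "norm (\<phi>' n x - \<phi> x) < e" if "n \<ge> N" for n
    proof -
      have "1 / real (Suc n) \<le> 1 / real (Suc N)" using that by (intro divide_left_mono) auto
      then show ?thesis using near[of n x] N by simp
    qed
    then show "\<exists>N. \<forall>n\<ge>N. norm (\<phi>' n x - \<phi> x) < e" by blast
  qed
  have test': "test_fun (\<phi>' n)" for n
  proof (rule test_funI[where C="C+1" and B="ball 0 r"])
    show "\<phi>' n \<in> borel_measurable borel" unfolding \<phi>'_def by measurable
  qed (use bound in auto)
  have fin: "finite (range (\<phi>' n))" for n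
  proof (rule finite_subset)
    show "range (\<phi>' n) \<subseteq> (\<lambda>k::int. of_int k / real (Suc n)) ` {- \<lceil>real (Suc n) * (C + 1)\<rceil>..\<lceil>real (Suc n) * (C + 1)\<rceil>}"
    proof safe
      fix x
      have "\<bar>\<phi> x\<bar> \<le> C" using C(2)[of x] C(1) by (auto split: split_indicator_asm)
      then have "\<bar>real (Suc n) * \<phi> x\<bar> \<le> real (Suc n) * C"
        unfolding abs_mult by (intro mult_mono) auto
      moreover have "real (Suc n) * (C + 1) \<ge> real (Suc n) * C + 1" by (simp add: algebra_simps)
      ultimately have "\<lfloor>real (Suc n) * \<phi> x\<rfloor> \<in> {- \<lceil>real (Suc n) * (C + 1)\<rceil>..\<lceil>real (Suc n) * (C + 1)\<rceil>}"
        unfolding atLeastAtMost_iff by linarith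
      then show "\<phi>' n x \<in> (\<lambda>k::int. of_int k / real (Suc n)) ` {- \<lceil>real (Suc n) * (C + 1)\<rceil>..\<lceil>real (Suc n) * (C + 1)\<rceil>}"
        unfolding \<phi>'_def by (rule imageI)
    qed
  qed auto
  have "(\<lambda>n. \<integral>\<^sup>+\<gamma>. ennreal (exp (pairing (\<phi>' n) \<gamma>)) \<partial>\<pi>) \<longlonglongrightarrow> (\<integral>\<^sup>+\<gamma>. ennreal (exp (pairing \<phi> \<gamma>)) \<partial>\<pi>)"
  proof (rule nn_integral_dominated_convergence)
    show "(\<lambda>\<gamma>. ennreal (exp (pairing (\<phi>' n) \<gamma>))) \<in> borel_measurable \<pi>" for n
      using pairing_measurable[of "\<phi>' n"] test'[of n] by (simp add: test_fun_def)
    show "(\<lambda>\<gamma>. ennreal (exp (pairing \<phi> \<gamma>))) \<in> borel_measurable \<pi>"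
      using pairing_measurable[of \<phi>] by simp
    show "(\<lambda>\<gamma>. ennreal (exp ((C + 1) * card (\<gamma> \<inter> ball 0 r)))) \<in> borel_measurable \<pi>"
      using card_measurable[of "ball 0 r"] by measurable
    show "(\<integral>\<^sup>+\<gamma>. ennreal (exp ((C + 1) * card (\<gamma> \<inter> ball 0 r))) \<partial>\<pi>) < \<infinity>"
      by (subst nn_integral_exp_card) auto
    show "AE \<gamma> in \<pi>. ennreal (exp (pairing (\<phi>' n) \<gamma>)) \<le> ennreal (exp ((C + 1) * card (\<gamma> \<inter> ball 0 r)))" for n
    proof (rule AE_I2)
      fix \<gamma> assume "\<gamma> \<in> space \<pi>"
      then have \<gamma>: "\<gamma> \<in> configs" by (simp add: space_pi)
      have "pairing (\<phi>' n) \<gamma> = (\<Sum>x\<in>\<gamma> \<inter> ball 0 r. \<phi>' n x)"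
        by (intro pairing_eq_sum \<gamma> supp) auto
      also have "\<dots> \<le> (\<Sum>x\<in>\<gamma> \<inter> ball 0 r. C + 1)"
        using bound[of n] by (intro sum_mono order_trans[OF abs_ge_self order_trans[OF bound]]) auto
      finally show "ennreal (exp (pairing (\<phi>' n) \<gamma>)) \<le> ennreal (exp ((C + 1) * card (\<gamma> \<inter> ball 0 r)))"
        by (intro ennreal_leI) (simp add: mult.commute)
    qed
    show "AE \<gamma> in \<pi>. (\<lambda>n. ennreal (exp (pairing (\<phi>' n) \<gamma>))) \<longlonglongrightarrow> ennreal (exp (pairing \<phi> \<gamma>))"
    proof (rule AE_I2)
      fix \<gamma> assume "\<gamma> \<in> space \<pi>"
      then have \<gamma>: "\<gamma> \<in> configs" by (simp add: space_pi)
      have "pairing (\<phi>' n) \<gamma> = (\<Sum>x\<in>\<gamma> \<inter> ball 0 r. \<phi>' n x)" for n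
        by (intro pairing_eq_sum \<gamma> supp) auto
      moreover have "pairing \<phi> \<gamma> = (\<Sum>x\<in>\<gamma> \<inter> ball 0 r. \<phi> x)"
        by (intro pairing_eq_sum \<gamma> supp) auto
      moreover have "(\<lambda>n. \<Sum>x\<in>\<gamma> \<inter> ball 0 r. \<phi>' n x) \<longlonglongrightarrow> (\<Sum>x\<in>\<gamma> \<inter> ball 0 r. \<phi> x)"
        by (intro tendsto_sum lim)
      ultimately show "(\<lambda>n. ennreal (exp (pairing (\<phi>' n) \<gamma>))) \<longlonglongrightarrow> ennreal (exp (pairing \<phi> \<gamma>))"
        by (intro tendsto_ennrealI tendsto_exp) simp
    qed
  qed
  moreover have "(\<lambda>n. LINT x|lborel. exp (\<phi>' n x) - 1) \<longlonglongrightarrow> (LINT x|lborel. exp (\<phi> x) - 1)"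
  proof (rule integral_dominated_convergence)
    show "integrable lborel (\<lambda>x. exp (C + 1) * (C + 1) * indicator (ball 0 r) x)"
      by (intro integrable_mult_right integrable_real_indicator)
         (auto simp: emeasure_bounded_finite[OF bounded_ball, simplified])
    show "(\<lambda>x. exp (\<phi>' n x) - 1) \<in> borel_measurable lborel" for n unfolding \<phi>'_def by measurable
    show "AE x in lborel. (\<lambda>n. exp (\<phi>' n x) - 1) \<longlonglongrightarrow> exp (\<phi> x) - 1"
      by (intro AE_I2 tendsto_intros lim)
    show "AE x in lborel. norm (exp (\<phi>' n x) - 1) \<le> exp (C + 1) * (C + 1) * indicator (ball 0 r) x" for n
    proof (rule AE_I2)
      fix x
      have "\<bar>\<phi>' n x\<bar> \<le> C + 1" using bound[of n x] C(1) by (auto split: split_indicator_asm)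
      then have "norm (exp (\<phi>' n x) - 1) \<le> exp (C + 1) * \<bar>\<phi>' n x\<bar>"
        by (simp add: abs_exp_minus_one_le)
      also have "\<dots> \<le> exp (C + 1) * ((C + 1) * indicator (ball 0 r) x)"
        by (intro mult_left_mono bound) auto
      finally show "norm (exp (\<phi>' n x) - 1) \<le> exp (C + 1) * (C + 1) * indicator (ball 0 r) x"
        by (simp add: mult_ac)
    qed
  qed simp
  then have "(\<lambda>n. ennreal (exp (z * (LINT x|lborel. exp (\<phi>' n x) - 1))))
      \<longlonglongrightarrow> ennreal (exp (z * (LINT x|lborel. exp (\<phi> x) - 1)))"
    by (intro tendsto_intros tendsto_ennrealI)
  ultimately show ?thesis
    unfolding laplace_finite_range[OF test' fin] by (rule LIMSEQ_unique)
qed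

text \<open>The value of the Laplace functional: the expectation of \<open>exp \<langle>\<phi>, \<gamma>\<rangle>\<close>, see \<open>laplace\<close> below.\<close>
definition "mean_exp \<phi> = exp (z * (LINT x|lborel. exp (\<phi> x) - 1))"

lemma mean_exp_pos: "mean_exp \<phi> > 0" by (simp add: mean_exp_def)

lemma laplace:
  assumes \<phi>: "test_fun \<phi>"
  shows "integrable \<pi> (\<lambda>\<gamma>. exp (pairing \<phi> \<gamma>))" "(LINT \<gamma>|\<pi>. exp (pairing \<phi> \<gamma>)) = mean_exp \<phi>"
proof -
  have [measurable]: "\<phi> \<in> borel_measurable borel" using \<phi> by (simp add: test_fun_def)
  note [measurable] = pairing_measurable[of \<phi>]
  show "integrable \<pi> (\<lambda>\<gamma>. exp (pairing \<phi> \<gamma>))"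
    using nn_laplace[OF \<phi>] by (subst integrable_iff_bounded) auto
  show "(LINT \<gamma>|\<pi>. exp (pairing \<phi> \<gamma>)) = mean_exp \<phi>"
    using nn_laplace[OF \<phi>] by (subst integral_eq_nn_integral) (auto simp: mean_exp_def)
qed

section \<open>Moments of counts under exponential weights\<close>

lemma exp_times_indicator_integrable:
  assumes \<phi>: "test_fun \<phi>" and A: "A \<in> sets borel" "bounded A"
  shows "integrable lborel (\<lambda>x. exp (\<phi> x) * indicator A x)"
proof -
  have "integrable lborel (\<lambda>x. (exp (\<phi> x) - 1) * indicator A x + indicator A x)"
    using A test_fun_integrable[OF test_fun_exp_minus_one[OF \<phi>]]
    by (intro Bochner_Integration.integrable_add integrable_real_mult_indicator integrable_real_indicator)
       (auto simp: emeasure_bounded_finite[simplified])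
  then show ?thesis by (simp add: algebra_simps)
qed

text \<open>Reweighting the Poisson measure by \<open>exp \<langle>\<phi>, \<gamma>\<rangle>\<close> and normalising gives the Poisson measure with intensity
  \<open>z exp \<phi> dx\<close>; this is the mass which the new intensity gives to \<open>A\<close>.\<close>
definition tilted_mass :: "('a \<Rightarrow> real) \<Rightarrow> 'a set \<Rightarrow> real" where
  "tilted_mass \<phi> A = z * (LINT x|lborel. exp (\<phi> x) * indicator A x)"

lemma tilted_mass_nonneg: "tilted_mass \<phi> A \<ge> 0"
  using z_pos by (auto simp: tilted_mass_def intro!: mult_nonneg_nonneg integral_nonneg)

text \<open>Pointwise, \<open>exp (\<phi> + s 1\<^sub>A) - 1 = (exp \<phi> - 1) + (exp s - 1) 1\<^sub>A exp \<phi>\<close>.\<close>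
lemma mean_exp_tilt:
  assumes \<phi>: "test_fun \<phi>" and A: "A \<in> sets borel" "bounded A"
  shows "mean_exp (\<lambda>x. \<phi> x + s * indicator A x) = mean_exp \<phi> * exp ((exp s - 1) * tilted_mass \<phi> A)"
proof -
  have "(LINT x|lborel. exp (\<phi> x + s * indicator A x) - 1)
     = (LINT x|lborel. (exp (\<phi> x) - 1) + (exp s - 1) * (exp (\<phi> x) * indicator A x))"
    by (intro Bochner_Integration.integral_cong) (auto simp: exp_add algebra_simps split: split_indicator)
  also have "\<dots> = (LINT x|lborel. exp (\<phi> x) - 1) + (exp s - 1) * (LINT x|lborel. exp (\<phi> x) * indicator A x)"
    by (subst Bochner_Integration.integral_add)
       (auto intro!: test_fun_integrable[OF test_fun_exp_minus_one[OF \<phi>]] integrable_mult_right exp_times_indicator_integrable \<phi> A)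
  finally have *: "(LINT x|lborel. exp (\<phi> x + s * indicator A x) - 1)
     = (LINT x|lborel. exp (\<phi> x) - 1) + (exp s - 1) * (LINT x|lborel. exp (\<phi> x) * indicator A x)" .
  show ?thesis unfolding mean_exp_def tilted_mass_def * exp_add[symmetric] by (simp add: algebra_simps)
qed

lemma tilted_mass_tilt:
  assumes \<phi>: "test_fun \<phi>" and A: "A \<in> sets borel" "bounded A" and B: "B \<in> sets borel" "bounded B"
  shows "tilted_mass (\<lambda>x. \<phi> x + s * indicator A x) B = tilted_mass \<phi> B + (exp s - 1) * tilted_mass \<phi> (A \<inter> B)"
proof -
  have "(LINT x|lborel. exp (\<phi> x + s * indicator A x) * indicator B x)
     = (LINT x|lborel. exp (\<phi> x) * indicator B x + (exp s - 1) * (exp (\<phi> x) * indicator (A \<inter> B) x))"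
    by (intro Bochner_Integration.integral_cong) (auto simp: exp_add algebra_simps split: split_indicator)
  also have "\<dots> = (LINT x|lborel. exp (\<phi> x) * indicator B x) + (exp s - 1) * (LINT x|lborel. exp (\<phi> x) * indicator (A \<inter> B) x)"
    by (subst Bochner_Integration.integral_add)
       (use A B in \<open>auto intro!: \<phi> integrable_mult_right exp_times_indicator_integrable bounded_Int\<close>)
  finally have *: "(LINT x|lborel. exp (\<phi> x + s * indicator A x) * indicator B x)
     = (LINT x|lborel. exp (\<phi> x) * indicator B x) + (exp s - 1) * (LINT x|lborel. exp (\<phi> x) * indicator (A \<inter> B) x)" .
  show ?thesis unfolding tilted_mass_def * by (simp add: algebra_simps)
qed

lemma exp_pairing_tilt:
  assumes "test_fun \<phi>" "A \<in> sets borel" "bounded A" "\<gamma> \<in> configs"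
  shows "exp (pairing (\<lambda>x. \<phi> x + s * indicator A x) \<gamma>) = exp (s * card (\<gamma> \<inter> A)) * exp (pairing \<phi> \<gamma>)"
  using assms by (simp add: pairing_add pairing_indicator test_fun_indicator exp_add mult_ac)

lemma test_fun_tilt:
  "test_fun \<phi> \<Longrightarrow> A \<in> sets borel \<Longrightarrow> bounded A \<Longrightarrow> test_fun (\<lambda>x. \<phi> x + s * indicator A x)"
  by (intro test_fun_add test_fun_indicator)

text \<open>The bound is uniform in \<open>s\<close>, and exponential in the count, hence integrable.\<close>
lemma difference_quotient_bound:
  fixes N :: real assumes "N \<ge> 0" "0 < s" "s \<le> 1"
  shows "\<bar>(exp (s * N) - 1) / s\<bar> \<le> exp (2 * N)"
proof -
  have "\<bar>exp (s * N) - 1\<bar> \<le> exp N * \<bar>s * N\<bar>"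
    using assms by (intro abs_exp_minus_one_le) (simp add: abs_mult mult_left_le_one_le)
  also have "\<dots> = exp N * N * s" using assms by (simp add: abs_mult)
  also have "\<dots> \<le> exp N * exp N * s"
    using assms order_trans[of N "1 + N" "exp N", OF _ exp_ge_add_one_self] by (intro mult_right_mono mult_left_mono) auto
  finally have "\<bar>exp (s * N) - 1\<bar> \<le> exp (2 * N) * s" by (simp add: exp_add[symmetric])
  then show ?thesis using assms by (simp add: abs_divide field_simps)
qed

lemma difference_quotient_tendsto:
  fixes N :: real
  shows "(\<lambda>n. (exp (1 / real (Suc n) * N) - 1) / (1 / real (Suc n))) \<longlonglongrightarrow> N"
  by real_asymp

lemma first_difference_tendsto:
  fixes p :: real
  shows "(\<lambda>n. (exp ((exp (1 / real (Suc n)) - 1) * p) - 1) / (1 / real (Suc n))) \<longlonglongrightarrow> p"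
  by real_asymp

text \<open>The count of \<open>A\<close> is the derivative at \<open>s = 0\<close> of \<open>exp (s N)\<close>, and the expectation of \<open>exp (s N)\<close> with the weight
  \<open>exp \<langle>\<phi>, \<gamma>\<rangle>\<close> is the Laplace functional at \<open>\<phi> + s 1\<^sub>A\<close>.  Difference quotients along \<open>s = 1 / (n + 1)\<close> are
  enough.\<close>
lemma integral_card_exp:
  assumes \<phi>: "test_fun \<phi>" and A: "A \<in> sets borel" "bounded A"
  shows "has_bochner_integral \<pi> (\<lambda>\<gamma>. real (card (\<gamma> \<inter> A)) * exp (pairing \<phi> \<gamma>)) (mean_exp \<phi> * tilted_mass \<phi> A)"
proof -
  let ?s = "\<lambda>n. 1 / real (Suc n)"
  let ?f = "\<lambda>n \<gamma>. (exp (?s n * card (\<gamma> \<inter> A)) - 1) / ?s n * exp (pairing \<phi> \<gamma>)"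
  let ?w = "\<lambda>\<gamma>. exp (pairing (\<lambda>x. \<phi> x + 2 * indicator A x) \<gamma>)"
  have [measurable]: "pairing \<phi> \<in> borel_measurable \<pi>" "(\<lambda>\<gamma>. card (\<gamma> \<inter> A)) \<in> measurable \<pi> (count_space UNIV)"
    using \<phi> A pairing_measurable card_measurable by (auto simp: test_fun_def)
  have w: "integrable \<pi> ?w" by (intro laplace test_fun_tilt \<phi> A)
  have lim: "AE \<gamma> in \<pi>. (\<lambda>n. ?f n \<gamma>) \<longlonglongrightarrow> real (card (\<gamma> \<inter> A)) * exp (pairing \<phi> \<gamma>)"
    by (intro AE_I2 tendsto_mult_right difference_quotient_tendsto)
  have bound: "AE \<gamma> in \<pi>. norm (?f n \<gamma>) \<le> ?w \<gamma>" for n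
  proof (rule AE_I2)
    fix \<gamma> assume "\<gamma> \<in> space \<pi>"
    then have \<gamma>: "\<gamma> \<in> configs" by (simp add: space_pi)
    have "\<bar>(exp (?s n * card (\<gamma> \<inter> A)) - 1) / ?s n\<bar> \<le> exp (2 * real (card (\<gamma> \<inter> A)))"
      by (intro difference_quotient_bound) auto
    then show "norm (?f n \<gamma>) \<le> ?w \<gamma>"
      unfolding exp_pairing_tilt[OF \<phi> A \<gamma>] norm_mult by (intro mult_mono) auto
  qed
  have I: "integrable \<pi> (\<lambda>\<gamma>. real (card (\<gamma> \<inter> A)) * exp (pairing \<phi> \<gamma>))"
    by (rule integrable_dominated_convergence[OF _ _ w lim bound]) measurable
  have L: "(\<lambda>n. LINT \<gamma>|\<pi>. ?f n \<gamma>) \<longlonglongrightarrow> (LINT \<gamma>|\<pi>. real (card (\<gamma> \<inter> A)) * exp (pairing \<phi> \<gamma>))"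
    by (rule integral_dominated_convergence[OF _ _ w lim bound]) measurable
  have "(LINT \<gamma>|\<pi>. ?f n \<gamma>) = mean_exp \<phi> * ((exp ((exp (?s n) - 1) * tilted_mass \<phi> A) - 1) / ?s n)" for n
  proof -
    define s where "s = ?s n"
    have "(LINT \<gamma>|\<pi>. (exp (s * card (\<gamma> \<inter> A)) - 1) / s * exp (pairing \<phi> \<gamma>))
      = (LINT \<gamma>|\<pi>. (exp (pairing (\<lambda>x. \<phi> x + s * indicator A x) \<gamma>) - exp (pairing \<phi> \<gamma>)) / s)"
      by (intro Bochner_Integration.integral_cong refl) (simp add: space_pi exp_pairing_tilt \<phi> A algebra_simps)
    also have "\<dots> = (mean_exp (\<lambda>x. \<phi> x + s * indicator A x) - mean_exp \<phi>) / s"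
      by (simp only: integral_divide_zero Bochner_Integration.integral_diff laplace test_fun_tilt \<phi> A)
    also have "\<dots> = mean_exp \<phi> * ((exp ((exp s - 1) * tilted_mass \<phi> A) - 1) / s)"
      by (simp only: mean_exp_tilt[OF \<phi> A]) (simp add: algebra_simps)
    finally show ?thesis by (simp only: s_def)
  qed
  moreover have "(\<lambda>n. mean_exp \<phi> * ((exp ((exp (?s n) - 1) * tilted_mass \<phi> A) - 1) / ?s n)) \<longlonglongrightarrow> mean_exp \<phi> * tilted_mass \<phi> A"
    by (intro tendsto_mult_left first_difference_tendsto)
  ultimately have "(LINT \<gamma>|\<pi>. real (card (\<gamma> \<inter> A)) * exp (pairing \<phi> \<gamma>)) = mean_exp \<phi> * tilted_mass \<phi> A"
    using LIMSEQ_unique[OF L] by simp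
  with I show ?thesis by (simp add: has_bochner_integral_iff)
qed

text \<open>The nested exponent is the one that arises from tilting by \<open>1\<^sub>A\<close> first and then by \<open>1\<^sub>B\<close>.\<close>
lemma second_difference_tendsto:
  fixes p q r :: real
  shows "(\<lambda>n. (exp ((exp (1 / real (Suc n)) - 1) * p + (exp (1 / real (Suc n)) - 1) * (q + (exp (1 / real (Suc n)) - 1) * r))
      - exp ((exp (1 / real (Suc n)) - 1) * p) - exp ((exp (1 / real (Suc n)) - 1) * q) + 1) / (1 / real (Suc n))^2)
    \<longlonglongrightarrow> p * q + r"
    (is "?f \<longlonglongrightarrow> _")
proof -
  have "?f \<longlonglongrightarrow> (p + q) * (p + q) / 2 + (r + (- (p * p / 2) - q * q / 2))"
    by real_asymp
  also have "(p + q) * (p + q) / 2 + (r + (- (p * p / 2) - q * q / 2)) = p * q + r"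
    by (simp add: field_simps)
  finally show ?thesis .
qed

text \<open>The same argument with mixed second differences in the directions \<open>1\<^sub>A\<close> and \<open>1\<^sub>B\<close>.  The summand for
  \<open>A \<inter> B\<close> is the contribution of pairs consisting of the same point twice.\<close>
lemma integral_card_card_exp:
  assumes \<phi>: "test_fun \<phi>" and A: "A \<in> sets borel" "bounded A" and B: "B \<in> sets borel" "bounded B"
  shows "has_bochner_integral \<pi> (\<lambda>\<gamma>. real (card (\<gamma> \<inter> A)) * real (card (\<gamma> \<inter> B)) * exp (pairing \<phi> \<gamma>))
     (mean_exp \<phi> * (tilted_mass \<phi> A * tilted_mass \<phi> B + tilted_mass \<phi> (A \<inter> B)))"
proof -
  let ?s = "\<lambda>n. 1 / real (Suc n)"
  let ?g = "\<lambda>A n \<gamma>. (exp (?s n * card (\<gamma> \<inter> A)) - 1) / ?s n"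
  let ?f = "\<lambda>n \<gamma>. ?g A n \<gamma> * ?g B n \<gamma> * exp (pairing \<phi> \<gamma>)"
  let ?w = "\<lambda>\<gamma>. exp (pairing (\<lambda>x. (\<phi> x + 2 * indicator A x) + 2 * indicator B x) \<gamma>)"
  let ?c = "\<lambda>\<gamma>. real (card (\<gamma> \<inter> A)) * real (card (\<gamma> \<inter> B)) * exp (pairing \<phi> \<gamma>)"
  have [measurable]: "pairing \<phi> \<in> borel_measurable \<pi>" "(\<lambda>\<gamma>. card (\<gamma> \<inter> A)) \<in> measurable \<pi> (count_space UNIV)"
     "(\<lambda>\<gamma>. card (\<gamma> \<inter> B)) \<in> measurable \<pi> (count_space UNIV)"
    using \<phi> A B pairing_measurable card_measurable by (auto simp: test_fun_def)
  note tA = test_fun_tilt[OF \<phi> A] and tB = test_fun_tilt[OF \<phi> B] and tAB = test_fun_tilt[OF test_fun_tilt[OF \<phi> A] B]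
  have w: "integrable \<pi> ?w" by (intro laplace tAB)
  have lim: "AE \<gamma> in \<pi>. (\<lambda>n. ?f n \<gamma>) \<longlonglongrightarrow> ?c \<gamma>"
    by (intro AE_I2 tendsto_mult_right tendsto_mult difference_quotient_tendsto)
  have bound: "AE \<gamma> in \<pi>. norm (?f n \<gamma>) \<le> ?w \<gamma>" for n
  proof (rule AE_I2)
    fix \<gamma> assume "\<gamma> \<in> space \<pi>"
    then have \<gamma>: "\<gamma> \<in> configs" by (simp add: space_pi)
    have "\<bar>?g A n \<gamma>\<bar> \<le> exp (2 * real (card (\<gamma> \<inter> A)))" "\<bar>?g B n \<gamma>\<bar> \<le> exp (2 * real (card (\<gamma> \<inter> B)))"
      by (intro difference_quotient_bound; simp)+
    then have "\<bar>?g A n \<gamma>\<bar> * \<bar>?g B n \<gamma>\<bar> * exp (pairing \<phi> \<gamma>)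
        \<le> exp (2 * real (card (\<gamma> \<inter> A))) * exp (2 * real (card (\<gamma> \<inter> B))) * exp (pairing \<phi> \<gamma>)"
      by (intro mult_mono) auto
    moreover have "norm (?f n \<gamma>) = \<bar>?g A n \<gamma>\<bar> * \<bar>?g B n \<gamma>\<bar> * exp (pairing \<phi> \<gamma>)"
      by (simp only: real_norm_def abs_mult abs_exp_cancel)
    moreover have "?w \<gamma> = exp (2 * real (card (\<gamma> \<inter> A))) * exp (2 * real (card (\<gamma> \<inter> B))) * exp (pairing \<phi> \<gamma>)"
      by (simp only: exp_pairing_tilt[OF tA B \<gamma>] exp_pairing_tilt[OF \<phi> A \<gamma>]) (simp only: mult_ac)
    ultimately show "norm (?f n \<gamma>) \<le> ?w \<gamma>"
      by (simp only:)
  qed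
  have I: "integrable \<pi> ?c"
    by (rule integrable_dominated_convergence[OF _ _ w lim bound]) measurable
  have L: "(\<lambda>n. LINT \<gamma>|\<pi>. ?f n \<gamma>) \<longlonglongrightarrow> (LINT \<gamma>|\<pi>. ?c \<gamma>)"
    by (rule integral_dominated_convergence[OF _ _ w lim bound]) measurable
  let ?u = "\<lambda>n. exp (?s n) - 1"
  have "(LINT \<gamma>|\<pi>. ?f n \<gamma>) = mean_exp \<phi> * ((exp (?u n * tilted_mass \<phi> A + ?u n * (tilted_mass \<phi> B + ?u n * tilted_mass \<phi> (A \<inter> B)))
      - exp (?u n * tilted_mass \<phi> A) - exp (?u n * tilted_mass \<phi> B) + 1) / (?s n)^2)" for n
  proof -
    define s where "s = ?s n"
    have "(LINT \<gamma>|\<pi>. (exp (s * card (\<gamma> \<inter> A)) - 1) / s * ((exp (s * card (\<gamma> \<inter> B)) - 1) / s) * exp (pairing \<phi> \<gamma>))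
      = (LINT \<gamma>|\<pi>. (exp (pairing (\<lambda>x. (\<phi> x + s * indicator A x) + s * indicator B x) \<gamma>)
          - exp (pairing (\<lambda>x. \<phi> x + s * indicator A x) \<gamma>) - exp (pairing (\<lambda>x. \<phi> x + s * indicator B x) \<gamma>)
          + exp (pairing \<phi> \<gamma>)) / s^2)"
      by (intro Bochner_Integration.integral_cong refl,
          simp only: space_pi exp_pairing_tilt[OF tA B] exp_pairing_tilt[OF \<phi> A] exp_pairing_tilt[OF \<phi> B])
         (simp add: power2_eq_square algebra_simps diff_divide_distrib add_divide_distrib)
    also have "\<dots> = (mean_exp (\<lambda>x. (\<phi> x + s * indicator A x) + s * indicator B x)
          - mean_exp (\<lambda>x. \<phi> x + s * indicator A x) - mean_exp (\<lambda>x. \<phi> x + s * indicator B x) + mean_exp \<phi>) / s^2"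
      by (simp only: integral_divide_zero Bochner_Integration.integral_add Bochner_Integration.integral_diff
            Bochner_Integration.integrable_diff laplace \<phi> tA tB tAB)
    also have "\<dots> = mean_exp \<phi> * ((exp ((exp s - 1) * tilted_mass \<phi> A + (exp s - 1) * (tilted_mass \<phi> B + (exp s - 1) * tilted_mass \<phi> (A \<inter> B)))
      - exp ((exp s - 1) * tilted_mass \<phi> A) - exp ((exp s - 1) * tilted_mass \<phi> B) + 1) / s^2)"
      by (simp only: mean_exp_tilt[OF tA B] mean_exp_tilt[OF \<phi> A] mean_exp_tilt[OF \<phi> B] tilted_mass_tilt[OF \<phi> A B] exp_add)
         (simp add: algebra_simps diff_divide_distrib add_divide_distrib)
    finally show ?thesis by (simp only: s_def)
  qed
  moreover have "(\<lambda>n. mean_exp \<phi> * ((exp (?u n * tilted_mass \<phi> A + ?u n * (tilted_mass \<phi> B + ?u n * tilted_mass \<phi> (A \<inter> B)))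
      - exp (?u n * tilted_mass \<phi> A) - exp (?u n * tilted_mass \<phi> B) + 1) / (?s n)^2))
     \<longlonglongrightarrow> mean_exp \<phi> * (tilted_mass \<phi> A * tilted_mass \<phi> B + tilted_mass \<phi> (A \<inter> B))"
    by (intro tendsto_mult_left second_difference_tendsto)
  ultimately have "(LINT \<gamma>|\<pi>. ?c \<gamma>) = mean_exp \<phi> * (tilted_mass \<phi> A * tilted_mass \<phi> B + tilted_mass \<phi> (A \<inter> B))"
    using LIMSEQ_unique[OF L] by simp
  with I show ?thesis by (simp add: has_bochner_integral_iff)
qed

end

section \<open>Campbell measures\<close>

text \<open>The weighted expected number of points in \<open>A\<close> is countably additive in \<open>A\<close>.  As it is a measure, it can be
  identified by its values on a generating family of sets.\<close>
lemma campbell_measure_exists: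
  fixes S :: "'b \<Rightarrow> 'x set" and w :: "'b \<Rightarrow> ennreal"
  assumes nn: "\<And>g. g \<in> borel_measurable N \<Longrightarrow> (\<lambda>\<omega>. \<integral>\<^sup>+x. g x \<partial>count_space (S \<omega>)) \<in> borel_measurable M"
    and [measurable]: "w \<in> borel_measurable M" and space_N: "space N = UNIV"
  obtains C where "sets C = sets N"
    "\<And>g. g \<in> borel_measurable N \<Longrightarrow> (\<integral>\<^sup>+x. g x \<partial>C) = (\<integral>\<^sup>+\<omega>. w \<omega> * (\<integral>\<^sup>+x. g x \<partial>count_space (S \<omega>)) \<partial>M)"
proof -
  define \<mu> where "\<mu> A = (\<integral>\<^sup>+\<omega>. w \<omega> * (\<integral>\<^sup>+x. indicator A x \<partial>count_space (S \<omega>)) \<partial>M)" for A :: "'x set"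
  define C where "C = measure_of (space N) (sets N) \<mu>"
  have sets: "sets C = sets N" by (simp add: C_def)
  have ca: "countably_additive (sets N) \<mu>"
  proof (rule countably_additiveI)
    fix A :: "nat \<Rightarrow> 'x set" assume A: "range A \<subseteq> sets N" "disjoint_family A"
    have [measurable]: "(\<lambda>\<omega>. \<integral>\<^sup>+x. indicator (A i) x \<partial>count_space (S \<omega>)) \<in> borel_measurable M" for i
      using A by (intro nn borel_measurable_indicator) auto
    have "(\<Sum>i. \<mu> (A i)) = (\<integral>\<^sup>+\<omega>. (\<Sum>i. w \<omega> * (\<integral>\<^sup>+x. indicator (A i) x \<partial>count_space (S \<omega>))) \<partial>M)"
      unfolding \<mu>_def by (subst nn_integral_suminf) auto
    also have "\<dots> = (\<integral>\<^sup>+\<omega>. w \<omega> * (\<integral>\<^sup>+x. (\<Sum>i. indicator (A i) x) \<partial>count_space (S \<omega>)) \<partial>M)"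
      by (simp add: nn_integral_suminf)
    finally show "(\<Sum>i. \<mu> (A i)) = \<mu> (\<Union>i. A i)"
      by (simp add: \<mu>_def suminf_indicator[OF A(2)])
  qed
  have em: "emeasure C A = \<mu> A" if "A \<in> sets N" for A
    unfolding C_def by (rule emeasure_measure_of_sigma) (use that ca sets.sigma_algebra_axioms in \<open>auto simp: positive_def \<mu>_def\<close>)
  have "(\<integral>\<^sup>+x. g x \<partial>C) = (\<integral>\<^sup>+\<omega>. w \<omega> * (\<integral>\<^sup>+x. g x \<partial>count_space (S \<omega>)) \<partial>M)" if "g \<in> borel_measurable N" for g
    using that
  proof (induction rule: borel_measurable_induct)
    case (cong f g)
    then show ?case by (simp add: space_N flip: fun_eq_iff)
  next
    case (set A)
    then show ?case by (simp add: em sets \<mu>_def)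
  next
    case (mult u c)
    have u: "u \<in> borel_measurable C" using mult by (simp add: measurable_cong_sets[OF sets refl])
    have "(\<integral>\<^sup>+\<omega>. w \<omega> * (\<integral>\<^sup>+x. c * u x \<partial>count_space (S \<omega>)) \<partial>M)
      = (\<integral>\<^sup>+\<omega>. c * (w \<omega> * (\<integral>\<^sup>+x. u x \<partial>count_space (S \<omega>))) \<partial>M)"
      by (intro nn_integral_cong) (simp add: nn_integral_cmult mult_ac)
    also have "\<dots> = c * (\<integral>\<^sup>+\<omega>. (w \<omega> * (\<integral>\<^sup>+x. u x \<partial>count_space (S \<omega>))) \<partial>M)"
      by (intro nn_integral_cmult borel_measurable_times_ennreal nn mult) simp
    finally show ?case using mult u by (simp add: nn_integral_cmult)
  next
    case (add u v)
    have uv: "u \<in> borel_measurable C" "v \<in> borel_measurable C" using add by (simp_all add: measurable_cong_sets[OF sets refl])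
    have "(\<integral>\<^sup>+\<omega>. w \<omega> * (\<integral>\<^sup>+x. v x + u x \<partial>count_space (S \<omega>)) \<partial>M)
      = (\<integral>\<^sup>+\<omega>. w \<omega> * (\<integral>\<^sup>+x. v x \<partial>count_space (S \<omega>)) + w \<omega> * (\<integral>\<^sup>+x. u x \<partial>count_space (S \<omega>)) \<partial>M)"
      by (intro nn_integral_cong) (simp add: nn_integral_add distrib_left)
    also have "\<dots> = (\<integral>\<^sup>+\<omega>. w \<omega> * (\<integral>\<^sup>+x. v x \<partial>count_space (S \<omega>)) \<partial>M) + (\<integral>\<^sup>+\<omega>. w \<omega> * (\<integral>\<^sup>+x. u x \<partial>count_space (S \<omega>)) \<partial>M)"
      by (intro nn_integral_add borel_measurable_times_ennreal nn add) simp_all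
    finally show ?case using add uv by (simp add: nn_integral_add)
  next
    case (seq U)
    have U: "U i \<in> borel_measurable C" for i using seq by (simp add: measurable_cong_sets[OF sets refl])
    have mono: "incseq (\<lambda>i. w \<omega> * (\<integral>\<^sup>+x. U i x \<partial>count_space (S \<omega>)))" for \<omega>
      using seq(3) by (auto simp: incseq_def le_fun_def intro!: mult_left_mono nn_integral_mono)
    have "(\<integral>\<^sup>+\<omega>. w \<omega> * (\<integral>\<^sup>+x. (SUP i. U i) x \<partial>count_space (S \<omega>)) \<partial>M)
      = (\<integral>\<^sup>+\<omega>. (SUP i. w \<omega> * (\<integral>\<^sup>+x. U i x \<partial>count_space (S \<omega>))) \<partial>M)"
    proof (intro nn_integral_cong)
      fix \<omega>
      have "(\<integral>\<^sup>+x. (SUP i. U i) x \<partial>count_space (S \<omega>)) = (SUP i. \<integral>\<^sup>+x. U i x \<partial>count_space (S \<omega>))"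
        unfolding SUP_apply by (rule nn_integral_monotone_convergence_SUP) (use seq in auto)
      then show "w \<omega> * (\<integral>\<^sup>+x. (SUP i. U i) x \<partial>count_space (S \<omega>))
          = (SUP i. w \<omega> * (\<integral>\<^sup>+x. U i x \<partial>count_space (S \<omega>)))"
        by (simp add: SUP_mult_left_ennreal)
    qed
    also have "\<dots> = (SUP i. \<integral>\<^sup>+\<omega>. w \<omega> * (\<integral>\<^sup>+x. U i x \<partial>count_space (S \<omega>)) \<partial>M)"
      using mono nn[OF seq(1)] by (intro nn_integral_monotone_convergence_SUP) (auto simp: incseq_def le_fun_def)
    also have "\<dots> = (SUP i. \<integral>\<^sup>+x. U i x \<partial>C)" using seq by simp
    also have "\<dots> = (\<integral>\<^sup>+x. (SUP i. U i) x \<partial>C)"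
      unfolding SUP_apply by (rule nn_integral_monotone_convergence_SUP[symmetric]) (use seq U in auto)
    finally show ?case ..
  qed
  with sets show thesis by (rule that)
qed

text \<open>The positive and negative parts are treated separately; positivity of the weight turns integrability of the
  weighted sum of absolute values into almost sure absolute convergence.\<close>
lemma campbell_signed:
  fixes S :: "'b \<Rightarrow> 'x set" and w :: "'b \<Rightarrow> real" and k :: "'x \<Rightarrow> real"
  assumes nn: "\<And>g::'x \<Rightarrow> ennreal. g \<in> borel_measurable \<mu> \<Longrightarrow> (\<lambda>\<omega>. \<integral>\<^sup>+x. g x \<partial>count_space (S \<omega>)) \<in> borel_measurable M"
    and campbell: "\<And>g. g \<in> borel_measurable \<mu> \<Longrightarrow>
      (\<integral>\<^sup>+\<omega>. ennreal (w \<omega>) * (\<integral>\<^sup>+x. g x \<partial>count_space (S \<omega>)) \<partial>M) = (\<integral>\<^sup>+x. g x \<partial>\<mu>)"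
    and [measurable]: "w \<in> borel_measurable M" and w: "\<And>\<omega>. w \<omega> > 0"
    and int: "integrable \<mu> k"
  shows "AE \<omega> in M. integrable (count_space (S \<omega>)) k"
    and "has_bochner_integral M (\<lambda>\<omega>. w \<omega> * (LINT x|count_space (S \<omega>). k x)) (LINT x|\<mu>. k x)"
proof -
  have [measurable]: "k \<in> borel_measurable \<mu>" using int by auto
  define P where "P \<omega> = (\<integral>\<^sup>+x. ennreal (k x) \<partial>count_space (S \<omega>))" for \<omega>
  define Q where "Q \<omega> = (\<integral>\<^sup>+x. ennreal (- k x) \<partial>count_space (S \<omega>))" for \<omega>
  define R where "R \<omega> = (\<integral>\<^sup>+x. ennreal (norm (k x)) \<partial>count_space (S \<omega>))" for \<omega>
  have [measurable]: "P \<in> borel_measurable M" "Q \<in> borel_measurable M" "R \<in> borel_measurable M"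
    unfolding P_def[abs_def] Q_def[abs_def] R_def[abs_def] by (auto intro!: nn)
  have fin: "(\<integral>\<^sup>+x. ennreal (norm (k x)) \<partial>\<mu>) < \<infinity>" using int by (simp add: integrable_iff_bounded)
  have "(\<integral>\<^sup>+\<omega>. ennreal (w \<omega>) * R \<omega> \<partial>M) \<noteq> \<infinity>"
    unfolding R_def using fin by (subst campbell) auto
  moreover have w_ne: "ennreal (w \<omega>) \<noteq> 0" for \<omega> using w[of \<omega>] by (simp add: ennreal_eq_0_iff not_le)
  ultimately have "AE \<omega> in M. ennreal (w \<omega>) * R \<omega> \<noteq> \<infinity>"
    by (intro nn_integral_PInf_AE) measurable
  then have R: "AE \<omega> in M. R \<omega> < \<infinity>"
    by eventually_elim (auto simp: ennreal_mult_eq_top_iff top.not_eq_extremum w_ne)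
  then show "AE \<omega> in M. integrable (count_space (S \<omega>)) k"
    by eventually_elim (simp add: integrable_iff_bounded R_def)
  have le: "P \<omega> \<le> R \<omega>" "Q \<omega> \<le> R \<omega>" for \<omega>
    unfolding P_def Q_def R_def by (auto intro!: nn_integral_mono ennreal_leI)
  have PQ: "AE \<omega> in M. ennreal (enn2real (P \<omega>)) = P \<omega> \<and> ennreal (enn2real (Q \<omega>)) = Q \<omega>"
    using R
  proof eventually_elim
    case (elim \<omega>)
    have "P \<omega> < \<infinity>" "Q \<omega> < \<infinity>" using le[of \<omega>] elim by (auto intro: le_less_trans)
    then show ?case by simp
  qed
  have finP: "(\<integral>\<^sup>+x. ennreal (k x) \<partial>\<mu>) < \<infinity>" "(\<integral>\<^sup>+x. ennreal (- k x) \<partial>\<mu>) < \<infinity>"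
    by (intro le_less_trans[OF nn_integral_mono fin] ennreal_leI; simp)+
  have hP: "has_bochner_integral M (\<lambda>\<omega>. w \<omega> * enn2real (P \<omega>)) (enn2real (\<integral>\<^sup>+x. ennreal (k x) \<partial>\<mu>))"
  proof (rule has_bochner_integral_nn_integral)
    have "(\<integral>\<^sup>+\<omega>. ennreal (w \<omega> * enn2real (P \<omega>)) \<partial>M) = (\<integral>\<^sup>+\<omega>. ennreal (w \<omega>) * P \<omega> \<partial>M)"
      using PQ by (intro nn_integral_cong_AE) (auto simp: ennreal_mult' w less_imp_le)
    also have "\<dots> = (\<integral>\<^sup>+x. ennreal (k x) \<partial>\<mu>)" unfolding P_def by (rule campbell) measurable
    finally show "(\<integral>\<^sup>+\<omega>. ennreal (w \<omega> * enn2real (P \<omega>)) \<partial>M) = ennreal (enn2real (\<integral>\<^sup>+x. ennreal (k x) \<partial>\<mu>))"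
      using finP by simp
  qed (use w in \<open>auto simp: less_imp_le\<close>)
  have hQ: "has_bochner_integral M (\<lambda>\<omega>. w \<omega> * enn2real (Q \<omega>)) (enn2real (\<integral>\<^sup>+x. ennreal (- k x) \<partial>\<mu>))"
  proof (rule has_bochner_integral_nn_integral)
    have "(\<integral>\<^sup>+\<omega>. ennreal (w \<omega> * enn2real (Q \<omega>)) \<partial>M) = (\<integral>\<^sup>+\<omega>. ennreal (w \<omega>) * Q \<omega> \<partial>M)"
      using PQ by (intro nn_integral_cong_AE) (auto simp: ennreal_mult' w less_imp_le)
    also have "\<dots> = (\<integral>\<^sup>+x. ennreal (- k x) \<partial>\<mu>)" unfolding Q_def by (rule campbell) measurable
    finally show "(\<integral>\<^sup>+\<omega>. ennreal (w \<omega> * enn2real (Q \<omega>)) \<partial>M) = ennreal (enn2real (\<integral>\<^sup>+x. ennreal (- k x) \<partial>\<mu>))"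
      using finP by simp
  qed (use w in \<open>auto simp: less_imp_le\<close>)
  have "has_bochner_integral M (\<lambda>\<omega>. w \<omega> * enn2real (P \<omega>) - w \<omega> * enn2real (Q \<omega>)) (LINT x|\<mu>. k x)"
    using has_bochner_integral_diff[OF hP hQ] by (simp add: real_lebesgue_integral_def[OF int])
  moreover have [measurable]: "(\<lambda>\<omega>. LINT x|count_space (S \<omega>). k x) \<in> borel_measurable M"
  proof -
    have "(LINT x|count_space (S \<omega>). k x) = (if R \<omega> < \<infinity> then enn2real (P \<omega>) - enn2real (Q \<omega>) else 0)" for \<omega>
      by (auto simp: R_def P_def Q_def integrable_iff_bounded not_integrable_integral_eq intro!: real_lebesgue_integral_def)
    then show ?thesis by (simp only:) measurable
  qed
  moreover have "AE \<omega> in M. w \<omega> * enn2real (P \<omega>) - w \<omega> * enn2real (Q \<omega>) = w \<omega> * (LINT x|count_space (S \<omega>). k x)"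
    using R by eventually_elim
      (simp add: right_diff_distrib[symmetric] P_def Q_def R_def real_lebesgue_integral_def integrable_iff_bounded)
  ultimately show "has_bochner_integral M (\<lambda>\<omega>. w \<omega> * (LINT x|count_space (S \<omega>). k x)) (LINT x|\<mu>. k x)"
    by (subst (asm) has_bochner_integral_cong_AE) (auto simp: P_def[symmetric] Q_def[symmetric])
qed

lemma incseq_Int_ball: "incseq (\<lambda>n. A \<inter> ball (0::'a::real_normed_vector) (real n))"
  by (auto simp: incseq_def)

lemma UN_Int_ball: "(\<Union>n. A \<inter> ball (0::'a::real_normed_vector) (real n)) = A"
  using reals_Archimedean2 by auto

lemma measure_eqI_bounded:
  fixes M N :: "'a::euclidean_space measure"
  assumes sets: "sets M = sets borel" "sets N = sets borel"
    and eq: "\<And>A. A \<in> sets borel \<Longrightarrow> bounded A \<Longrightarrow> emeasure M A = emeasure N A"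
  shows "M = N"
proof (rule measure_eqI)
  fix A assume "A \<in> sets M"
  then have A: "A \<in> sets borel" by (simp add: sets)
  have r: "range (\<lambda>n. A \<inter> ball 0 (real n)) \<subseteq> sets borel" using A by auto
  have "emeasure M A = (SUP n. emeasure M (A \<inter> ball 0 (real n)))"
    using SUP_emeasure_incseq[of "\<lambda>n. A \<inter> ball 0 (real n)" M] r sets(1) incseq_Int_ball[of A] by (simp only: UN_Int_ball)
  also have "\<dots> = (SUP n. emeasure N (A \<inter> ball 0 (real n)))"
    using A by (intro SUP_cong refl eq) auto
  also have "\<dots> = emeasure N A"
    using SUP_emeasure_incseq[of "\<lambda>n. A \<inter> ball 0 (real n)" N] r sets(2) incseq_Int_ball[of A] by (simp only: UN_Int_ball)
  finally show "emeasure M A = emeasure N A" .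
qed (simp add: sets)

lemma nn_integral_indicator_count_space:
  assumes "finite (S \<inter> A)"
  shows "(\<integral>\<^sup>+x. indicator A x \<partial>count_space S) = ennreal (real (card (S \<inter> A)))"
proof -
  have "(\<integral>\<^sup>+x. indicator A x \<partial>count_space S) = (\<integral>\<^sup>+x. indicator (S \<inter> A) x \<partial>count_space S)"
    by (intro nn_integral_cong) (auto split: split_indicator)
  also have "\<dots> = emeasure (count_space S) (S \<inter> A)" by (intro nn_integral_indicator) auto
  finally show ?thesis using assms by (simp add: emeasure_count_space_finite ennreal_of_nat_eq_real_of_nat)
qed

context poisson_space begin

definition tilted_intensity :: "('a \<Rightarrow> real) \<Rightarrow> 'a measure" where
  "tilted_intensity \<phi> = density lborel (\<lambda>x. ennreal (z * exp (\<phi> x)))"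

definition tilt :: "('a \<Rightarrow> real) \<Rightarrow> 'a set \<Rightarrow> real" where
  "tilt \<phi> \<gamma> = exp (pairing \<phi> \<gamma>) / mean_exp \<phi>"

lemma sets_tilted_intensity[simp, measurable_cong]: "sets (tilted_intensity \<phi>) = sets borel" by (simp add: tilted_intensity_def)

lemma tilt_pos: "tilt \<phi> \<gamma> > 0" using mean_exp_pos[of \<phi>] by (simp add: tilt_def)

lemma mean_exp_tilt_mult: "mean_exp \<phi> * (tilt \<phi> \<gamma> * y) = exp (pairing \<phi> \<gamma>) * y"
  using mean_exp_pos[of \<phi>] by (simp add: tilt_def)

lemma tilt_measurable: "test_fun \<phi> \<Longrightarrow> tilt \<phi> \<in> borel_measurable \<pi>"
  unfolding tilt_def[abs_def] using pairing_measurable by (auto simp: test_fun_def)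

lemma sigma_finite_tilted_intensity: assumes "test_fun \<phi>" shows "sigma_finite_measure (tilted_intensity \<phi>)"
  unfolding tilted_intensity_def using assms by (subst sigma_finite_measure.sigma_finite_iff_density_finite[OF sigma_finite_lborel]) (auto simp: test_fun_def)

lemma emeasure_tilted_intensity:
  assumes \<phi>: "test_fun \<phi>" and A: "A \<in> sets borel" "bounded A"
  shows "emeasure (tilted_intensity \<phi>) A = ennreal (tilted_mass \<phi> A)"
proof -
  have [measurable]: "\<phi> \<in> borel_measurable borel" using \<phi> by (simp add: test_fun_def)
  have "emeasure (tilted_intensity \<phi>) A = (\<integral>\<^sup>+x. ennreal (z * (exp (\<phi> x) * indicator A x)) \<partial>lborel)"
    unfolding tilted_intensity_def using A by (subst emeasure_density) (auto intro!: nn_integral_cong split: split_indicator)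
  also have "\<dots> = ennreal (LINT x|lborel. z * (exp (\<phi> x) * indicator A x))"
    using exp_times_indicator_integrable[OF \<phi> A] z_pos
    by (intro nn_integral_eq_integral integrable_mult_right) auto
  finally show ?thesis by (simp add: tilted_mass_def)
qed

lemma nn_points_measurable_fixed:
  "g \<in> borel_measurable borel \<Longrightarrow> (\<lambda>\<gamma>. \<integral>\<^sup>+x. g x \<partial>count_space \<gamma>) \<in> borel_measurable \<pi>"
  using nn_points_measurable[of "\<lambda>p. g (snd p)"] by simp

lemma nn_pairs_measurable_fixed:
  "g \<in> borel_measurable (borel \<Otimes>\<^sub>M borel) \<Longrightarrow> (\<lambda>\<gamma>. \<integral>\<^sup>+p. g p \<partial>count_space (offdiag \<gamma>)) \<in> borel_measurable \<pi>"
  using nn_pairs_measurable[of "\<lambda>p. g (snd p)"] by simp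

text \<open>Both sides are measures in \<open>g\<close>; on bounded sets they agree by the weighted first moment of the
  counts.\<close>
lemma campbell1:
  assumes \<phi>: "test_fun \<phi>" and g: "g \<in> borel_measurable borel"
  shows "(\<integral>\<^sup>+\<gamma>. ennreal (tilt \<phi> \<gamma>) * (\<integral>\<^sup>+x. g x \<partial>count_space \<gamma>) \<partial>\<pi>) = (\<integral>\<^sup>+x. g x \<partial>tilted_intensity \<phi>)"
proof -
  obtain C where C: "sets C = sets (borel :: 'a measure)"
    "\<And>g. g \<in> borel_measurable borel \<Longrightarrow> (\<integral>\<^sup>+x. g x \<partial>C) = (\<integral>\<^sup>+\<gamma>. ennreal (tilt \<phi> \<gamma>) * (\<integral>\<^sup>+x. g x \<partial>count_space \<gamma>) \<partial>\<pi>)"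
    by (rule campbell_measure_exists[of borel "\<lambda>\<gamma>. \<gamma>" \<pi> "\<lambda>\<gamma>. ennreal (tilt \<phi> \<gamma>)"])
       (auto intro!: nn_points_measurable_fixed measurable_compose[OF tilt_measurable[OF \<phi>]])
  have "C = tilted_intensity \<phi>"
  proof (rule measure_eqI_bounded)
    fix A :: "'a set" assume A: "A \<in> sets borel" "bounded A"
    have "emeasure C A = (\<integral>\<^sup>+x. indicator A x \<partial>C)" using A C(1) by simp
    also have "\<dots> = (\<integral>\<^sup>+\<gamma>. ennreal (tilt \<phi> \<gamma>) * (\<integral>\<^sup>+x. indicator A x \<partial>count_space \<gamma>) \<partial>\<pi>)"
      using A by (intro C(2)) auto
    also have "\<dots> = (\<integral>\<^sup>+\<gamma>. ennreal (real (card (\<gamma> \<inter> A)) * exp (pairing \<phi> \<gamma>) / mean_exp \<phi>) \<partial>\<pi>)"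
      using A mean_exp_pos[of \<phi>]
      by (intro nn_integral_cong)
         (simp add: space_pi nn_integral_indicator_count_space configs_finite_Int tilt_def mult.commute flip: ennreal_mult)
    also have "\<dots> = ennreal (LINT \<gamma>|\<pi>. real (card (\<gamma> \<inter> A)) * exp (pairing \<phi> \<gamma>) / mean_exp \<phi>)"
      using integral_card_exp[OF \<phi> A] mean_exp_pos[of \<phi>]
      by (intro nn_integral_eq_integral) (auto simp: has_bochner_integral_iff)
    also have "\<dots> = emeasure (tilted_intensity \<phi>) A"
      using integral_card_exp[OF \<phi> A] mean_exp_pos[of \<phi>] by (simp add: emeasure_tilted_intensity[OF \<phi> A] has_bochner_integral_iff)
    finally show "emeasure C A = emeasure (tilted_intensity \<phi>) A" .
  qed (simp_all add: C)
  with C(2)[OF g] show ?thesis by simp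
qed

lemma card_offdiag:
  assumes "finite (\<gamma> \<inter> A)" "finite (\<gamma> \<inter> B)"
  shows "finite (offdiag \<gamma> \<inter> A \<times> B)"
    "real (card (offdiag \<gamma> \<inter> A \<times> B)) = real (card (\<gamma> \<inter> A)) * real (card (\<gamma> \<inter> B)) - real (card (\<gamma> \<inter> (A \<inter> B)))"
proof -
  have eq: "offdiag \<gamma> \<inter> A \<times> B = (\<gamma> \<inter> A) \<times> (\<gamma> \<inter> B) - (\<lambda>x. (x, x)) ` (\<gamma> \<inter> (A \<inter> B))"
    by (auto simp: offdiag_def)
  show "finite (offdiag \<gamma> \<inter> A \<times> B)" unfolding eq using assms by simp
  have sub: "(\<lambda>x. (x, x)) ` (\<gamma> \<inter> (A \<inter> B)) \<subseteq> (\<gamma> \<inter> A) \<times> (\<gamma> \<inter> B)" by auto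
  have "finite (\<gamma> \<inter> (A \<inter> B))" using assms by (auto intro: finite_subset[of _ "\<gamma> \<inter> A"])
  then have "card ((\<gamma> \<inter> A) \<times> (\<gamma> \<inter> B) - (\<lambda>x. (x, x)) ` (\<gamma> \<inter> (A \<inter> B)))
     = card ((\<gamma> \<inter> A) \<times> (\<gamma> \<inter> B)) - card ((\<lambda>x. (x, x)) ` (\<gamma> \<inter> (A \<inter> B)))"
    using sub by (intro card_Diff_subset) auto
  moreover have "card ((\<lambda>x. (x, x)) ` (\<gamma> \<inter> (A \<inter> B))) = card (\<gamma> \<inter> (A \<inter> B))"
    by (intro card_image inj_onI) auto
  moreover have "card ((\<lambda>x. (x, x)) ` (\<gamma> \<inter> (A \<inter> B))) \<le> card ((\<gamma> \<inter> A) \<times> (\<gamma> \<inter> B))"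
    using assms sub by (intro card_mono) auto
  ultimately show "real (card (offdiag \<gamma> \<inter> A \<times> B)) = real (card (\<gamma> \<inter> A)) * real (card (\<gamma> \<inter> B)) - real (card (\<gamma> \<inter> (A \<inter> B)))"
    unfolding eq by (simp add: card_cartesian_product of_nat_diff)
qed

text \<open>Removing the diagonal from the pairs in \<open>A \<times> B\<close> cancels the term for \<open>A \<inter> B\<close> in the weighted second moment,
  and the product of the two intensities remains.  Unbounded rectangles, which the uniqueness theorem
  for product measures also requires, are exhausted by bounded ones.\<close>
lemma campbell2:
  assumes \<phi>: "test_fun \<phi>" and g: "g \<in> borel_measurable (borel \<Otimes>\<^sub>M borel)"
  shows "(\<integral>\<^sup>+\<gamma>. ennreal (tilt \<phi> \<gamma>) * (\<integral>\<^sup>+p. g p \<partial>count_space (offdiag \<gamma>)) \<partial>\<pi>) = (\<integral>\<^sup>+p. g p \<partial>(tilted_intensity \<phi> \<Otimes>\<^sub>M tilted_intensity \<phi>))"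
proof -
  obtain C where C: "sets C = sets (borel \<Otimes>\<^sub>M borel :: ('a \<times> 'a) measure)"
    "\<And>g. g \<in> borel_measurable (borel \<Otimes>\<^sub>M borel) \<Longrightarrow>
      (\<integral>\<^sup>+x. g x \<partial>C) = (\<integral>\<^sup>+\<gamma>. ennreal (tilt \<phi> \<gamma>) * (\<integral>\<^sup>+x. g x \<partial>count_space (offdiag \<gamma>)) \<partial>\<pi>)"
    by (rule campbell_measure_exists[of "borel \<Otimes>\<^sub>M borel" offdiag \<pi> "\<lambda>\<gamma>. ennreal (tilt \<phi> \<gamma>)"])
       (auto intro!: nn_pairs_measurable_fixed measurable_compose[OF tilt_measurable[OF \<phi>]] simp: space_pair_measure)
  interpret sigma_finite_measure "tilted_intensity \<phi>" by (rule sigma_finite_tilted_intensity[OF \<phi>])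
  have rect: "emeasure C (A \<times> B) = emeasure (tilted_intensity \<phi> \<Otimes>\<^sub>M tilted_intensity \<phi>) (A \<times> B)"
    if A: "A \<in> sets borel" "bounded A" and B: "B \<in> sets borel" "bounded B" for A B
  proof -
    have AB: "A \<inter> B \<in> sets borel" "bounded (A \<inter> B)" using A B by (auto intro: bounded_Int)
    have "emeasure C (A \<times> B) = (\<integral>\<^sup>+p. indicator (A \<times> B) p \<partial>C)" using A B by (intro nn_integral_indicator[symmetric]) (simp add: C(1))
    also have "\<dots> = (\<integral>\<^sup>+\<gamma>. ennreal (tilt \<phi> \<gamma>) * (\<integral>\<^sup>+p. indicator (A \<times> B) p \<partial>count_space (offdiag \<gamma>)) \<partial>\<pi>)"
      using A B by (intro C(2)) auto
    also have "\<dots> = (\<integral>\<^sup>+\<gamma>. ennreal (tilt \<phi> \<gamma> * real (card (offdiag \<gamma> \<inter> A \<times> B))) \<partial>\<pi>)"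
      using A B tilt_pos[of \<phi>] 
      by (intro nn_integral_cong)
         (simp add: space_pi nn_integral_indicator_count_space card_offdiag(1) configs_finite_Int less_imp_le flip: ennreal_mult)
    also have "\<dots> = (\<integral>\<^sup>+\<gamma>. ennreal (real (card (offdiag \<gamma> \<inter> A \<times> B)) * exp (pairing \<phi> \<gamma>) / mean_exp \<phi>) \<partial>\<pi>)"
      by (simp add: tilt_def mult.commute)
    also have "\<dots> = ennreal (tilted_mass \<phi> A * tilted_mass \<phi> B)"
    proof -
      have "has_bochner_integral \<pi> (\<lambda>\<gamma>. (real (card (\<gamma> \<inter> A)) * real (card (\<gamma> \<inter> B)) * exp (pairing \<phi> \<gamma>)
           - real (card (\<gamma> \<inter> (A \<inter> B))) * exp (pairing \<phi> \<gamma>)) / mean_exp \<phi>)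
         ((mean_exp \<phi> * (tilted_mass \<phi> A * tilted_mass \<phi> B + tilted_mass \<phi> (A \<inter> B)) - mean_exp \<phi> * tilted_mass \<phi> (A \<inter> B)) / mean_exp \<phi>)"
        by (intro has_bochner_integral_divide_zero has_bochner_integral_diff integral_card_card_exp integral_card_exp \<phi> A B AB)
      also have "(mean_exp \<phi> * (tilted_mass \<phi> A * tilted_mass \<phi> B + tilted_mass \<phi> (A \<inter> B)) - mean_exp \<phi> * tilted_mass \<phi> (A \<inter> B)) / mean_exp \<phi> = tilted_mass \<phi> A * tilted_mass \<phi> B"
        using mean_exp_pos[of \<phi>] by (simp add: field_simps)
      finally have h: "has_bochner_integral \<pi> (\<lambda>\<gamma>. (real (card (\<gamma> \<inter> A)) * real (card (\<gamma> \<inter> B)) * exp (pairing \<phi> \<gamma>)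
           - real (card (\<gamma> \<inter> (A \<inter> B))) * exp (pairing \<phi> \<gamma>)) / mean_exp \<phi>) (tilted_mass \<phi> A * tilted_mass \<phi> B)" .
      have "has_bochner_integral \<pi> (\<lambda>\<gamma>. real (card (offdiag \<gamma> \<inter> A \<times> B)) * exp (pairing \<phi> \<gamma>) / mean_exp \<phi>) (tilted_mass \<phi> A * tilted_mass \<phi> B)"
        by (rule has_bochner_integral_cong[THEN iffD1, OF refl _ refl h])
           (use A B in \<open>simp add: space_pi card_offdiag configs_finite_Int left_diff_distrib\<close>)
      then show ?thesis using mean_exp_pos[of \<phi>]
        by (subst nn_integral_eq_integral) (auto simp: has_bochner_integral_iff)
    qed
    also have "\<dots> = emeasure (tilted_intensity \<phi> \<Otimes>\<^sub>M tilted_intensity \<phi>) (A \<times> B)"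
      using A B by (subst emeasure_pair_measure_Times) (auto simp: emeasure_tilted_intensity[OF \<phi>] tilted_mass_nonneg ennreal_mult)
    finally show ?thesis .
  qed
  have "tilted_intensity \<phi> \<Otimes>\<^sub>M tilted_intensity \<phi> = C"
  proof (rule pair_measure_eqI)
    show "sigma_finite_measure (tilted_intensity \<phi>)" "sigma_finite_measure (tilted_intensity \<phi>)" by (rule sigma_finite_tilted_intensity[OF \<phi>])+
    show sets: "sets (tilted_intensity \<phi> \<Otimes>\<^sub>M tilted_intensity \<phi>) = sets C" unfolding C(1) by (intro sets_pair_measure_cong) auto
    fix A B assume "A \<in> sets (tilted_intensity \<phi>)" "B \<in> sets (tilted_intensity \<phi>)"
    then have A: "A \<in> sets borel" and B: "B \<in> sets borel" by auto
    let ?X = "\<lambda>n. (A \<inter> ball 0 (real n)) \<times> (B \<inter> ball 0 (real n))"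
    have X: "range ?X \<subseteq> sets C" using A B unfolding C(1) by auto
    have inc: "incseq ?X" by (auto simp: incseq_def)
    have un: "(\<Union>n. ?X n) = A \<times> B"
    proof (intro equalityI subsetI)
      fix p assume p: "p \<in> A \<times> B"
      obtain n where "max (norm (fst p)) (norm (snd p)) < real n" using reals_Archimedean2 by blast
      then have "p \<in> ?X n" using p by auto
      then show "p \<in> (\<Union>n. ?X n)" by blast
    qed auto
    have "emeasure (tilted_intensity \<phi>) A * emeasure (tilted_intensity \<phi>) B = emeasure (tilted_intensity \<phi> \<Otimes>\<^sub>M tilted_intensity \<phi>) (A \<times> B)"
      using A B by (subst emeasure_pair_measure_Times) auto
    also have "\<dots> = (SUP n. emeasure (tilted_intensity \<phi> \<Otimes>\<^sub>M tilted_intensity \<phi>) (?X n))"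
      using SUP_emeasure_incseq[of ?X "tilted_intensity \<phi> \<Otimes>\<^sub>M tilted_intensity \<phi>"] X inc by (simp only: un sets)
    also have "\<dots> = (SUP n. emeasure C (?X n))"
      using A B by (intro SUP_cong refl rect[symmetric]) (auto intro: bounded_Int)
    also have "\<dots> = emeasure C (A \<times> B)"
      using SUP_emeasure_incseq[of ?X C] X inc by (simp only: un)
    finally show "emeasure (tilted_intensity \<phi>) A * emeasure (tilted_intensity \<phi>) B = emeasure C (A \<times> B)" .
  qed
  with C(2)[OF g] show ?thesis by simp
qed

section \<open>The Mecke formula\<close>

lemma mecke_points:
  assumes \<phi>: "test_fun \<phi>" and k: "k \<in> borel_measurable borel"
    and int: "integrable lborel (\<lambda>x. exp (\<phi> x) * k x)"
  shows "has_bochner_integral \<pi> (\<lambda>\<gamma>. exp (pairing \<phi> \<gamma>) * (LINT x|count_space \<gamma>. k x))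
     (mean_exp \<phi> * (z * (LINT x|lborel. exp (\<phi> x) * k x)))"
proof -
  have [measurable]: "\<phi> \<in> borel_measurable borel" using \<phi> by (simp add: test_fun_def)
  note [measurable] = k
  have i: "integrable (tilted_intensity \<phi>) k"
    unfolding tilted_intensity_def using z_pos integrable_mult_right[OF int, of z]
    by (subst integrable_density) (auto simp: mult_ac)
  have l: "(LINT x|tilted_intensity \<phi>. k x) = z * (LINT x|lborel. exp (\<phi> x) * k x)"
    unfolding tilted_intensity_def using z_pos by (subst integral_density) (auto simp: mult_ac)
  have "has_bochner_integral \<pi> (\<lambda>\<gamma>. tilt \<phi> \<gamma> * (LINT x|count_space \<gamma>. k x)) (LINT x|tilted_intensity \<phi>. k x)"
    by (rule campbell_signed) (auto intro!: nn_points_measurable_fixed campbell1 tilt_measurable tilt_pos \<phi> i)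
  from has_bochner_integral_mult_right[OF this, of "mean_exp \<phi>"]
  show ?thesis by (simp only: mean_exp_tilt_mult l)
qed

text \<open>The almost sure convergence is needed in addition to the formula: without it the generator could not be
  evaluated term by term on combinations of exponentials.\<close>
lemma mecke_pairs:
  assumes \<phi>: "test_fun \<phi>" and k: "k \<in> borel_measurable (borel \<Otimes>\<^sub>M borel)"
    and int: "integrable (lborel \<Otimes>\<^sub>M lborel) (\<lambda>p. exp (\<phi> (fst p) + \<phi> (snd p)) * k p)"
  shows "AE \<gamma> in \<pi>. integrable (count_space (offdiag \<gamma>)) k"
    and "has_bochner_integral \<pi> (\<lambda>\<gamma>. exp (pairing \<phi> \<gamma>) * (LINT p|count_space (offdiag \<gamma>). k p))
     (mean_exp \<phi> * (z\<^sup>2 * (LINT p|(lborel \<Otimes>\<^sub>M lborel). exp (\<phi> (fst p) + \<phi> (snd p)) * k p)))"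
proof -
  have [measurable]: "\<phi> \<in> borel_measurable borel" using \<phi> by (simp add: test_fun_def)
  have kl[measurable]: "k \<in> borel_measurable (lborel \<Otimes>\<^sub>M lborel)"
    using k by simp
  have rr: "tilted_intensity \<phi> \<Otimes>\<^sub>M tilted_intensity \<phi> = density (lborel \<Otimes>\<^sub>M lborel) (\<lambda>p. ennreal (z\<^sup>2 * exp (\<phi> (fst p) + \<phi> (snd p))))"
    unfolding tilted_intensity_def using sigma_finite_tilted_intensity[OF \<phi>] z_pos
    by (subst pair_measure_density)
       (auto simp: tilted_intensity_def sigma_finite_lborel case_prod_beta' power2_eq_square exp_add mult_ac less_imp_le
          intro!: density_cong simp flip: ennreal_mult)
  have i: "integrable (tilted_intensity \<phi> \<Otimes>\<^sub>M tilted_intensity \<phi>) k"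
    unfolding rr using z_pos integrable_mult_right[OF int, of "z\<^sup>2"]
    by (subst integrable_density) (auto simp: mult_ac)
  have l: "(LINT x|(tilted_intensity \<phi> \<Otimes>\<^sub>M tilted_intensity \<phi>). k x) = z\<^sup>2 * (LINT p|(lborel \<Otimes>\<^sub>M lborel). exp (\<phi> (fst p) + \<phi> (snd p)) * k p)"
    unfolding rr using z_pos by (subst integral_density) (auto simp: mult_ac simp flip: integral_mult_right_zero)
  have m: "g \<in> borel_measurable (tilted_intensity \<phi> \<Otimes>\<^sub>M tilted_intensity \<phi>) \<longleftrightarrow> g \<in> borel_measurable (borel \<Otimes>\<^sub>M borel)" for g :: "'a \<times> 'a \<Rightarrow> ennreal"
    by (intro arg_cong2[where f="(\<in>)"] refl measurable_cong_sets sets_pair_measure_cong) auto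
  have nn: "(\<lambda>\<gamma>. \<integral>\<^sup>+p. g p \<partial>count_space (offdiag \<gamma>)) \<in> borel_measurable \<pi>"
    if "g \<in> borel_measurable (tilted_intensity \<phi> \<Otimes>\<^sub>M tilted_intensity \<phi>)" for g :: "'a \<times> 'a \<Rightarrow> ennreal"
    using that unfolding m by (rule nn_pairs_measurable_fixed)
  have c: "(\<integral>\<^sup>+\<gamma>. ennreal (tilt \<phi> \<gamma>) * (\<integral>\<^sup>+p. g p \<partial>count_space (offdiag \<gamma>)) \<partial>\<pi>) = (\<integral>\<^sup>+p. g p \<partial>(tilted_intensity \<phi> \<Otimes>\<^sub>M tilted_intensity \<phi>))"
    if "g \<in> borel_measurable (tilted_intensity \<phi> \<Otimes>\<^sub>M tilted_intensity \<phi>)" for g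
    using that unfolding m by (rule campbell2[OF \<phi>])
  note s = campbell_signed[OF nn c tilt_measurable[OF \<phi>] tilt_pos i]
  show "AE \<gamma> in \<pi>. integrable (count_space (offdiag \<gamma>)) k" by (rule s(1))
  from has_bochner_integral_mult_right[OF s(2), of "mean_exp \<phi>"]
  show "has_bochner_integral \<pi> (\<lambda>\<gamma>. exp (pairing \<phi> \<gamma>) * (LINT p|count_space (offdiag \<gamma>). k p))
     (mean_exp \<phi> * (z\<^sup>2 * (LINT p|(lborel \<Otimes>\<^sub>M lborel). exp (\<phi> (fst p) + \<phi> (snd p)) * k p)))"
    by (simp only: mean_exp_tilt_mult l)
qed

end

section \<open>The pair interaction\<close>

text \<open>Used with \<open>c = 1\<close> and \<open>c = -1\<close>, when \<open>b (x\<^sub>2 - x\<^sub>1)\<close> is integrated over \<open>x\<^sub>2\<close> and over \<open>x\<^sub>1\<close>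
  respectively.\<close>
lemma nn_integral_lborel_reflect:
  fixes f :: "'a::euclidean_space \<Rightarrow> ennreal"
  assumes [measurable]: "f \<in> borel_measurable borel" and c: "\<bar>c\<bar> = 1"
  shows "(\<integral>\<^sup>+x. f (t + c *\<^sub>R x) \<partial>lborel) = (\<integral>\<^sup>+x. f x \<partial>lborel)"
proof -
  have "(\<integral>\<^sup>+x. f x \<partial>lborel) = (\<integral>\<^sup>+x. f x \<partial>distr lborel borel (\<lambda>x. t + c *\<^sub>R x))"
    using c by (subst lborel_affine[of c t]) (auto simp: density_1)
  also have "\<dots> = (\<integral>\<^sup>+x. f (t + c *\<^sub>R x) \<partial>lborel)"
    by (subst nn_integral_distr) auto
  finally show ?thesis ..
qed

lemma test_fun_cmult: assumes "test_fun \<phi>" shows "test_fun (\<lambda>x. c * \<phi> x)"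
proof -
  obtain C r where *: "\<And>x. \<bar>\<phi> x\<bar> \<le> C * indicator (ball 0 r) x" "C > 0"
    using assms by (metis test_fun_bound)
  have "\<bar>c * \<phi> x\<bar> \<le> (\<bar>c\<bar> * C) * indicator (ball 0 r) x" for x
    using mult_left_mono[OF *(1)[of x], of "\<bar>c\<bar>"] by (simp add: abs_mult mult_ac)
  then show ?thesis using assms by (intro test_funI) (auto simp: test_fun_def)
qed

lemma pairing_cmult:
  assumes "\<gamma> \<in> configs" "test_fun \<phi>"
  shows "pairing (\<lambda>x. c * \<phi> x) \<gamma> = c * pairing \<phi> \<gamma>"
proof -
  have B: "bounded {x. \<phi> x \<noteq> 0}" using assms by (simp add: test_fun_def)
  show ?thesis
    using assms B by (subst (1 2) pairing_eq_sum[of _ "{x. \<phi> x \<noteq> 0}"]) (auto simp: sum_distrib_left)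
qed

lemma test_fun_uminus: "test_fun \<phi> \<Longrightarrow> test_fun (\<lambda>x. - \<phi> x)"
  using test_fun_cmult[of \<phi> "-1"] by simp

lemma test_fun_mult:
  assumes "test_fun \<phi>" "test_fun \<psi>" shows "test_fun (\<lambda>x. \<phi> x * \<psi> x)"
proof -
  obtain C r D s where *: "\<And>x. \<bar>\<phi> x\<bar> \<le> C * indicator (ball 0 r) x" "C > 0"
    "\<And>x. \<bar>\<psi> x\<bar> \<le> D * indicator (ball 0 s) x" "D > 0"
    using assms by (metis test_fun_bound)
  have "\<bar>\<phi> x * \<psi> x\<bar> \<le> (C * D) * indicator (ball 0 r) x" for x
    using *(1)[of x] *(3)[of x] *(2,4) mult_mono[of "\<bar>\<phi> x\<bar>" C "\<bar>\<psi> x\<bar>" D]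
    by (auto simp: abs_mult split: split_indicator split_indicator_asm)
  then show ?thesis using assms by (intro test_funI) (auto simp: test_fun_def)
qed

definition pair_exp :: "('a \<Rightarrow> real) \<Rightarrow> 'a \<times> 'a \<Rightarrow> real" where
  "pair_exp \<phi> p = exp (\<phi> (fst p) + \<phi> (snd p))"

lemma pair_exp_measurable[measurable]:
  assumes [measurable]: "\<phi> \<in> borel_measurable borel" shows "pair_exp \<phi> \<in> borel_measurable (borel \<Otimes>\<^sub>M borel)"
  unfolding pair_exp_def[abs_def] by measurable

lemma pair_exp_uminus: "pair_exp \<phi> p * pair_exp (\<lambda>x. - \<phi> x) p = 1"
  by (simp add: pair_exp_def exp_add[symmetric])

locale poisson_kernel = poisson_space \<pi> z for \<pi> :: "'a::euclidean_space set measure" and z +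
  fixes b :: "'a \<Rightarrow> ennreal"
  assumes b_measurable[measurable]: "b \<in> borel_measurable borel" and b_finite: "(\<integral>\<^sup>+x. b x \<partial>lborel) < \<infinity>"
begin

definition pair_rate :: "'a \<times> 'a \<Rightarrow> real" where "pair_rate p = enn2real (b (snd p - fst p))"

definition \<beta> :: real where "\<beta> = integral_dx b"

lemma pair_rate_nonneg: "pair_rate p \<ge> 0" by (simp add: pair_rate_def)

lemma beta_nonneg: "\<beta> \<ge> 0" by (simp add: \<beta>_def integral_dx_def)

lemma pair_rate_measurable[measurable]: "pair_rate \<in> borel_measurable (borel \<Otimes>\<^sub>M borel)"
  unfolding pair_rate_def[abs_def] by measurable

lemma measurable_pair_lborel: "f \<in> borel_measurable (borel \<Otimes>\<^sub>M borel) \<Longrightarrow> f \<in> borel_measurable (lborel \<Otimes>\<^sub>M lborel)"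
  by simp

lemma nn_integral_b_finite: "(\<integral>\<^sup>+x. ennreal (enn2real (b x)) \<partial>lborel) < \<infinity>"
proof -
  have "(\<integral>\<^sup>+x. ennreal (enn2real (b x)) \<partial>lborel) \<le> (\<integral>\<^sup>+x. b x \<partial>lborel)"
    by (intro nn_integral_mono) (metis enn2real_top ennreal_0 ennreal_enn2real le_less linear top.not_eq_extremum zero_le)
  with b_finite show ?thesis by (rule le_less_trans[rotated])
qed

text \<open>One of the two points is confined to a ball; integrating over the other one first leaves \<open>\<integral> b dx\<close> times
  the volume of the ball.\<close>
lemma pair_rate_integrable:
  assumes [measurable]: "h \<in> borel_measurable (borel \<Otimes>\<^sub>M borel)"
    and h: "\<And>p. \<bar>h p\<bar> \<le> C * (indicator (ball 0 r) (fst p) + indicator (ball 0 r) (snd p))" and C: "C \<ge> 0"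
  shows "integrable (lborel \<Otimes>\<^sub>M lborel) (\<lambda>p. pair_rate p * h p)"
proof -
  let ?I = "\<integral>\<^sup>+x. ennreal (enn2real (b x)) \<partial>lborel"
  let ?K = "ball 0 r :: 'a set"
  have K: "emeasure lborel ?K < \<infinity>" by (rule emeasure_bounded_finite) simp
  have [measurable]: "?K \<in> sets borel" by simp
  have m: "(\<lambda>p. ennreal (norm (pair_rate p * indicator ?K (fst p)))) \<in> borel_measurable (lborel \<Otimes>\<^sub>M lborel)"
    "(\<lambda>p. ennreal (norm (pair_rate p * indicator ?K (snd p)))) \<in> borel_measurable (lborel \<Otimes>\<^sub>M lborel)"
    by (intro measurable_pair_lborel; measurable)+
  have 1: "integrable (lborel \<Otimes>\<^sub>M lborel) (\<lambda>p. pair_rate p * indicator ?K (fst p))"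
  proof (rule integrableI_bounded)
    have "(\<integral>\<^sup>+p. ennreal (norm (pair_rate p * indicator ?K (fst p))) \<partial>(lborel \<Otimes>\<^sub>M lborel))
      = (\<integral>\<^sup>+x1. \<integral>\<^sup>+x2. ennreal (enn2real (b (- x1 + 1 *\<^sub>R x2))) * indicator ?K x1 \<partial>lborel \<partial>lborel)"
      by (subst lborel.nn_integral_fst[OF m(1), symmetric])
         (auto simp: pair_rate_def intro!: nn_integral_cong split: split_indicator)
    also have "\<dots> = (\<integral>\<^sup>+x1. ?I * indicator ?K x1 \<partial>lborel)"
      by (intro nn_integral_cong) (subst nn_integral_multc, simp, subst nn_integral_lborel_reflect[of "\<lambda>x. ennreal (enn2real (b x))"], auto)
    also have "\<dots> < \<infinity>" using K nn_integral_b_finite by (simp add: nn_integral_cmult ennreal_mult_less_top)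
    finally show "(\<integral>\<^sup>+p. ennreal (norm (pair_rate p * indicator ?K (fst p))) \<partial>(lborel \<Otimes>\<^sub>M lborel)) < \<infinity>" .
  qed (intro measurable_pair_lborel; measurable)
  have 2: "integrable (lborel \<Otimes>\<^sub>M lborel) (\<lambda>p. pair_rate p * indicator ?K (snd p))"
  proof (rule integrableI_bounded)
    have "(\<integral>\<^sup>+p. ennreal (norm (pair_rate p * indicator ?K (snd p))) \<partial>(lborel \<Otimes>\<^sub>M lborel))
      = (\<integral>\<^sup>+x2. \<integral>\<^sup>+x1. ennreal (enn2real (b (x2 + (-1) *\<^sub>R x1))) * indicator ?K x2 \<partial>lborel \<partial>lborel)"
      by (subst lborel_pair.nn_integral_snd[OF m(2), symmetric])
         (auto simp: pair_rate_def intro!: nn_integral_cong split: split_indicator)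
    also have "\<dots> = (\<integral>\<^sup>+x2. ?I * indicator ?K x2 \<partial>lborel)"
      by (intro nn_integral_cong) (subst nn_integral_multc, simp, subst nn_integral_lborel_reflect[of "\<lambda>x. ennreal (enn2real (b x))"], auto)
    also have "\<dots> < \<infinity>" using K nn_integral_b_finite by (simp add: nn_integral_cmult ennreal_mult_less_top)
    finally show "(\<integral>\<^sup>+p. ennreal (norm (pair_rate p * indicator ?K (snd p))) \<partial>(lborel \<Otimes>\<^sub>M lborel)) < \<infinity>" .
  qed (intro measurable_pair_lborel; measurable)
  have 3: "integrable (lborel \<Otimes>\<^sub>M lborel) (\<lambda>p. C * (pair_rate p * indicator ?K (fst p) + pair_rate p * indicator ?K (snd p)))"
    by (intro integrable_mult_right Bochner_Integration.integrable_add 1 2)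
  show ?thesis
  proof (rule Bochner_Integration.integrable_bound[OF 3])
    show "(\<lambda>p. pair_rate p * h p) \<in> borel_measurable (lborel \<Otimes>\<^sub>M lborel)" by (intro measurable_pair_lborel) measurable
    show "AE p in lborel \<Otimes>\<^sub>M lborel. norm (pair_rate p * h p) \<le> norm (C * (pair_rate p * indicator ?K (fst p) + pair_rate p * indicator ?K (snd p)))"
    proof (rule AE_I2)
      fix p :: "'a \<times> 'a"
      have "\<bar>pair_rate p * h p\<bar> \<le> pair_rate p * (C * (indicator ?K (fst p) + indicator ?K (snd p)))"
        using pair_rate_nonneg[of p] h[of p] by (auto simp: abs_mult intro!: mult_left_mono)
      then show "norm (pair_rate p * h p) \<le> norm (C * (pair_rate p * indicator ?K (fst p) + pair_rate p * indicator ?K (snd p)))"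
        using pair_rate_nonneg[of p] C by (auto simp: algebra_simps)
    qed
  qed
qed

lemma pair_rate_pair_exp_integrable:
  assumes \<phi>: "test_fun \<phi>" and \<psi>: "test_fun \<psi>"
  shows "integrable (lborel \<Otimes>\<^sub>M lborel) (\<lambda>p. pair_rate p * (pair_exp \<phi> p * (pair_exp \<psi> p - 1)))"
proof -
  have [measurable]: "\<phi> \<in> borel_measurable borel" "\<psi> \<in> borel_measurable borel" using \<phi> \<psi> by (auto simp: test_fun_def)
  obtain C r D s where *: "\<And>x. \<bar>\<phi> x\<bar> \<le> C * indicator (ball 0 r) x" "C > 0"
    "\<And>x. \<bar>\<psi> x\<bar> \<le> D * indicator (ball 0 s) x" "D > 0"
    using \<phi> \<psi> by (metis test_fun_bound)
  show ?thesis
  proof (rule pair_rate_integrable)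
    fix p :: "'a \<times> 'a"
    show "\<bar>pair_exp \<phi> p * (pair_exp \<psi> p - 1)\<bar>
        \<le> (exp (2 * C) * (exp (2 * D) + 1)) * (indicator (ball 0 s) (fst p) + indicator (ball 0 s) (snd p))"
    proof (cases "fst p \<in> ball 0 s \<or> snd p \<in> ball 0 s")
      case True
      have c: "\<bar>\<phi> x\<bar> \<le> C" "\<bar>\<psi> x\<bar> \<le> D" for x
        using *(1)[of x] *(3)[of x] *(2,4) by (auto split: split_indicator_asm)
      have u: "pair_exp \<phi> p \<le> exp (2 * C)" "pair_exp \<psi> p \<le> exp (2 * D)"
        unfolding pair_exp_def using c(1)[of "fst p"] c(1)[of "snd p"] c(2)[of "fst p"] c(2)[of "snd p"] by auto
      have p: "pair_exp \<phi> p > 0" "pair_exp \<psi> p > 0" by (auto simp: pair_exp_def)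
      have "\<bar>pair_exp \<psi> p - 1\<bar> \<le> exp (2 * D) + 1" using u(2) p(2) by (simp add: abs_le_iff)
      then have "\<bar>pair_exp \<phi> p * (pair_exp \<psi> p - 1)\<bar> \<le> exp (2 * C) * (exp (2 * D) + 1)"
        unfolding abs_mult using u(1) p(1) by (intro mult_mono) auto
      also have "\<dots> \<le> (exp (2 * C) * (exp (2 * D) + 1)) * (indicator (ball 0 s) (fst p) + indicator (ball 0 s) (snd p))"
        using True by (auto split: split_indicator intro!: mult_nonneg_nonneg add_nonneg_nonneg)
      finally show ?thesis .
    next
      case False
      then have "\<psi> (fst p) = 0" "\<psi> (snd p) = 0" using *(3)[of "fst p"] *(3)[of "snd p"] by auto
      then show ?thesis by (simp add: pair_exp_def)
    qed
  qed (auto intro!: mult_nonneg_nonneg add_nonneg_nonneg)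
qed

section \<open>The form on exponentials\<close>

text \<open>Up to constants, the functions by which the four parts of the generator multiply \<open>exp \<langle>\<phi>, \<gamma>\<rangle>\<close>.  The two birth terms do not
  depend on the configuration, because configurations are Lebesgue null sets.\<close>
definition pair_death :: "('a \<Rightarrow> real) \<Rightarrow> 'a set \<Rightarrow> real" where
  "pair_death \<phi> \<gamma> = (LINT p|count_space (offdiag \<gamma>). pair_rate p * (pair_exp (\<lambda>x. - \<phi> x) p - 1))"
definition pair_birth :: "('a \<Rightarrow> real) \<Rightarrow> real" where
  "pair_birth \<phi> = z\<^sup>2 * (LINT p|(lborel \<Otimes>\<^sub>M lborel). pair_rate p * (pair_exp \<phi> p - 1))"
definition point_death :: "('a \<Rightarrow> real) \<Rightarrow> 'a set \<Rightarrow> real" where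
  "point_death \<phi> \<gamma> = pairing (\<lambda>x. exp (- \<phi> x) - 1) \<gamma>"
definition point_birth :: "('a \<Rightarrow> real) \<Rightarrow> real" where
  "point_birth \<phi> = z * (LINT x|lborel. exp (\<phi> x) - 1)"

text \<open>Up to constants and the factor \<open>E[e\<^sub>\<phi> e\<^sub>\<psi>]\<close>, these are the contributions of pairs and of single points to the
  form at \<open>e\<^sub>\<phi>\<close>, \<open>e\<^sub>\<psi>\<close>.\<close>
definition pair_form :: "('a \<Rightarrow> real) \<Rightarrow> ('a \<Rightarrow> real) \<Rightarrow> real" where
  "pair_form \<phi> \<psi> = z\<^sup>2 * (LINT p|(lborel \<Otimes>\<^sub>M lborel). pair_rate p * ((pair_exp \<phi> p - 1) * (pair_exp \<psi> p - 1)))"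
definition point_form :: "('a \<Rightarrow> real) \<Rightarrow> ('a \<Rightarrow> real) \<Rightarrow> real" where
  "point_form \<phi> \<psi> = z * (LINT x|lborel. (exp (\<phi> x) - 1) * (exp (\<psi> x) - 1))"

text \<open>The Mecke formula replaces the sum over pairs of points by an integral with the additional factor
  \<open>\<Phi> \<Psi>\<close>, where \<open>\<Phi> = exp (\<phi> x\<^sub>1 + \<phi> x\<^sub>2)\<close> and \<open>\<Psi>\<close> is formed likewise from \<open>\<psi>\<close>.  Then
  \<open>\<Phi> \<Psi> (1 / \<Phi> - 1) + (\<Phi> - 1) = - (\<Phi> - 1) (\<Psi> - 1)\<close>.\<close>
lemma pair_death_birth:
  assumes \<phi>: "test_fun \<phi>" and \<psi>: "test_fun \<psi>"
  shows "AE \<gamma> in \<pi>. integrable (count_space (offdiag \<gamma>)) (\<lambda>p. pair_rate p * (pair_exp (\<lambda>x. - \<phi> x) p - 1))"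
    and "has_bochner_integral \<pi> (\<lambda>\<gamma>. exp (pairing (\<lambda>x. \<phi> x + \<psi> x) \<gamma>) * (pair_death \<phi> \<gamma> + pair_birth \<phi>))
       (- (mean_exp (\<lambda>x. \<phi> x + \<psi> x) * pair_form \<phi> \<psi>))"
proof -
  have [measurable]: "\<phi> \<in> borel_measurable borel" "\<psi> \<in> borel_measurable borel" using \<phi> \<psi> by (auto simp: test_fun_def)
  have e: "test_fun (\<lambda>x. \<phi> x + \<psi> x)" using \<phi> \<psi> by (rule test_fun_add)
  have zero: "test_fun (\<lambda>x. 0 :: real)" by (simp add: test_fun_def image_constant_conv)
  have k: "(\<lambda>p. pair_rate p * (pair_exp (\<lambda>x. - \<phi> x) p - 1)) \<in> borel_measurable (borel \<Otimes>\<^sub>M borel)" by measurable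
  have i0: "integrable (lborel \<Otimes>\<^sub>M lborel) (\<lambda>p. pair_rate p * (pair_exp (\<lambda>x. \<phi> x + \<psi> x) p * (pair_exp (\<lambda>x. - \<phi> x) p - 1)))"
    by (rule pair_rate_pair_exp_integrable[OF e test_fun_uminus[OF \<phi>]])
  have i: "integrable (lborel \<Otimes>\<^sub>M lborel) (\<lambda>p. exp ((\<phi> (fst p) + \<psi> (fst p)) + (\<phi> (snd p) + \<psi> (snd p))) * (pair_rate p * (pair_exp (\<lambda>x. - \<phi> x) p - 1)))"
    using i0 by (simp add: pair_exp_def mult_ac)
  have i1: "integrable (lborel \<Otimes>\<^sub>M lborel) (\<lambda>p. pair_rate p * (pair_exp \<phi> p - 1))"
    using pair_rate_pair_exp_integrable[OF zero \<phi>] by (simp add: pair_exp_def)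
  note m = mecke_pairs[OF e k i]
  show "AE \<gamma> in \<pi>. integrable (count_space (offdiag \<gamma>)) (\<lambda>p. pair_rate p * (pair_exp (\<lambda>x. - \<phi> x) p - 1))"
    by (rule m(1))
  have "has_bochner_integral \<pi> (\<lambda>\<gamma>. exp (pairing (\<lambda>x. \<phi> x + \<psi> x) \<gamma>)) (mean_exp (\<lambda>x. \<phi> x + \<psi> x))"
    using laplace[OF e] by (simp add: has_bochner_integral_iff)
  from has_bochner_integral_add[OF m(2) has_bochner_integral_mult_left[OF this, of "pair_birth \<phi>"]]
  have h: "has_bochner_integral \<pi> (\<lambda>\<gamma>. exp (pairing (\<lambda>x. \<phi> x + \<psi> x) \<gamma>) * (pair_death \<phi> \<gamma> + pair_birth \<phi>))
     (mean_exp (\<lambda>x. \<phi> x + \<psi> x) * (z\<^sup>2 * (LINT p|(lborel \<Otimes>\<^sub>M lborel).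
        exp ((\<phi> (fst p) + \<psi> (fst p)) + (\<phi> (snd p) + \<psi> (snd p))) * (pair_rate p * (pair_exp (\<lambda>x. - \<phi> x) p - 1)))) + mean_exp (\<lambda>x. \<phi> x + \<psi> x) * pair_birth \<phi>)"
    by (simp only: distrib_left pair_death_def)
  have "(LINT p|(lborel \<Otimes>\<^sub>M lborel).
        exp ((\<phi> (fst p) + \<psi> (fst p)) + (\<phi> (snd p) + \<psi> (snd p))) * (pair_rate p * (pair_exp (\<lambda>x. - \<phi> x) p - 1)))
      + (LINT p|(lborel \<Otimes>\<^sub>M lborel). pair_rate p * (pair_exp \<phi> p - 1))
    = (LINT p|(lborel \<Otimes>\<^sub>M lborel).
        exp ((\<phi> (fst p) + \<psi> (fst p)) + (\<phi> (snd p) + \<psi> (snd p))) * (pair_rate p * (pair_exp (\<lambda>x. - \<phi> x) p - 1))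
          + pair_rate p * (pair_exp \<phi> p - 1))"
    using i i1 by (simp only: Bochner_Integration.integral_add)
  also have "\<dots> = (LINT p|(lborel \<Otimes>\<^sub>M lborel). - (pair_rate p * ((pair_exp \<phi> p - 1) * (pair_exp \<psi> p - 1))))"
  proof (rule Bochner_Integration.integral_cong[OF refl])
    fix p
    have 1: "exp ((\<phi> (fst p) + \<psi> (fst p)) + (\<phi> (snd p) + \<psi> (snd p))) = pair_exp \<phi> p * pair_exp \<psi> p"
      by (simp add: pair_exp_def exp_add mult_ac)
    have 2: "pair_exp \<phi> p * (pair_exp \<psi> p * (pair_rate p * pair_exp (\<lambda>x. - \<phi> x) p)) = pair_exp \<psi> p * pair_rate p"
    proof -
      have "pair_exp \<phi> p * (pair_exp \<psi> p * (pair_rate p * pair_exp (\<lambda>x. - \<phi> x) p))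
         = (pair_exp \<phi> p * pair_exp (\<lambda>x. - \<phi> x) p) * (pair_exp \<psi> p * pair_rate p)" by (simp only: mult_ac)
      then show ?thesis by (simp add: pair_exp_uminus)
    qed
    show "exp ((\<phi> (fst p) + \<psi> (fst p)) + (\<phi> (snd p) + \<psi> (snd p))) * (pair_rate p * (pair_exp (\<lambda>x. - \<phi> x) p - 1))
          + pair_rate p * (pair_exp \<phi> p - 1) = - (pair_rate p * ((pair_exp \<phi> p - 1) * (pair_exp \<psi> p - 1)))"
      unfolding 1 by (simp add: algebra_simps 2)
  qed
  finally have "(LINT p|(lborel \<Otimes>\<^sub>M lborel).
        exp ((\<phi> (fst p) + \<psi> (fst p)) + (\<phi> (snd p) + \<psi> (snd p))) * (pair_rate p * (pair_exp (\<lambda>x. - \<phi> x) p - 1)))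
     = - (LINT p|(lborel \<Otimes>\<^sub>M lborel). pair_rate p * ((pair_exp \<phi> p - 1) * (pair_exp \<psi> p - 1)))
       - (LINT p|(lborel \<Otimes>\<^sub>M lborel). pair_rate p * (pair_exp \<phi> p - 1))" by simp
  with h show "has_bochner_integral \<pi> (\<lambda>\<gamma>. exp (pairing (\<lambda>x. \<phi> x + \<psi> x) \<gamma>) * (pair_death \<phi> \<gamma> + pair_birth \<phi>))
       (- (mean_exp (\<lambda>x. \<phi> x + \<psi> x) * pair_form \<phi> \<psi>))"
    by (simp only: pair_birth_def pair_form_def) (simp add: algebra_simps)
qed

lemma point_death_birth:
  assumes \<phi>: "test_fun \<phi>" and \<psi>: "test_fun \<psi>"
  shows "has_bochner_integral \<pi> (\<lambda>\<gamma>. exp (pairing (\<lambda>x. \<phi> x + \<psi> x) \<gamma>) * (point_death \<phi> \<gamma> + point_birth \<phi>))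
       (- (mean_exp (\<lambda>x. \<phi> x + \<psi> x) * point_form \<phi> \<psi>))"
proof -
  have [measurable]: "\<phi> \<in> borel_measurable borel" "\<psi> \<in> borel_measurable borel" using \<phi> \<psi> by (auto simp: test_fun_def)
  have e: "test_fun (\<lambda>x. \<phi> x + \<psi> x)" using \<phi> \<psi> by (rule test_fun_add)
  have f: "test_fun (\<lambda>x. exp (\<phi> x) - 1)" "test_fun (\<lambda>x. exp (\<psi> x) - 1)" using \<phi> \<psi> by (auto intro: test_fun_exp_minus_one)
  have eq: "exp (\<phi> x + \<psi> x) * (exp (- \<phi> x) - 1) = - ((exp (\<phi> x) - 1) * (exp (\<psi> x) - 1)) - (exp (\<phi> x) - 1)" for x
    by (simp add: exp_add exp_minus field_simps)
  have i1: "integrable lborel (\<lambda>x. (exp (\<phi> x) - 1) * (exp (\<psi> x) - 1))" "integrable lborel (\<lambda>x. exp (\<phi> x) - 1)"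
    using f by (auto intro!: test_fun_integrable test_fun_mult)
  have i: "integrable lborel (\<lambda>x. exp (\<phi> x + \<psi> x) * (exp (- \<phi> x) - 1))"
    unfolding eq by (rule Bochner_Integration.integrable_diff[OF integrable_minus[OF i1(1)] i1(2)])
  have "(\<lambda>x. exp (- \<phi> x) - 1) \<in> borel_measurable borel" by measurable
  note m = mecke_points[OF e this i]
  have "has_bochner_integral \<pi> (\<lambda>\<gamma>. exp (pairing (\<lambda>x. \<phi> x + \<psi> x) \<gamma>)) (mean_exp (\<lambda>x. \<phi> x + \<psi> x))"
    using laplace[OF e] by (simp add: has_bochner_integral_iff)
  from has_bochner_integral_add[OF m has_bochner_integral_mult_left[OF this, of "point_birth \<phi>"]]
  have h: "has_bochner_integral \<pi> (\<lambda>\<gamma>. exp (pairing (\<lambda>x. \<phi> x + \<psi> x) \<gamma>) * (point_death \<phi> \<gamma> + point_birth \<phi>))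
     (mean_exp (\<lambda>x. \<phi> x + \<psi> x) * (z * (LINT x|lborel. exp (\<phi> x + \<psi> x) * (exp (- \<phi> x) - 1))) + mean_exp (\<lambda>x. \<phi> x + \<psi> x) * point_birth \<phi>)"
    by (simp only: distrib_left point_death_def pairing_def infsum_eq_integral_count_space)
  have "(LINT x|lborel. exp (\<phi> x + \<psi> x) * (exp (- \<phi> x) - 1))
     = - (LINT x|lborel. (exp (\<phi> x) - 1) * (exp (\<psi> x) - 1)) - (LINT x|lborel. exp (\<phi> x) - 1)"
    unfolding eq
    by (simp only: Bochner_Integration.integral_diff[OF integrable_minus[OF i1(1)] i1(2)] integral_minus)
  with h show ?thesis
    by (simp only: point_birth_def point_form_def) (simp add: algebra_simps)
qed

end

definition esum :: "'i set \<Rightarrow> ('i \<Rightarrow> real) \<Rightarrow> ('i \<Rightarrow> 'a \<Rightarrow> real) \<Rightarrow> 'a::euclidean_space set \<Rightarrow> real" where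
  "esum I c \<phi> \<gamma> = (\<Sum>i\<in>I. c i * exp (pairing (\<phi> i) \<gamma>))"

lemma F_exp_eq: "F_exp = {esum {..<n} c \<phi> | (n::nat) c \<phi>. \<forall>i<n. \<phi> i \<in> C0}"
  unfolding F_exp_def esum_def[abs_def] by auto

context poisson_kernel begin

lemma esum_remove_pair:
  assumes \<gamma>: "\<gamma> \<in> configs" and ball: "\<forall>i\<in>I. test_fun (\<phi> i)" and x: "(x1, x2) \<in> offdiag \<gamma>"
  shows "esum I c \<phi> (\<gamma> - {x1, x2}) - esum I c \<phi> \<gamma>
    = (\<Sum>i\<in>I. c i * exp (pairing (\<phi> i) \<gamma>) * (pair_exp (\<lambda>x. - \<phi> i x) (x1, x2) - 1))"
proof -
  have \<phi>: "test_fun (\<phi> i)" if "i \<in> I" for i using ball that by blast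
  have "pairing (\<phi> i) (\<gamma> - {x1, x2}) = pairing (\<phi> i) \<gamma> - \<phi> i x1 - \<phi> i x2" if "i \<in> I" for i
  proof -
    have "pairing (\<phi> i) ((\<gamma> - {x1}) - {x2}) = pairing (\<phi> i) (\<gamma> - {x1}) - \<phi> i x2"
      using x by (intro pairing_remove configs_mono[OF \<gamma>] \<phi> that) (auto simp: offdiag_def)
    moreover have "pairing (\<phi> i) (\<gamma> - {x1}) = pairing (\<phi> i) \<gamma> - \<phi> i x1"
      using x by (intro pairing_remove \<gamma> \<phi> that) (auto simp: offdiag_def)
    moreover have "\<gamma> - {x1, x2} = (\<gamma> - {x1}) - {x2}" by auto
    ultimately show ?thesis by simp
  qed
  note eq = this
  show ?thesis
    unfolding esum_def sum_subtractf[symmetric]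
    by (intro sum.cong refl, simp only: eq) (simp add: pair_exp_def exp_add exp_diff exp_minus field_simps)
qed

lemma esum_add_pair:
  assumes \<gamma>: "\<gamma> \<in> configs" and ball: "\<forall>i\<in>I. test_fun (\<phi> i)" and x: "x1 \<notin> \<gamma>" "x2 \<notin> insert x1 \<gamma>"
  shows "esum I c \<phi> (\<gamma> \<union> {x1, x2}) - esum I c \<phi> \<gamma>
    = (\<Sum>i\<in>I. c i * exp (pairing (\<phi> i) \<gamma>) * (pair_exp (\<phi> i) (x1, x2) - 1))"
proof -
  have \<phi>: "test_fun (\<phi> i)" if "i \<in> I" for i using ball that by blast
  have "pairing (\<phi> i) (\<gamma> \<union> {x1, x2}) = \<phi> i x2 + (\<phi> i x1 + pairing (\<phi> i) \<gamma>)" if "i \<in> I" for i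
  proof -
    have "pairing (\<phi> i) (insert x2 (insert x1 \<gamma>)) = \<phi> i x2 + pairing (\<phi> i) (insert x1 \<gamma>)"
      using x by (intro pairing_insert configs_insert \<gamma> \<phi> that)
    moreover have "pairing (\<phi> i) (insert x1 \<gamma>) = \<phi> i x1 + pairing (\<phi> i) \<gamma>"
      using x by (intro pairing_insert \<gamma> \<phi> that)
    moreover have "\<gamma> \<union> {x1, x2} = insert x2 (insert x1 \<gamma>)" by auto
    ultimately show ?thesis by simp
  qed
  note eq = this
  show ?thesis
    unfolding esum_def sum_subtractf[symmetric]
    by (intro sum.cong refl, simp only: eq) (simp add: pair_exp_def exp_add algebra_simps)
qed

lemma esum_remove:
  assumes \<gamma>: "\<gamma> \<in> configs" and ball: "\<forall>i\<in>I. test_fun (\<phi> i)" and x: "x \<in> \<gamma>"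
  shows "esum I c \<phi> (\<gamma> - {x}) - esum I c \<phi> \<gamma> = (\<Sum>i\<in>I. c i * exp (pairing (\<phi> i) \<gamma>) * (exp (- \<phi> i x) - 1))"
  unfolding esum_def sum_subtractf[symmetric]
proof (intro sum.cong refl)
  fix i assume "i \<in> I"
  then have "test_fun (\<phi> i)" using ball by blast
  then show "c i * exp (pairing (\<phi> i) (\<gamma> - {x})) - c i * exp (pairing (\<phi> i) \<gamma>)
     = c i * exp (pairing (\<phi> i) \<gamma>) * (exp (- \<phi> i x) - 1)"
    by (simp add: pairing_remove[OF \<gamma> _ x] exp_diff exp_minus field_simps)
qed

lemma esum_add:
  assumes \<gamma>: "\<gamma> \<in> configs" and ball: "\<forall>i\<in>I. test_fun (\<phi> i)" and x: "x \<notin> \<gamma>"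
  shows "esum I c \<phi> (\<gamma> \<union> {x}) - esum I c \<phi> \<gamma> = (\<Sum>i\<in>I. c i * exp (pairing (\<phi> i) \<gamma>) * (exp (\<phi> i x) - 1))"
  unfolding esum_def sum_subtractf[symmetric]
proof (intro sum.cong refl)
  fix i assume "i \<in> I"
  then have "test_fun (\<phi> i)" using ball by blast
  then show "c i * exp (pairing (\<phi> i) (\<gamma> \<union> {x})) - c i * exp (pairing (\<phi> i) \<gamma>)
     = c i * exp (pairing (\<phi> i) \<gamma>) * (exp (\<phi> i x) - 1)"
    by (simp add: pairing_insert[OF \<gamma> _ x] exp_add algebra_simps)
qed

lemma pair_death_sum:
  assumes \<gamma>: "\<gamma> \<in> configs" and ball: "\<forall>i\<in>I. test_fun (\<phi> i)"
  shows "(\<Sum>\<^sub>\<infinity>(x1, x2)\<in>{(x1, x2). x1 \<in> \<gamma> \<and> x2 \<in> \<gamma> \<and> x1 \<noteq> x2}.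
          enn2real (b (x2 - x1)) * (esum I c \<phi> (\<gamma> - {x1, x2}) - esum I c \<phi> \<gamma>))
    = (LINT p|count_space (offdiag \<gamma>). (\<Sum>i\<in>I. c i * exp (pairing (\<phi> i) \<gamma>) * (pair_rate p * (pair_exp (\<lambda>x. - \<phi> i x) p - 1))))"
proof -
  have \<phi>: "test_fun (\<phi> i)" if "i \<in> I" for i using ball that by blast
  have "(\<Sum>\<^sub>\<infinity>(x1, x2)\<in>{(x1, x2). x1 \<in> \<gamma> \<and> x2 \<in> \<gamma> \<and> x1 \<noteq> x2}.
          enn2real (b (x2 - x1)) * (esum I c \<phi> (\<gamma> - {x1, x2}) - esum I c \<phi> \<gamma>))
     = (LINT p|count_space (offdiag \<gamma>). (case p of (x1, x2) \<Rightarrow>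
          enn2real (b (x2 - x1)) * (esum I c \<phi> (\<gamma> - {x1, x2}) - esum I c \<phi> \<gamma>)))"
    unfolding infsum_eq_integral_count_space offdiag_def ..
  also have "\<dots> = (LINT p|count_space (offdiag \<gamma>). (\<Sum>i\<in>I. c i * exp (pairing (\<phi> i) \<gamma>) * (pair_rate p * (pair_exp (\<lambda>x. - \<phi> i x) p - 1))))"
  proof (intro Bochner_Integration.integral_cong refl)
    fix p assume "p \<in> space (count_space (offdiag \<gamma>))"
    then obtain x1 x2 where p: "p = (x1, x2)" "(x1, x2) \<in> offdiag \<gamma>" by (cases p) auto
    show "(case p of (x1, x2) \<Rightarrow> enn2real (b (x2 - x1)) * (esum I c \<phi> (\<gamma> - {x1, x2}) - esum I c \<phi> \<gamma>))
      = (\<Sum>i\<in>I. c i * exp (pairing (\<phi> i) \<gamma>) * (pair_rate p * (pair_exp (\<lambda>x. - \<phi> i x) p - 1)))"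
      using p by (simp add: esum_remove_pair[OF \<gamma> ball] pair_rate_def sum_distrib_left mult_ac)
  qed
  finally show ?thesis .
qed

text \<open>The points of \<open>\<gamma>\<close>, and for the inner integral also \<open>x1\<close>, are countably many and hence negligible; outside of
  them the increment of \<open>F\<close> has product form.\<close>
lemma pair_birth_integral:
  assumes I: "finite I" and \<gamma>: "\<gamma> \<in> configs" and ball: "\<forall>i\<in>I. test_fun (\<phi> i)"
  shows "(LINT x1|lborel. z * (LINT x2|lborel. z *
          (enn2real (b (x2 - x1)) * (esum I c \<phi> (\<gamma> \<union> {x1, x2}) - esum I c \<phi> \<gamma>))))
    = (\<Sum>i\<in>I. c i * exp (pairing (\<phi> i) \<gamma>) * pair_birth (\<phi> i))"
proof -
  have \<phi>: "test_fun (\<phi> i)" if "i \<in> I" for i using ball that by blast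
  let ?h = "\<lambda>p. \<Sum>i\<in>I. c i * exp (pairing (\<phi> i) \<gamma>) * (pair_rate p * (pair_exp (\<phi> i) p - 1))"
  have zero: "test_fun (\<lambda>x::'a. 0 :: real)" by (simp add: test_fun_def image_constant_conv)
  have i: "integrable (lborel \<Otimes>\<^sub>M lborel) (\<lambda>p. pair_rate p * (pair_exp (\<phi> i) p - 1))" if "i \<in> I" for i
    using pair_rate_pair_exp_integrable[OF zero \<phi>[OF that]] by (simp add: pair_exp_def)
  have ih: "integrable (lborel \<Otimes>\<^sub>M lborel) ?h"
    by (intro Bochner_Integration.integrable_sum integrable_mult_right i)
  have cnt: "countable \<gamma>" by (rule configs_countable[OF \<gamma>])
  have inner: "(LINT x2|lborel. z * (enn2real (b (x2 - x1)) * (esum I c \<phi> (\<gamma> \<union> {x1, x2}) - esum I c \<phi> \<gamma>)))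
      = (LINT x2|lborel. z * ?h (x1, x2))" if "x1 \<notin> \<gamma>" for x1
  proof (rule integral_discrete_difference[where X="insert x1 \<gamma>"])
    fix x2 assume x2: "x2 \<notin> insert x1 \<gamma>"
    show "z * (enn2real (b (x2 - x1)) * (esum I c \<phi> (\<gamma> \<union> {x1, x2}) - esum I c \<phi> \<gamma>)) = z * ?h (x1, x2)"
      by (simp only: esum_add_pair[OF \<gamma> ball that x2]) (simp add: pair_rate_def sum_distrib_left mult_ac)
  qed (use cnt in auto)
  have "(LINT x1|lborel. z * (LINT x2|lborel. z *
          (enn2real (b (x2 - x1)) * (esum I c \<phi> (\<gamma> \<union> {x1, x2}) - esum I c \<phi> \<gamma>))))
     = (LINT x1|lborel. z * (LINT x2|lborel. z * ?h (x1, x2)))"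
    by (rule integral_discrete_difference[where X=\<gamma>]) (use cnt inner in auto)
  also have "\<dots> = z\<^sup>2 * (LINT x1|lborel. LINT x2|lborel. ?h (x1, x2))"
    by (simp only: integral_mult_right_zero power2_eq_square mult.assoc)
  also have "(LINT x1|lborel. LINT x2|lborel. ?h (x1, x2)) = (LINT p|(lborel \<Otimes>\<^sub>M lborel). ?h p)"
    by (rule lborel_pair.integral_fst'[OF ih])
  also have "\<dots> = (\<Sum>i\<in>I. c i * exp (pairing (\<phi> i) \<gamma>) * (LINT p|(lborel \<Otimes>\<^sub>M lborel). pair_rate p * (pair_exp (\<phi> i) p - 1)))"
    using i by (subst Bochner_Integration.integral_sum) auto
  finally show ?thesis by (simp add: pair_birth_def sum_distrib_left mult_ac)
qed

lemma point_death_sum: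
  assumes I: "finite I" and \<gamma>: "\<gamma> \<in> configs" and ball: "\<forall>i\<in>I. test_fun (\<phi> i)"
  shows "(\<Sum>\<^sub>\<infinity>x\<in>\<gamma>. esum I c \<phi> (\<gamma> - {x}) - esum I c \<phi> \<gamma>) = (\<Sum>i\<in>I. c i * exp (pairing (\<phi> i) \<gamma>) * point_death (\<phi> i) \<gamma>)"
proof -
  have \<phi>: "test_fun (\<phi> i)" if "i \<in> I" for i using ball that by blast
  have t: "test_fun (\<lambda>x. exp (- \<phi> i x) - 1)" if "i \<in> I" for i
    by (rule test_fun_exp_minus_one[OF test_fun_uminus[OF \<phi>[OF that]]])
  have "(\<Sum>\<^sub>\<infinity>x\<in>\<gamma>. esum I c \<phi> (\<gamma> - {x}) - esum I c \<phi> \<gamma>)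
     = pairing (\<lambda>x. \<Sum>i\<in>I. c i * exp (pairing (\<phi> i) \<gamma>) * (exp (- \<phi> i x) - 1)) \<gamma>"
    unfolding pairing_def[of _ \<gamma>] by (intro infsum_cong) (simp only: esum_remove[OF \<gamma> ball] pairing_def)
  also have "\<dots> = (\<Sum>i\<in>I. c i * exp (pairing (\<phi> i) \<gamma>) * point_death (\<phi> i) \<gamma>)"
    by (subst pairing_sum) (auto intro!: I \<gamma> test_fun_cmult t sum.cong simp: point_death_def pairing_cmult[OF \<gamma> t])
  finally show ?thesis .
qed

lemma point_birth_integral:
  assumes I: "finite I" and \<gamma>: "\<gamma> \<in> configs" and ball: "\<forall>i\<in>I. test_fun (\<phi> i)"
  shows "(LINT x|lborel. z * (esum I c \<phi> (\<gamma> \<union> {x}) - esum I c \<phi> \<gamma>)) = (\<Sum>i\<in>I. c i * exp (pairing (\<phi> i) \<gamma>) * point_birth (\<phi> i))"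
proof -
  have \<phi>: "test_fun (\<phi> i)" if "i \<in> I" for i using ball that by blast
  have t: "integrable lborel (\<lambda>x. exp (\<phi> i x) - 1)" if "i \<in> I" for i
    by (rule test_fun_integrable[OF test_fun_exp_minus_one[OF \<phi>[OF that]]])
  have "(LINT x|lborel. z * (esum I c \<phi> (\<gamma> \<union> {x}) - esum I c \<phi> \<gamma>))
     = (LINT x|lborel. (\<Sum>i\<in>I. z * (c i * exp (pairing (\<phi> i) \<gamma>) * (exp (\<phi> i x) - 1))))"
  proof (rule integral_discrete_difference[where X=\<gamma>])
    fix x assume x: "x \<notin> \<gamma>"
    show "z * (esum I c \<phi> (\<gamma> \<union> {x}) - esum I c \<phi> \<gamma>) = (\<Sum>i\<in>I. z * (c i * exp (pairing (\<phi> i) \<gamma>) * (exp (\<phi> i x) - 1)))"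
      by (simp only: esum_add[OF \<gamma> ball x] sum_distrib_left)
  qed (use configs_countable[OF \<gamma>] in auto)
  also have "\<dots> = (\<Sum>i\<in>I. LINT x|lborel. z * (c i * exp (pairing (\<phi> i) \<gamma>) * (exp (\<phi> i x) - 1)))"
    by (intro Bochner_Integration.integral_sum integrable_mult_right t)
  also have "\<dots> = (\<Sum>i\<in>I. c i * exp (pairing (\<phi> i) \<gamma>) * point_birth (\<phi> i))"
    by (intro sum.cong refl) (simp only: integral_mult_right_zero point_birth_def mult_ac)
  finally show ?thesis .
qed

definition exp_form :: "('a \<Rightarrow> ennreal) \<Rightarrow> ('a \<Rightarrow> real) \<Rightarrow> ('a \<Rightarrow> real) \<Rightarrow> real" where
  "exp_form a \<phi> \<psi> = (integral_dx a)\<^sup>2 * (1/2 * pair_form \<phi> \<psi> + z * \<beta> * point_form \<phi> \<psi>) * mean_exp (\<lambda>x. \<phi> x + \<psi> x)"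

text \<open>Almost surely the pair sums of all exponentials converge absolutely, so that the generator acts linearly on the
  combination; on the remaining null set only measurability of the pair sum matters.\<close>
lemma E0_esum:
  assumes I: "finite I" and J: "finite J"
    and ball: "\<forall>i\<in>I. test_fun (\<phi> i)" and ball': "\<forall>j\<in>J. test_fun (\<psi> j)"
  shows "E0 a b z \<pi> (esum I c \<phi>) (esum J d \<psi>) = (\<Sum>i\<in>I. \<Sum>j\<in>J. c i * d j * exp_form a (\<phi> i) (\<psi> j))"
proof -
  have \<phi>: "\<And>i. i \<in> I \<Longrightarrow> test_fun (\<phi> i)" and \<psi>: "\<And>j. j \<in> J \<Longrightarrow> test_fun (\<psi> j)"
    using ball ball' by auto
  let ?A = "(integral_dx a)\<^sup>2"
  let ?e = "\<lambda>i \<gamma>. exp (pairing (\<phi> i) \<gamma>)"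
  let ?P = "\<lambda>\<gamma>. LINT p|count_space (offdiag \<gamma>). (\<Sum>i\<in>I. c i * ?e i \<gamma> * (pair_rate p * (pair_exp (\<lambda>x. - \<phi> i x) p - 1)))"
  let ?L = "\<lambda>\<gamma>. ?A * (1/2 * ?P \<gamma> + 1/2 * (\<Sum>i\<in>I. c i * ?e i \<gamma> * pair_birth (\<phi> i))
     + z * \<beta> * (\<Sum>i\<in>I. c i * ?e i \<gamma> * point_death (\<phi> i) \<gamma>) + z * \<beta> * (\<Sum>i\<in>I. c i * ?e i \<gamma> * point_birth (\<phi> i)))"
  let ?t = "\<lambda>i j \<gamma>. exp (pairing (\<lambda>x. \<phi> i x + \<psi> j x) \<gamma>) * (1/2 * (pair_death (\<phi> i) \<gamma> + pair_birth (\<phi> i)) + z * \<beta> * (point_death (\<phi> i) \<gamma> + point_birth (\<phi> i)))"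
  have \<phi>m[measurable]: "\<phi> i \<in> borel_measurable borel" if "i \<in> I" for i using \<phi>[OF that] by (simp add: test_fun_def)
  have \<psi>m: "\<psi> j \<in> borel_measurable borel" if "j \<in> J" for j using \<psi>[OF that] by (simp add: test_fun_def)
  have em: "?e i \<in> borel_measurable \<pi>" if "i \<in> I" for i using pairing_measurable[OF \<phi>m[OF that]] by simp
  have S1m: "point_death (\<phi> i) \<in> borel_measurable \<pi>" if "i \<in> I" for i
    unfolding point_death_def[abs_def] using \<phi>m[OF that] by (intro pairing_measurable) simp
  \<comment> \<open>The sums for the individual \<open>i\<close> are not enough here: they may diverge at configurations where the
    combination converges.\<close>
  have Pm: "?P \<in> borel_measurable \<pi>"
  proof -
    have "(\<lambda>\<gamma>. LINT p|count_space (offdiag \<gamma>). (\<lambda>q. \<Sum>i\<in>I. c i * ?e i (fst q) * (pair_rate (snd q) * (pair_exp (\<lambda>x. - \<phi> i x) (snd q) - 1))) (\<gamma>, p)) \<in> borel_measurable \<pi>"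
    proof (rule borel_measurable_integral_points[where N="borel \<Otimes>\<^sub>M borel"])
      show "(\<lambda>q. \<Sum>i\<in>I. c i * ?e i (fst q) * (pair_rate (snd q) * (pair_exp (\<lambda>x. - \<phi> i x) (snd q) - 1))) \<in> borel_measurable (\<pi> \<Otimes>\<^sub>M (borel \<Otimes>\<^sub>M borel))"
      proof (rule borel_measurable_sum)
        fix i assume i: "i \<in> I"
        note [measurable] = em[OF i] \<phi>m[OF i]
        have [measurable]: "(\<lambda>q. ?e i (fst q)) \<in> borel_measurable (\<pi> \<Otimes>\<^sub>M (borel \<Otimes>\<^sub>M borel))"
          by (rule measurable_compose[OF measurable_fst em[OF i]])
        show "(\<lambda>q. c i * ?e i (fst q) * (pair_rate (snd q) * (pair_exp (\<lambda>x. - \<phi> i x) (snd q) - 1))) \<in> borel_measurable (\<pi> \<Otimes>\<^sub>M (borel \<Otimes>\<^sub>M borel))"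
          by measurable
      qed
    qed (rule nn_pairs_measurable)
    then show ?thesis by simp
  qed
  have L: "L0 a b z (esum I c \<phi>) \<gamma> = ?L \<gamma>" if "\<gamma> \<in> configs" for \<gamma>
    unfolding L0_def pair_death_sum[OF that ball] pair_birth_integral[OF I that ball]
      point_death_sum[OF I that ball] point_birth_integral[OF I that ball] \<beta>_def ..
  have Lm: "?L \<in> borel_measurable \<pi>"
    using em S1m Pm by (intro borel_measurable_times borel_measurable_add borel_measurable_sum borel_measurable_const) auto
  have Gm: "esum J d \<psi> \<in> borel_measurable \<pi>"
    unfolding esum_def[abs_def] using pairing_measurable[OF \<psi>m]
    by (intro borel_measurable_times borel_measurable_sum borel_measurable_const) auto
  have t: "has_bochner_integral \<pi> (?t i j) (- ((1/2 * pair_form (\<phi> i) (\<psi> j) + z * \<beta> * point_form (\<phi> i) (\<psi> j)) * mean_exp (\<lambda>x. \<phi> i x + \<psi> j x)))"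
    if "i \<in> I" "j \<in> J" for i j
  proof -
    have "has_bochner_integral \<pi> (\<lambda>\<gamma>. 1/2 * (exp (pairing (\<lambda>x. \<phi> i x + \<psi> j x) \<gamma>) * (pair_death (\<phi> i) \<gamma> + pair_birth (\<phi> i)))
        + z * \<beta> * (exp (pairing (\<lambda>x. \<phi> i x + \<psi> j x) \<gamma>) * (point_death (\<phi> i) \<gamma> + point_birth (\<phi> i))))
      (1/2 * (- (mean_exp (\<lambda>x. \<phi> i x + \<psi> j x) * pair_form (\<phi> i) (\<psi> j))) + z * \<beta> * (- (mean_exp (\<lambda>x. \<phi> i x + \<psi> j x) * point_form (\<phi> i) (\<psi> j))))"
      by (intro has_bochner_integral_add has_bochner_integral_mult_right pair_death_birth point_death_birth \<phi> \<psi> that)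
    then show ?thesis by (simp add: algebra_simps)
  qed
  have sum: "has_bochner_integral \<pi> (\<lambda>\<gamma>. \<Sum>i\<in>I. \<Sum>j\<in>J. - (?A * (c i * d j)) * ?t i j \<gamma>)
     (\<Sum>i\<in>I. \<Sum>j\<in>J. - (?A * (c i * d j)) * (- ((1/2 * pair_form (\<phi> i) (\<psi> j) + z * \<beta> * point_form (\<phi> i) (\<psi> j)) * mean_exp (\<lambda>x. \<phi> i x + \<psi> j x))))"
    by (intro has_bochner_integral_sum has_bochner_integral_mult_right t)
  have AEi: "AE \<gamma> in \<pi>. \<forall>i\<in>I. integrable (count_space (offdiag \<gamma>)) (\<lambda>p. pair_rate p * (pair_exp (\<lambda>x. - \<phi> i x) p - 1))"
    using pair_death_birth(1)[OF \<phi> \<phi>] I by (intro AE_finite_allI) auto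
  have ae: "AE \<gamma> in \<pi>. (- ?L \<gamma>) * esum J d \<psi> \<gamma> = (\<Sum>i\<in>I. \<Sum>j\<in>J. - (?A * (c i * d j)) * ?t i j \<gamma>)"
    using AEi AE_space
  proof eventually_elim
    case (elim \<gamma>)
    then have \<gamma>: "\<gamma> \<in> configs" by (simp add: space_pi)
    have P: "?P \<gamma> = (\<Sum>i\<in>I. c i * ?e i \<gamma> * pair_death (\<phi> i) \<gamma>)"
    proof -
      have "?P \<gamma> = (\<Sum>i\<in>I. LINT p|count_space (offdiag \<gamma>). c i * ?e i \<gamma> * (pair_rate p * (pair_exp (\<lambda>x. - \<phi> i x) p - 1)))"
        using elim(1) by (intro Bochner_Integration.integral_sum integrable_mult_right) blast
      then show ?thesis by (simp only: integral_mult_right_zero pair_death_def)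
    qed
    have "?L \<gamma> = (\<Sum>i\<in>I. ?A * (c i * ?e i \<gamma> * (1/2 * (pair_death (\<phi> i) \<gamma> + pair_birth (\<phi> i)) + z * \<beta> * (point_death (\<phi> i) \<gamma> + point_birth (\<phi> i)))))"
      unfolding P by (simp add: sum_distrib_left sum.distrib distrib_left mult_ac)
    then have "(- ?L \<gamma>) * esum J d \<psi> \<gamma> = (\<Sum>i\<in>I. \<Sum>j\<in>J. - (?A * (c i * ?e i \<gamma> * (1/2 * (pair_death (\<phi> i) \<gamma> + pair_birth (\<phi> i)) + z * \<beta> * (point_death (\<phi> i) \<gamma> + point_birth (\<phi> i)))))
         * (d j * exp (pairing (\<psi> j) \<gamma>)))"
      unfolding esum_def by (simp only: sum_negf[symmetric] sum_product)
    also have "\<dots> = (\<Sum>i\<in>I. \<Sum>j\<in>J. - (?A * (c i * d j)) * ?t i j \<gamma>)"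
    proof (intro sum.cong refl)
      fix i j assume "i \<in> I" "j \<in> J"
      then have "exp (pairing (\<lambda>x. \<phi> i x + \<psi> j x) \<gamma>) = exp (pairing (\<phi> i) \<gamma>) * exp (pairing (\<psi> j) \<gamma>)"
        by (simp add: pairing_add[OF \<gamma> \<phi> \<psi>] exp_add)
      then show "- (?A * (c i * ?e i \<gamma> * (1/2 * (pair_death (\<phi> i) \<gamma> + pair_birth (\<phi> i)) + z * \<beta> * (point_death (\<phi> i) \<gamma> + point_birth (\<phi> i)))))
         * (d j * exp (pairing (\<psi> j) \<gamma>)) = - (?A * (c i * d j)) * ?t i j \<gamma>"
        by simp
    qed
    finally show ?case .
  qed
  have "E0 a b z \<pi> (esum I c \<phi>) (esum J d \<psi>) = (LINT \<gamma>|\<pi>. (- ?L \<gamma>) * esum J d \<psi> \<gamma>)"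
    unfolding E0_def by (intro Bochner_Integration.integral_cong refl) (simp only: L space_pi)
  also have "\<dots> = (LINT \<gamma>|\<pi>. (\<Sum>i\<in>I. \<Sum>j\<in>J. - (?A * (c i * d j)) * ?t i j \<gamma>))"
  proof (rule integral_cong_AE[OF _ _ ae])
    show "(\<lambda>\<gamma>. (- ?L \<gamma>) * esum J d \<psi> \<gamma>) \<in> borel_measurable \<pi>"
      by (rule borel_measurable_times[OF borel_measurable_uminus[OF Lm] Gm])
    show "(\<lambda>\<gamma>. \<Sum>i\<in>I. \<Sum>j\<in>J. - (?A * (c i * d j)) * ?t i j \<gamma>) \<in> borel_measurable \<pi>"
      by (rule borel_measurable_has_bochner_integral[OF sum])
  qed
  also have "\<dots> = (\<Sum>i\<in>I. \<Sum>j\<in>J. - (?A * (c i * d j)) * (- ((1/2 * pair_form (\<phi> i) (\<psi> j) + z * \<beta> * point_form (\<phi> i) (\<psi> j)) * mean_exp (\<lambda>x. \<phi> i x + \<psi> j x))))"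
    using sum by (simp only: has_bochner_integral_integral_eq)
  also have "\<dots> = (\<Sum>i\<in>I. \<Sum>j\<in>J. c i * d j * exp_form a (\<phi> i) (\<psi> j))"
    by (intro sum.cong refl) (simp add: exp_form_def mult_ac)
  finally show ?thesis .
qed

section \<open>The Poincare inequality on exponentials\<close>

lemma esum_mult:
  assumes "finite I" "\<forall>i\<in>I. test_fun (\<phi> i)" "\<gamma> \<in> configs"
  shows "esum I c \<phi> \<gamma> * esum I d \<phi> \<gamma> = (\<Sum>i\<in>I. \<Sum>j\<in>I. c i * d j * exp (pairing (\<lambda>x. \<phi> i x + \<phi> j x) \<gamma>))"
  unfolding esum_def sum_product
  using assms by (intro sum.cong refl) (simp add: pairing_add exp_add)

lemma esum_integral:
  assumes "\<forall>i\<in>I. test_fun (\<phi> i)"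
  shows "has_bochner_integral \<pi> (esum I c \<phi>) (\<Sum>i\<in>I. c i * mean_exp (\<phi> i))"
  unfolding esum_def[abs_def]
  using assms by (intro has_bochner_integral_sum has_bochner_integral_mult_right) (simp add: has_bochner_integral_iff laplace)

lemma esum_mult_integral:
  assumes "finite I" "\<forall>i\<in>I. test_fun (\<phi> i)"
  shows "has_bochner_integral \<pi> (\<lambda>\<gamma>. esum I c \<phi> \<gamma> * esum I d \<phi> \<gamma>) (\<Sum>i\<in>I. \<Sum>j\<in>I. c i * d j * mean_exp (\<lambda>x. \<phi> i x + \<phi> j x))"
proof (rule has_bochner_integral_cong[THEN iffD2, OF refl _ refl])
  show "esum I c \<phi> \<gamma> * esum I d \<phi> \<gamma> = (\<Sum>i\<in>I. \<Sum>j\<in>I. c i * d j * exp (pairing (\<lambda>x. \<phi> i x + \<phi> j x) \<gamma>))"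
    if "\<gamma> \<in> space \<pi>" for \<gamma>
    using that assms by (intro esum_mult) (auto simp: space_pi)
  show "has_bochner_integral \<pi> (\<lambda>\<gamma>. \<Sum>i\<in>I. \<Sum>j\<in>I. c i * d j * exp (pairing (\<lambda>x. \<phi> i x + \<phi> j x) \<gamma>))
     (\<Sum>i\<in>I. \<Sum>j\<in>I. c i * d j * mean_exp (\<lambda>x. \<phi> i x + \<phi> j x))"
    using assms
    by (intro has_bochner_integral_sum has_bochner_integral_mult_right) (simp add: has_bochner_integral_iff laplace test_fun_add)
qed

text \<open>The matrix with entries \<open>E[e\<^sub>\<phi>\<^sub>i e\<^sub>\<phi>\<^sub>j]\<close> is a Gram matrix in \<open>L\<^sup>2\<close>.\<close>
lemma mean_exp_psd:
  fixes \<phi> :: "'i \<Rightarrow> 'a \<Rightarrow> real"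
  assumes "finite I" "\<forall>i\<in>I. test_fun (\<phi> i)"
  shows "0 \<le> (\<Sum>i\<in>I. \<Sum>j\<in>I. w i * w j * mean_exp (\<lambda>x. \<phi> i x + \<phi> j x))"
proof -
  have "0 \<le> (LINT \<gamma>|\<pi>. esum I w \<phi> \<gamma> * esum I w \<phi> \<gamma>)" by (intro Bochner_Integration.integral_nonneg) simp
  then show ?thesis unfolding has_bochner_integral_integral_eq[OF esum_mult_integral[OF assms]] .
qed

text \<open>For fixed \<open>x\<^sub>1, x\<^sub>2\<close> the integrand is the quadratic form of \<open>mean_exp_psd\<close> at the vector
  \<open>c\<^sub>i (exp (\<phi>\<^sub>i x\<^sub>1 + \<phi>\<^sub>i x\<^sub>2) - 1)\<close>.\<close>
lemma pair_form_psd: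
  assumes I: "finite I" and \<phi>: "\<forall>i\<in>I. test_fun (\<phi> i)"
  shows "0 \<le> (\<Sum>i\<in>I. \<Sum>j\<in>I. c i * c j * (pair_form (\<phi> i) (\<phi> j) * mean_exp (\<lambda>x. \<phi> i x + \<phi> j x)))"
proof -
  let ?k = "\<lambda>i j p. pair_rate p * ((pair_exp (\<phi> i) p - 1) * (pair_exp (\<phi> j) p - 1))"
  have zero: "test_fun (\<lambda>x::'a. 0 :: real)" by (simp add: test_fun_def image_constant_conv)
  \<comment> \<open>Expand \<open>(\<Phi> - 1) (\<Psi> - 1) = \<Phi> (\<Psi> - 1) - (\<Psi> - 1)\<close>.\<close>
  have k: "integrable (lborel \<Otimes>\<^sub>M lborel) (?k i j)" if "i \<in> I" "j \<in> I" for i j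
  proof -
    have "integrable (lborel \<Otimes>\<^sub>M lborel) (\<lambda>p. pair_rate p * (pair_exp (\<phi> i) p * (pair_exp (\<phi> j) p - 1)) - pair_rate p * (pair_exp (\<lambda>x. 0) p * (pair_exp (\<phi> j) p - 1)))"
      using \<phi> that zero by (intro Bochner_Integration.integrable_diff pair_rate_pair_exp_integrable) auto
    then show ?thesis by (simp add: pair_exp_def algebra_simps)
  qed
  have "0 \<le> (LINT p|(lborel \<Otimes>\<^sub>M lborel). (\<Sum>i\<in>I. \<Sum>j\<in>I. c i * c j * mean_exp (\<lambda>x. \<phi> i x + \<phi> j x) * ?k i j p))"
  proof (rule Bochner_Integration.integral_nonneg)
    fix p :: "'a \<times> 'a"
    have "(\<Sum>i\<in>I. \<Sum>j\<in>I. c i * c j * mean_exp (\<lambda>x. \<phi> i x + \<phi> j x) * ?k i j p)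
      = pair_rate p * (\<Sum>i\<in>I. \<Sum>j\<in>I. (c i * (pair_exp (\<phi> i) p - 1)) * (c j * (pair_exp (\<phi> j) p - 1)) * mean_exp (\<lambda>x. \<phi> i x + \<phi> j x))"
      unfolding sum_distrib_left by (intro sum.cong refl) (simp only: mult_ac)
    also have "\<dots> \<ge> 0" by (intro mult_nonneg_nonneg pair_rate_nonneg mean_exp_psd I \<phi>)
    finally show "0 \<le> (\<Sum>i\<in>I. \<Sum>j\<in>I. c i * c j * mean_exp (\<lambda>x. \<phi> i x + \<phi> j x) * ?k i j p)" .
  qed
  also have "\<dots> = (\<Sum>i\<in>I. \<Sum>j\<in>I. c i * c j * mean_exp (\<lambda>x. \<phi> i x + \<phi> j x) * (LINT p|(lborel \<Otimes>\<^sub>M lborel). ?k i j p))"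
    by (subst Bochner_Integration.integral_sum, intro Bochner_Integration.integrable_sum integrable_mult_right k, assumption+,
        intro sum.cong refl, subst Bochner_Integration.integral_sum, intro integrable_mult_right k, assumption+,
        simp only: integral_mult_right_zero)
  finally have "0 \<le> z\<^sup>2 * (\<Sum>i\<in>I. \<Sum>j\<in>I. c i * c j * mean_exp (\<lambda>x. \<phi> i x + \<phi> j x) * (LINT p|(lborel \<Otimes>\<^sub>M lborel). ?k i j p))"
    by simp
  also have "\<dots> = (\<Sum>i\<in>I. \<Sum>j\<in>I. c i * c j * (pair_form (\<phi> i) (\<phi> j) * mean_exp (\<lambda>x. \<phi> i x + \<phi> j x)))"
    unfolding sum_distrib_left pair_form_def by (intro sum.cong refl) (simp only: mult_ac)
  finally show ?thesis .
qed

text \<open>A case of the Schur product theorem.  One factor is a Gram matrix, so the quadratic form of the next power is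
  an integral over \<open>x\<close> of the form of the previous power at the vector \<open>w\<^sub>i f\<^sub>\<phi>\<^sub>i(x)\<close>; hence the
  induction over all \<open>w\<close>.\<close>
lemma point_form_power_psd:
  assumes I: "finite I" and \<phi>: "\<forall>i\<in>I. test_fun (\<phi> i)"
  shows "0 \<le> (\<Sum>i\<in>I. \<Sum>j\<in>I. w i * w j * point_form (\<phi> i) (\<phi> j) ^ k)"
proof (induction k arbitrary: w)
  case 0
  have "(\<Sum>i\<in>I. \<Sum>j\<in>I. w i * w j * point_form (\<phi> i) (\<phi> j) ^ 0) = (\<Sum>i\<in>I. w i) * (\<Sum>j\<in>I. w j)" by (simp add: sum_product)
  then show ?case by simp
next
  case (Suc k)
  let ?f = "\<lambda>i x. exp (\<phi> i x) - 1"
  have f: "integrable lborel (\<lambda>x. ?f i x * ?f j x)" if "i \<in> I" "j \<in> I" for i j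
    using \<phi> that by (intro test_fun_integrable test_fun_mult test_fun_exp_minus_one) auto
  have "0 \<le> (LINT x|lborel. (\<Sum>i\<in>I. \<Sum>j\<in>I. w i * w j * point_form (\<phi> i) (\<phi> j) ^ k * (?f i x * ?f j x)))"
  proof (rule Bochner_Integration.integral_nonneg)
    fix x
    have "(\<Sum>i\<in>I. \<Sum>j\<in>I. w i * w j * point_form (\<phi> i) (\<phi> j) ^ k * (?f i x * ?f j x))
      = (\<Sum>i\<in>I. \<Sum>j\<in>I. (w i * ?f i x) * (w j * ?f j x) * point_form (\<phi> i) (\<phi> j) ^ k)"
      by (intro sum.cong refl) (simp only: mult_ac)
    also have "\<dots> \<ge> 0" by (rule Suc.IH)
    finally show "0 \<le> (\<Sum>i\<in>I. \<Sum>j\<in>I. w i * w j * point_form (\<phi> i) (\<phi> j) ^ k * (?f i x * ?f j x))" .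
  qed
  also have "\<dots> = (\<Sum>i\<in>I. \<Sum>j\<in>I. w i * w j * point_form (\<phi> i) (\<phi> j) ^ k * (LINT x|lborel. ?f i x * ?f j x))"
    by (subst Bochner_Integration.integral_sum, intro Bochner_Integration.integrable_sum integrable_mult_right f, assumption+,
        intro sum.cong refl, subst Bochner_Integration.integral_sum, intro integrable_mult_right f, assumption+,
        simp only: integral_mult_right_zero)
  finally have "0 \<le> z * (\<Sum>i\<in>I. \<Sum>j\<in>I. w i * w j * point_form (\<phi> i) (\<phi> j) ^ k * (LINT x|lborel. ?f i x * ?f j x))"
    using z_pos by simp
  also have "\<dots> = (\<Sum>i\<in>I. \<Sum>j\<in>I. w i * w j * point_form (\<phi> i) (\<phi> j) ^ Suc k)"
    unfolding sum_distrib_left by (intro sum.cong refl) (simp only: point_form_def[symmetric] power_Suc, simp add: point_form_def mult_ac)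
  finally show ?case .
qed

text \<open>The coefficient of \<open>t ^ (k + 1)\<close> is \<open>1 / k! - 1 / (k + 1)! = k / (k + 1)!\<close>, hence nonnegative.\<close>
lemma mult_exp_minus_exp_series: 
  fixes t :: real
  shows "(\<lambda>k. real k / fact (Suc k) * t ^ Suc k) sums (t * exp t - exp t + 1)"
proof -
  have e: "(\<lambda>k. t ^ k / fact k) sums exp t"
    using exp_converges[of t] by (simp add: divide_inverse mult.commute)
  have 1: "(\<lambda>k. t * (t ^ k / fact k)) sums (t * exp t)" by (rule sums_mult[OF e])
  have "(\<lambda>k. t ^ Suc k / fact (Suc k)) sums (exp t - 1)"
    using sums_split_initial_segment[OF e, of 1] by simp
  from sums_diff[OF 1 this] have "(\<lambda>k. t * (t ^ k / fact k) - t ^ Suc k / fact (Suc k)) sums (t * exp t - exp t + 1)"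
    by (simp add: algebra_simps)
  moreover have "t * (t ^ k / fact k) - t ^ Suc k / fact (Suc k) = real k / fact (Suc k) * t ^ Suc k" for k
  proof -
    have "fact (Suc k) = (1 + real k) * fact k" "1 + real k \<noteq> 0" by auto
    then show ?thesis by (simp add: divide_simps) (simp add: algebra_simps)
  qed
  ultimately show ?thesis by simp
qed

text \<open>Expand \<open>exp (\<phi> + \<psi>) - 1 = f\<^sub>\<phi> + f\<^sub>\<psi> + f\<^sub>\<phi> f\<^sub>\<psi>\<close> in the Laplace functional.\<close>
lemma mean_exp_add:
  assumes "test_fun \<phi>" "test_fun \<psi>"
  shows "mean_exp (\<lambda>x. \<phi> x + \<psi> x) = mean_exp \<phi> * mean_exp \<psi> * exp (point_form \<phi> \<psi>)"
proof -
  have i: "integrable lborel (\<lambda>x. exp (\<phi> x) - 1)" "integrable lborel (\<lambda>x. exp (\<psi> x) - 1)"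
    "integrable lborel (\<lambda>x. (exp (\<phi> x) - 1) * (exp (\<psi> x) - 1))"
    using assms by (auto intro!: test_fun_integrable test_fun_mult test_fun_exp_minus_one)
  have "(LINT x|lborel. exp (\<phi> x + \<psi> x) - 1)
     = (LINT x|lborel. ((exp (\<phi> x) - 1) + (exp (\<psi> x) - 1)) + (exp (\<phi> x) - 1) * (exp (\<psi> x) - 1))"
    by (intro Bochner_Integration.integral_cong refl) (simp add: exp_add algebra_simps)
  also have "\<dots> = (LINT x|lborel. exp (\<phi> x) - 1) + (LINT x|lborel. exp (\<psi> x) - 1)
       + (LINT x|lborel. (exp (\<phi> x) - 1) * (exp (\<psi> x) - 1))"
    by (simp only: Bochner_Integration.integral_add i Bochner_Integration.integrable_add)
  finally show ?thesis unfolding mean_exp_def point_form_def exp_add[symmetric] by (simp add: distrib_left)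
qed

text \<open>The Poincare inequality of the Poisson measure on exponentials: the left side is the variance of
  \<open>\<Sum>\<^sub>i c\<^sub>i e\<^sub>\<phi>\<^sub>i\<close> and the right side its Dirichlet form \<open>z \<integral> E[(F(\<gamma> \<union> {x}) - F(\<gamma>))\<^sup>2] dx\<close>.  After factoring out the
  means, the difference of the two matrices is \<open>t exp t - exp t + 1\<close> entrywise, a series of
  entrywise powers of \<open>t\<close> with nonnegative coefficients.\<close>
lemma poisson_poincare:
  assumes I: "finite I" and \<phi>: "\<forall>i\<in>I. test_fun (\<phi> i)"
  shows "(\<Sum>i\<in>I. \<Sum>j\<in>I. c i * c j * (mean_exp (\<lambda>x. \<phi> i x + \<phi> j x) - mean_exp (\<phi> i) * mean_exp (\<phi> j)))
    \<le> (\<Sum>i\<in>I. \<Sum>j\<in>I. c i * c j * (point_form (\<phi> i) (\<phi> j) * mean_exp (\<lambda>x. \<phi> i x + \<phi> j x)))"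
proof -
  define w where "w i = c i * mean_exp (\<phi> i)" for i
  let ?t = "\<lambda>i j. point_form (\<phi> i) (\<phi> j)"
  have "(\<lambda>k. \<Sum>i\<in>I. \<Sum>j\<in>I. w i * w j * (real k / fact (Suc k) * ?t i j ^ Suc k))
      sums (\<Sum>i\<in>I. \<Sum>j\<in>I. w i * w j * (?t i j * exp (?t i j) - exp (?t i j) + 1))"
    by (intro sums_sum sums_mult mult_exp_minus_exp_series)
  moreover have "0 \<le> (\<Sum>i\<in>I. \<Sum>j\<in>I. w i * w j * (real k / fact (Suc k) * ?t i j ^ Suc k))" for k
  proof -
    have "(\<Sum>i\<in>I. \<Sum>j\<in>I. w i * w j * (real k / fact (Suc k) * ?t i j ^ Suc k))
      = real k / fact (Suc k) * (\<Sum>i\<in>I. \<Sum>j\<in>I. w i * w j * ?t i j ^ Suc k)"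
      unfolding sum_distrib_left by (intro sum.cong refl) (simp only: mult_ac)
    also have "\<dots> \<ge> 0" by (intro mult_nonneg_nonneg point_form_power_psd I \<phi>) auto
    finally show ?thesis .
  qed
  ultimately have "0 \<le> (\<Sum>i\<in>I. \<Sum>j\<in>I. w i * w j * (?t i j * exp (?t i j) - exp (?t i j) + 1))"
    by (rule sums_le[OF _ sums_zero, rotated])
  also have "\<dots> = (\<Sum>i\<in>I. \<Sum>j\<in>I. c i * c j * (?t i j * mean_exp (\<lambda>x. \<phi> i x + \<phi> j x))
      - c i * c j * (mean_exp (\<lambda>x. \<phi> i x + \<phi> j x) - mean_exp (\<phi> i) * mean_exp (\<phi> j)))"
    using \<phi> by (intro sum.cong refl) (simp add: mean_exp_add w_def algebra_simps)
  finally show ?thesis by (simp add: sum_subtractf)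
qed

lemma variance_esum:
  assumes I: "finite I" and \<phi>: "\<forall>i\<in>I. test_fun (\<phi> i)"
  shows "variance (esum I c \<phi>) = (\<Sum>i\<in>I. \<Sum>j\<in>I. c i * c j * (mean_exp (\<lambda>x. \<phi> i x + \<phi> j x) - mean_exp (\<phi> i) * mean_exp (\<phi> j)))"
proof -
  note 1 = esum_integral[OF \<phi>, of c] and 2 = esum_mult_integral[OF I \<phi>, of c c]
  have "variance (esum I c \<phi>) = (\<Sum>i\<in>I. \<Sum>j\<in>I. c i * c j * mean_exp (\<lambda>x. \<phi> i x + \<phi> j x)) - (\<Sum>i\<in>I. c i * mean_exp (\<phi> i))\<^sup>2"
    using 1 2 by (subst variance_eq) (auto simp: has_bochner_integral_iff power2_eq_square)
  also have "(\<Sum>i\<in>I. c i * mean_exp (\<phi> i))\<^sup>2 = (\<Sum>i\<in>I. \<Sum>j\<in>I. c i * c j * (mean_exp (\<phi> i) * mean_exp (\<phi> j)))"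
    unfolding power2_eq_square sum_product by (intro sum.cong refl) (simp only: mult_ac)
  finally show ?thesis by (simp only: right_diff_distrib sum_subtractf)
qed

lemma E0_poincare:
  assumes I: "finite I" and \<phi>: "\<forall>i\<in>I. test_fun (\<phi> i)"
  shows "E0 a b z \<pi> (esum I c \<phi>) (esum I c \<phi>) \<ge> (integral_dx a)\<^sup>2 * z * \<beta> * variance (esum I c \<phi>)"
proof -
  let ?A = "(integral_dx a)\<^sup>2"
  let ?X = "\<Sum>i\<in>I. \<Sum>j\<in>I. c i * c j * (pair_form (\<phi> i) (\<phi> j) * mean_exp (\<lambda>x. \<phi> i x + \<phi> j x))"
  let ?Y = "\<Sum>i\<in>I. \<Sum>j\<in>I. c i * c j * (point_form (\<phi> i) (\<phi> j) * mean_exp (\<lambda>x. \<phi> i x + \<phi> j x))"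
  have "?A * z * \<beta> * variance (esum I c \<phi>) \<le> ?A * z * \<beta> * ?Y"
    unfolding variance_esum[OF I \<phi>] using z_pos beta_nonneg by (intro mult_left_mono poisson_poincare I \<phi>) auto
  also have "\<dots> \<le> ?A * (1/2) * ?X + ?A * z * \<beta> * ?Y" using pair_form_psd[OF I \<phi>, of c] by simp
  also have "\<dots> = E0 a b z \<pi> (esum I c \<phi>) (esum I c \<phi>)"
    unfolding E0_esum[OF I I \<phi> \<phi>] exp_form_def sum_distrib_left sum.distrib[symmetric]
    by (intro sum.cong refl) (simp add: algebra_simps)
  finally show ?thesis .
qed

section \<open>The form on the span of the exponentials\<close>

lemma exp_form_sym: "exp_form a \<phi> \<psi> = exp_form a \<psi> \<phi>"
  by (simp add: exp_form_def point_form_def pair_form_def add.commute mult.commute)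

text \<open>Two elements of the span can be written over the same exponentials, so that bilinear identities reduce to the
  coefficients.\<close>
lemma F_exp_common_family:
  assumes "F \<in> F_exp" "G \<in> (F_exp :: ('a set \<Rightarrow> real) set)"
  obtains I :: "nat set" and c d \<phi> where "finite I" "\<forall>i\<in>I. test_fun (\<phi> i)" "F = esum I c \<phi>" "G = esum I d \<phi>"
proof -
  obtain n c \<phi> where F: "F = esum {..<n::nat} c \<phi>" "\<forall>i<n. \<phi> i \<in> C0" using assms(1) by (auto simp: F_exp_eq)
  obtain m d \<psi> where G: "G = esum {..<m::nat} d \<psi>" "\<forall>i<m. \<psi> i \<in> C0" using assms(2) by (auto simp: F_exp_eq)
  define \<theta> where "\<theta> i = (if i < n then \<phi> i else \<psi> (i - n))" for i
  define c' where "c' i = (if i < n then c i else 0)" for i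
  define d' where "d' i = (if i < n then 0 else d (i - n))" for i
  have split: "(\<Sum>i<n + m. f i) = (\<Sum>i<n. f i) + (\<Sum>i<m. f (n + i))" for f :: "nat \<Rightarrow> real"
    by (induction m) (auto simp: add.assoc)
  have "F = esum {..<n + m} c' \<theta>"
    by (rule ext) (simp add: F(1) esum_def split c'_def \<theta>_def)
  moreover have "G = esum {..<n + m} d' \<theta>"
    by (rule ext) (simp add: G(1) esum_def split d'_def \<theta>_def)
  moreover have "\<forall>i\<in>{..<n + m}. test_fun (\<theta> i)" using F(2) G(2) by (auto simp: \<theta>_def intro!: C0_test_fun)
  ultimately show thesis using that by blast
qed

lemma esum_diff: "(\<lambda>\<gamma>. esum I c \<phi> \<gamma> - esum I d \<phi> \<gamma>) = esum I (\<lambda>i. c i - d i) \<phi>"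
  by (rule ext) (simp add: esum_def sum_subtractf left_diff_distrib)

lemma E0_nonneg:
  assumes "finite I" "\<forall>i\<in>I. test_fun (\<phi> i)"
  shows "0 \<le> E0 a b z \<pi> (esum I c \<phi>) (esum I c \<phi>)"
proof -
  have "0 \<le> (integral_dx a)\<^sup>2 * z * \<beta> * variance (esum I c \<phi>)"
    using z_pos beta_nonneg variance_positive by (intro mult_nonneg_nonneg) auto
  then show ?thesis using E0_poincare[OF assms] by (rule order_trans)
qed

text \<open>Nonnegativity of the form at \<open>e G - (F - G)\<close> bounds the mixed term of \<open>F = G + (F - G)\<close>.  This replaces the triangle
  inequality for the square root of the form.\<close>
lemma E0_young:
  assumes F: "F \<in> F_exp" and G: "G \<in> F_exp" and e: "e > 0"
  shows "E0 a b z \<pi> F F \<le> (1 + e) * E0 a b z \<pi> G G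
    + (1 + 1 / e) * E0 a b z \<pi> (\<lambda>\<gamma>. F \<gamma> - G \<gamma>) (\<lambda>\<gamma>. F \<gamma> - G \<gamma>)"
proof -
  obtain I :: "nat set" and c d \<phi> where I: "finite I" and \<phi>: "\<forall>i\<in>I. test_fun (\<phi> i)"
    and FG: "F = esum I c \<phi>" "G = esum I d \<phi>"
    by (rule F_exp_common_family[OF F G])
  define B where "B c d = (\<Sum>i\<in>I. \<Sum>j\<in>I. c i * d j * exp_form a (\<phi> i) (\<phi> j))" for c d :: "nat \<Rightarrow> real"
  have E: "E0 a b z \<pi> (esum I c \<phi>) (esum I c \<phi>) = B c c" for c unfolding B_def by (rule E0_esum[OF I I \<phi> \<phi>])
  have B_sym: "B c d = B d c" for c d
    unfolding B_def by (subst sum.swap) (intro sum.cong refl, subst exp_form_sym, simp only: mult_ac)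
  have B_lin: "B (\<lambda>i. s * c i + t * d i) g = s * B c g + t * B d g" for s t c d g
    by (simp add: B_def sum_distrib_left distrib_left distrib_right sum.distrib mult_ac)
  define h where "h i = c i - d i" for i
  have "0 \<le> B (\<lambda>i. e * d i + (-1) * h i) (\<lambda>i. e * d i + (-1) * h i)"
    using E0_nonneg[OF I \<phi>, of a "\<lambda>i. e * d i + (-1) * h i"] unfolding E .
  also have "\<dots> = e * B d (\<lambda>i. e * d i + (-1) * h i) + (-1) * B h (\<lambda>i. e * d i + (-1) * h i)" by (rule B_lin)
  also have "B d (\<lambda>i. e * d i + (-1) * h i) = e * B d d + (-1) * B h d" by (rule trans[OF B_sym B_lin])
  also have "B h (\<lambda>i. e * d i + (-1) * h i) = e * B d h + (-1) * B h h" by (rule trans[OF B_sym B_lin])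
  finally have 1: "2 * e * B d h \<le> e * e * B d d + B h h" using B_sym[of h d] by (simp add: algebra_simps)
  have "e * (2 * B d h) \<le> e * (e * B d d + B h h / e)" using 1 e by (simp add: algebra_simps)
  then have 2: "2 * B d h \<le> e * B d d + B h h / e" using e by simp
  have "c = (\<lambda>i. 1 * d i + 1 * h i)" by (simp add: h_def)
  then have "B c c = B (\<lambda>i. 1 * d i + 1 * h i) (\<lambda>i. 1 * d i + 1 * h i)" by simp
  also have "\<dots> = 1 * B d (\<lambda>i. 1 * d i + 1 * h i) + 1 * B h (\<lambda>i. 1 * d i + 1 * h i)" by (rule B_lin)
  also have "B d (\<lambda>i. 1 * d i + 1 * h i) = 1 * B d d + 1 * B h d" by (rule trans[OF B_sym B_lin])
  also have "B h (\<lambda>i. 1 * d i + 1 * h i) = 1 * B d h + 1 * B h h" by (rule trans[OF B_sym B_lin])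
  finally have "B c c = B d d + 2 * B d h + B h h" using B_sym[of h d] by simp
  also have "\<dots> \<le> (1 + e) * B d d + (1 + 1 / e) * B h h" using 2 by (simp add: algebra_simps)
  finally show ?thesis unfolding FG esum_diff h_def[symmetric] E .
qed

lemma F_exp_L2: assumes "F \<in> F_exp" shows "F \<in> L2 \<pi>"
proof -
  obtain I :: "nat set" and c d \<phi> where I: "finite I" and \<phi>: "\<forall>i\<in>I. test_fun (\<phi> i)"
    and F: "F = esum I c \<phi>" "F = esum I d \<phi>"
    by (rule F_exp_common_family[OF assms assms])
  show ?thesis unfolding L2_def F(1)
    using esum_integral[OF \<phi>, of c] esum_mult_integral[OF I \<phi>, of c c]
    by (auto simp: has_bochner_integral_iff power2_eq_square)
qed

lemma F_exp_poincare:
  assumes "F \<in> F_exp" shows "E0 a b z \<pi> F F \<ge> (integral_dx a)\<^sup>2 * z * \<beta> * variance F"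
proof -
  obtain I :: "nat set" and c d \<phi> where I: "finite I" and \<phi>: "\<forall>i\<in>I. test_fun (\<phi> i)"
    and F: "F = esum I c \<phi>" "F = esum I d \<phi>"
    by (rule F_exp_common_family[OF assms assms])
  show ?thesis unfolding F(1) by (rule E0_poincare[OF I \<phi>])
qed

lemma E0_diff_nonneg:
  assumes "F \<in> F_exp" "G \<in> F_exp" shows "0 \<le> E0 a b z \<pi> (\<lambda>\<gamma>. F \<gamma> - G \<gamma>) (\<lambda>\<gamma>. F \<gamma> - G \<gamma>)"
proof -
  obtain I :: "nat set" and c d \<phi> where I: "finite I" and \<phi>: "\<forall>i\<in>I. test_fun (\<phi> i)"
    and FG: "F = esum I c \<phi>" "G = esum I d \<phi>"
    by (rule F_exp_common_family[OF assms])
  show ?thesis unfolding FG esum_diff by (rule E0_nonneg[OF I \<phi>])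
qed

end

section \<open>Passage to the closure\<close>

lemma square_add_young:
  fixes x y e :: real assumes "e > 0"
  shows "(x + y)\<^sup>2 \<le> (1 + e) * x\<^sup>2 + (1 + 1 / e) * y\<^sup>2"
proof -
  have "0 \<le> (e * x - y)\<^sup>2 / e" using assms by simp
  also have "(e * x - y)\<^sup>2 / e = e * x\<^sup>2 - 2 * x * y + y\<^sup>2 / e"
    using assms by (simp add: field_simps power2_eq_square)
  finally show ?thesis by (simp add: power2_eq_square algebra_simps)
qed

lemma (in prob_space) variance_add_young:
  assumes F: "F \<in> L2 M" and G: "G \<in> L2 M" and e: "e > 0"
  shows "variance F \<le> (1 + e) * variance G + (1 + 1 / e) * expectation (\<lambda>x. (F x - G x)\<^sup>2)"
proof -
  have [measurable]: "F \<in> borel_measurable M" "G \<in> borel_measurable M" using F G by (auto simp: L2_def)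
  have F2: "integrable M (\<lambda>x. (F x)\<^sup>2)" and G2: "integrable M (\<lambda>x. (G x)\<^sup>2)" using F G by (auto simp: L2_def)
  have D2: "integrable M (\<lambda>x. (F x - G x)\<^sup>2)"
  proof (rule Bochner_Integration.integrable_bound)
    show "integrable M (\<lambda>x. 2 * (F x)\<^sup>2 + 2 * (G x)\<^sup>2)" using F2 G2 by auto
    show "AE x in M. norm ((F x - G x)\<^sup>2) \<le> norm (2 * (F x)\<^sup>2 + 2 * (G x)\<^sup>2)"
      using square_add_young[of 1 "F x" "- G x" for x] by (intro AE_I2) simp
  qed measurable
  have i: "integrable M F" "integrable M G"
    using F2 G2 by (auto intro: square_integrable_imp_integrable)
  define D where "D x = F x - G x" for x
  have D: "integrable M D" "integrable M (\<lambda>x. (D x)\<^sup>2)" using i D2 by (auto simp: D_def[abs_def])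
  have vi: "integrable M (\<lambda>x. (X x - c)\<^sup>2)" if "integrable M X" "integrable M (\<lambda>x. (X x)\<^sup>2)" for X and c :: real
    using that by (simp add: power2_diff)
  have ED: "expectation F = expectation G + expectation D"
    unfolding D_def using i by simp
  have "variance F \<le> expectation (\<lambda>x. (1 + e) * (G x - expectation G)\<^sup>2 + (1 + 1 / e) * (D x - expectation D)\<^sup>2)"
  proof (rule integral_mono)
    show "integrable M (\<lambda>x. (F x - expectation F)\<^sup>2)" by (rule vi[OF i(1) F2])
    show "integrable M (\<lambda>x. (1 + e) * (G x - expectation G)\<^sup>2 + (1 + 1 / e) * (D x - expectation D)\<^sup>2)"
      by (intro Bochner_Integration.integrable_add integrable_mult_right vi i G2 D)
    show "(F x - expectation F)\<^sup>2 \<le> (1 + e) * (G x - expectation G)\<^sup>2 + (1 + 1 / e) * (D x - expectation D)\<^sup>2" for x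
    proof -
      have "F x - expectation F = (G x - expectation G) + (D x - expectation D)" unfolding ED by (simp add: D_def)
      then show ?thesis using square_add_young[OF e] by simp
    qed
  qed
  also have "\<dots> = (1 + e) * variance G + (1 + 1 / e) * variance D"
    using vi[OF i(2) G2, of "expectation G"] vi[OF D, of "expectation D"]
    by (subst Bochner_Integration.integral_add) auto
  also have "variance D \<le> expectation (\<lambda>x. (D x)\<^sup>2)" using D by (subst variance_eq) auto
  finally show ?thesis using e by (simp add: D_def mult_left_mono)
qed

text \<open>The inequality first bounds \<open>q\<close>, by comparison with one fixed index and \<open>e = 1\<close>; with this bound, a small \<open>e\<close>
  makes \<open>q m - q n\<close> small.\<close>
lemma convergent_of_young:
  fixes q :: "nat \<Rightarrow> real" and d :: "nat \<Rightarrow> nat \<Rightarrow> real"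
  assumes young: "\<And>m n e. e > 0 \<Longrightarrow> q m \<le> (1 + e) * q n + (1 + 1 / e) * d m n"
    and q: "\<And>n. q n \<ge> 0"
    and d: "\<And>e. e > 0 \<Longrightarrow> \<exists>N. \<forall>m\<ge>N. \<forall>n\<ge>N. d m n < e"
  shows "convergent q"
proof -
  obtain N1 where N1: "\<And>m n. m \<ge> N1 \<Longrightarrow> n \<ge> N1 \<Longrightarrow> d m n < 1" using d[of 1] by auto
  define K where "K = 2 * q N1 + 2"
  have K: "K > 0" using q[of N1] by (simp add: K_def)
  have qK: "q m \<le> K" if "m \<ge> N1" for m
    using young[of 1 m N1] N1[OF that order_refl] by (simp add: K_def)
  have "Cauchy q"
  proof (rule metric_CauchyI)
    fix r :: real assume r: "r > 0"
    define e where "e = r / (2 * K)"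
    have e: "e > 0" using r K by (simp add: e_def)
    have "r / (2 * (1 + 1 / e)) > 0" using r e by (intro divide_pos_pos mult_pos_pos add_pos_pos) auto
    then obtain N2 where N2: "\<And>m n. m \<ge> N2 \<Longrightarrow> n \<ge> N2 \<Longrightarrow> d m n < r / (2 * (1 + 1 / e))" using d by meson
    have *: "q m - q n < r" if "m \<ge> max N1 N2" "n \<ge> max N1 N2" for m n
    proof -
      have "(1 + 1 / e) * d m n < (1 + 1 / e) * (r / (2 * (1 + 1 / e)))"
        using that e by (intro mult_strict_left_mono N2 add_pos_pos) auto
      also have "\<dots> = r / 2"
      proof -
        have "k * (r / (2 * k)) = r / 2" if "k > 0" for k :: real using that by simp
        moreover have "1 + 1 / e > 0" using e by (intro add_pos_pos) auto
        ultimately show ?thesis by blast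
      qed
      finally have "(1 + 1 / e) * d m n < r / 2" .
      moreover have "e * q n \<le> e * K" using that e qK by (intro mult_left_mono) auto
      moreover have "e * K = r / 2" using K by (simp add: e_def)
      ultimately show ?thesis using young[OF e, of m n] unfolding distrib_right[of 1 e "q n"] by linarith
    qed
    show "\<exists>M. \<forall>m\<ge>M. \<forall>n\<ge>M. dist (q m) (q n) < r"
      using * by (intro exI[of _ "max N1 N2"]) (auto simp: dist_real_def abs_less_iff)
  qed
  then show ?thesis by (simp add: Cauchy_convergent_iff)
qed

text \<open>The approximating sequence selected by the definition of the closure is form-Cauchy, so the values of the form
  along it converge; the variance of the limit is controlled by the variances along the sequence up to a
  factor \<open>1 + e\<close> and the \<open>L\<^sup>2\<close> distance.  Then \<open>e\<close> tends to \<open>0\<close>.\<close>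
lemma (in poisson_kernel) closure_poincare:
  assumes F: "F \<in> closure_dom \<pi> (E0 a b z \<pi>) F_exp"
  shows "form_closure \<pi> (E0 a b z \<pi>) F_exp F F \<ge> (integral_dx a)\<^sup>2 * z * \<beta> * variance F"
proof -
  define Fs where "Fs = (SOME Hs. form_approx \<pi> (E0 a b z \<pi>) F_exp Hs F)"
  have "\<exists>Hs. form_approx \<pi> (E0 a b z \<pi>) F_exp Hs F" using F by (simp add: closure_dom_def)
  then have "form_approx \<pi> (E0 a b z \<pi>) F_exp Fs F"
    unfolding Fs_def by (rule someI_ex)
  then have Fs: "\<And>n. Fs n \<in> F_exp"
    and L2: "(\<lambda>n. \<integral>\<^sup>+x. ennreal ((Fs n x - F x)\<^sup>2) \<partial>\<pi>) \<longlonglongrightarrow> 0"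
    and C: "\<And>e. e > 0 \<Longrightarrow> \<exists>N. \<forall>m\<ge>N. \<forall>n\<ge>N. \<bar>E0 a b z \<pi> (\<lambda>x. Fs m x - Fs n x) (\<lambda>x. Fs m x - Fs n x)\<bar> < e"
    unfolding form_approx_def by auto
  have FL: "F \<in> L2 \<pi>" using F by (simp add: closure_dom_def)
  define q where "q n = E0 a b z \<pi> (Fs n) (Fs n)" for n
  define \<kappa> where "\<kappa> = (integral_dx a)\<^sup>2 * z * \<beta>"
  have \<kappa>: "\<kappa> \<ge> 0" using z_pos beta_nonneg by (simp add: \<kappa>_def)
  have qv: "\<kappa> * variance (Fs n) \<le> q n" for n unfolding \<kappa>_def q_def by (rule F_exp_poincare[OF Fs])
  have q0: "q n \<ge> 0" for n
    using order_trans[OF mult_nonneg_nonneg[OF \<kappa> variance_positive] qv] .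
  have "convergent q"
  proof (rule convergent_of_young)
    show "q m \<le> (1 + e) * q n + (1 + 1 / e) * \<bar>E0 a b z \<pi> (\<lambda>x. Fs m x - Fs n x) (\<lambda>x. Fs m x - Fs n x)\<bar>" if "e > 0" for m n e
      unfolding q_def using E0_young[OF Fs[of m] Fs[of n] that, of a] E0_diff_nonneg[OF Fs[of m] Fs[of n], of a] by simp
  qed (use q0 C in auto)
  then have ql: "q \<longlonglongrightarrow> lim q" by (simp add: convergent_LIMSEQ_iff)
  define \<delta> where "\<delta> n = expectation (\<lambda>x. (F x - Fs n x)\<^sup>2)" for n
  have \<delta>: "\<delta> \<longlonglongrightarrow> 0"
  proof -
    have "(\<integral>\<^sup>+x. ennreal ((Fs n x - F x)\<^sup>2) \<partial>\<pi>) = ennreal (\<delta> n)" for n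
    proof -
      have "integrable \<pi> (\<lambda>x. (F x - Fs n x)\<^sup>2)"
      proof (rule Bochner_Integration.integrable_bound)
        show "integrable \<pi> (\<lambda>x. 2 * (F x)\<^sup>2 + 2 * (Fs n x)\<^sup>2)" using FL F_exp_L2[OF Fs, of n] by (auto simp: L2_def)
        show "AE x in \<pi>. norm ((F x - Fs n x)\<^sup>2) \<le> norm (2 * (F x)\<^sup>2 + 2 * (Fs n x)\<^sup>2)"
          using square_add_young[of 1 "F x" "- Fs n x" for x] by (intro AE_I2) simp
        show "(\<lambda>x. (F x - Fs n x)\<^sup>2) \<in> borel_measurable \<pi>" using FL F_exp_L2[OF Fs, of n] by (auto simp: L2_def)
      qed
      then show ?thesis unfolding \<delta>_def by (subst nn_integral_eq_integral[symmetric]) (auto simp: power2_commute)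
    qed
    then have "(\<lambda>n. ennreal (\<delta> n)) \<longlonglongrightarrow> ennreal 0" using L2 by (simp only: ennreal_0)
    then show ?thesis by (rule tendsto_ennrealD) (auto simp: \<delta>_def)
  qed
  have "\<kappa> * variance F \<le> (1 + e) * lim q" if e: "e > 0" for e
  proof (rule LIMSEQ_le_const)
    show "(\<lambda>n. (1 + e) * q n + \<kappa> * ((1 + 1 / e) * \<delta> n)) \<longlonglongrightarrow> (1 + e) * lim q"
      using tendsto_add[OF tendsto_mult_left[OF ql, of "1 + e"] tendsto_mult_left[OF tendsto_mult_left[OF \<delta>, of "1 + 1 / e"], of \<kappa>]] by simp
    have "\<kappa> * variance F \<le> (1 + e) * q n + \<kappa> * ((1 + 1 / e) * \<delta> n)" for n
    proof -
      have "\<kappa> * variance F \<le> \<kappa> * ((1 + e) * variance (Fs n) + (1 + 1 / e) * \<delta> n)"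
        unfolding \<delta>_def using \<kappa> by (intro mult_left_mono variance_add_young FL F_exp_L2 Fs e)
      also have "\<dots> = (1 + e) * (\<kappa> * variance (Fs n)) + \<kappa> * ((1 + 1 / e) * \<delta> n)" by (simp add: algebra_simps)
      also have "(1 + e) * (\<kappa> * variance (Fs n)) \<le> (1 + e) * q n" using e qv by (intro mult_left_mono) auto
      finally show ?thesis by simp
    qed
    then show "\<exists>N. \<forall>n\<ge>N. \<kappa> * variance F \<le> (1 + e) * q n + \<kappa> * ((1 + 1 / e) * \<delta> n)" by blast
  qed
  moreover have "((\<lambda>e. (1 + e) * lim q) \<longlongrightarrow> (1 + 0) * lim q) (at_right 0)"
    by (intro tendsto_intros)
  ultimately have "\<kappa> * variance F \<le> (1 + 0) * lim q"
    by (intro tendsto_lowerbound[of _ _ "at_right 0"]) (auto simp: eventually_at_right_less intro: eventually_mono[OF eventually_at_right_less])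
  moreover have "form_closure \<pi> (E0 a b z \<pi>) F_exp F F = lim q"
    by (simp add: form_closure_def Let_def Fs_def q_def[abs_def])
  ultimately show ?thesis by (simp add: \<kappa>_def)
qed

theorem corollary2:
  fixes a b :: "real ^ 'd \<Rightarrow> ennreal"
    and z :: real
    and \<pi> :: "(real ^ 'd) set measure"
  assumes "z > 0"
    and "poisson_measure z \<pi>"
    and "a \<in> borel_measurable borel" and "b \<in> borel_measurable borel"
    and "\<forall>x. a (- x) = a x" and "\<forall>x. b (- x) = b x"
    and "(\<integral>\<^sup>+x. a x \<partial>lborel) < \<infinity>" and "(\<integral>\<^sup>+x. b x \<partial>lborel) < \<infinity>"
    and "esssup lborel b < \<infinity>"
  shows "\<forall>F \<in> closure_dom \<pi> (E0 a b z \<pi>) F_exp.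
           form_closure \<pi> (E0 a b z \<pi>) F_exp F F
             \<ge> (integral_dx a)\<^sup>2 * z * integral_dx b
                 * (LINT \<gamma>|\<pi>. (F \<gamma> - (LINT \<gamma>'|\<pi>. F \<gamma>'))\<^sup>2)"
proof -
  have "prob_space \<pi>" using assms(2) by (simp add: poisson_measure_def)
  then interpret poisson_kernel \<pi> z b
    using assms by (auto simp: poisson_kernel_def poisson_space_def poisson_kernel_axioms_def poisson_space_axioms_def)
  show ?thesis using closure_poincare by (simp add: \<beta>_def)
qed

end
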